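(* Let the finite group $G=AB$ be a product of subgroups $A$ and $B$. Assume that $A$ is a normal subgroup of $G$ and that every Sylow subgroup of $B$ permutes with every maximal subgroup of every Sylow subgroup of $A$. If the derived subgroup $G'$ is nilpotent, then $$G^{w\mathfrak{U}}=A^{w\mathfrak{U}}B^{w\mathfrak{U}}.$$
   Context: All groups are finite. Two subgroups $X,Y$ of a group permute if $XY=YX$. Sylow subgroups are taken for all primes. A subgroup $H$ of a group $G$ is $\mathbb{P}$-subnormal in $G$ if either $H=G$ or there is a chain of subgroups $H=H_0\leqslant H_1\leqslant\cdots\leqslant H_n=G$ such that $|H_i:H_{i-1}|$ is a prime for every $i=1,\dots,n$. A group is $w$-supersoluble if every Sylow subgroup of it is $\mathbb{P}$-subnormal in it. The class $w\mathfrak{U}$ of all finite $w$-supersoluble groups is a (subgroup-closed saturated) formation, and for a finite group $X$, the residual $X^{w\mathfrak{U}}$ is the smallest normal subgroup $N$ of $X$ such that $X/N$ is $w$-supersoluble. *)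

theory Defs
  imports "HOL-Algebra.Sylow" "HOL-Algebra.Generated_Groups"
begin

text \<open>A subgroup \<open>H\<close> of \<open>G\<close>, regarded as a group in its own right, is
  \<open>G\<lparr>carrier := H\<rparr>\<close>, as in HOL-Algebra. All notions below are meant for finite groups.\<close>

definition permutes_with ::
  "('a, 'b) monoid_scheme \<Rightarrow> 'a set \<Rightarrow> 'a set \<Rightarrow> bool" where
  "permutes_with G X Y \<longleftrightarrow> X <#>\<^bsub>G\<^esub> Y = Y <#>\<^bsub>G\<^esub> X"

definition maximal_subgroup :: "'a set \<Rightarrow> ('a, 'b) monoid_scheme \<Rightarrow> bool" where
  "maximal_subgroup M G \<longleftrightarrow>
     subgroup M G \<and> M \<noteq> carrier G \<and>
     (\<forall>K. subgroup K G \<longrightarrow> M \<subseteq> K \<longrightarrow> K = M \<or> K = carrier G)"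

text \<open>The prime \<open>p\<close> need not divide the order: for the remaining primes the Sylow
  \<open>p\<close>-subgroup is trivial.\<close>

definition sylow_subgroup :: "'a set \<Rightarrow> ('a, 'b) monoid_scheme \<Rightarrow> bool" where
  "sylow_subgroup P G \<longleftrightarrow>
     (\<exists>p::nat. prime p \<and> subgroup P G \<and> card P = p ^ multiplicity p (order G))"

definition P_subnormal :: "'a set \<Rightarrow> ('a, 'b) monoid_scheme \<Rightarrow> bool" where
  "P_subnormal H G \<longleftrightarrow>
     subgroup H G \<and>
     (H = carrier G \<or>
      (\<exists>(n::nat) K. K 0 = H \<and> K n = carrier G \<and>
         (\<forall>i\<le>n. subgroup (K i) G) \<and>
         (\<forall>i\<in>{1..n}. K (i - 1) \<subseteq> K i \<and>
            prime (card (rcosets\<^bsub>G\<lparr>carrier := K i\<rparr>\<^esub> (K (i - 1)))))))"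

definition w_supersoluble :: "('a, 'b) monoid_scheme \<Rightarrow> bool" where
  "w_supersoluble G \<longleftrightarrow>
     group G \<and> finite (carrier G) \<and> (\<forall>P. sylow_subgroup P G \<longrightarrow> P_subnormal P G)"

text \<open>The order on \<open>'a set\<close> is inclusion, so the \<open>LEAST\<close> below is the smallest such
  normal subgroup; it exists for every finite group because the \<open>w\<close>-supersoluble groups
  form a formation.\<close>

definition wU_residual :: "('a, 'b) monoid_scheme \<Rightarrow> 'a set" where
  "wU_residual G = (LEAST N. N \<lhd> G \<and> w_supersoluble (G Mod N))"

primrec lower_central :: "('a, 'b) monoid_scheme \<Rightarrow> nat \<Rightarrow> 'a set" where
  "lower_central G 0 = carrier G"
| "lower_central G (Suc n) =
     generate G (\<Union>x\<in>lower_central G n. \<Union>y\<in>carrier G.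
       {x \<otimes>\<^bsub>G\<^esub> y \<otimes>\<^bsub>G\<^esub> inv\<^bsub>G\<^esub> x \<otimes>\<^bsub>G\<^esub> inv\<^bsub>G\<^esub> y})"

definition nilpotent_group :: "('a, 'b) monoid_scheme \<Rightarrow> bool" where
  "nilpotent_group G \<longleftrightarrow> group G \<and> (\<exists>n. lower_central G n = {\<one>\<^bsub>G\<^esub>})"

end

theory Submission
  imports Defs "HOL-Algebra.Group_Action" "HOL-Algebra.Multiplicative_Group" "HOL-Algebra.Zassenhaus"
    "HOL-Number_Theory.Residue_Primitive_Roots"
begin

text \<open>Supersolubility can be tested in \<open>G'\<close> alone, as \<open>G / G'\<close> is abelian, and there it is a matter
  of scalars. Let \<open>T\<close> be the \<open>p\<close>-part of the nilpotent group \<open>G'\<close>. Then \<open>G\<close> is \<open>w\<close>-supersoluble if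
  and only if, for all primes \<open>p \<noteq> q\<close>, the power \<open>x\<^sup>p\<^sup>-\<^sup>1\<close> of every \<open>q\<close>-element \<open>x\<close> centralizes
  \<open>T\<close>. In one direction, a chain with prime indices above a Sylow \<open>q\<close>-subgroup cuts \<open>T\<close> into factors
  of order \<open>1\<close> or \<open>p\<close>, and a group of order \<open>p\<close> has only \<open>p - 1\<close> automorphisms
  (\<open>P_subnormal_imp_scalar\<close>). In the other, the condition makes every element act on a chief factor
  inside \<open>G'\<close> as a scalar, so that these factors have prime order
  (\<open>minimal_derived_prime_order\<close>), all maximal subgroups have prime index
  (\<open>maximal_subgroup_prime_index\<close>) and all subgroups are P-subnormal.

  The commutators \<open>[x\<^sup>p\<^sup>-\<^sup>1, t]\<close> with \<open>t \<in> T\<close> are compatible with quotients, hence they generate the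
  residual (\<open>wU_residual_eq\<close>), and the theorem becomes the statement that the commutators of \<open>G\<close>
  already come from \<open>A\<close> and \<open>B\<close> (\<open>scalar_residual_product\<close>). By nilpotency of \<open>G'\<close>, it
  depends only on the coset modulo \<open>G'\<close> whether an element of order prime to \<open>p\<close> acts trivially on
  a given factor of \<open>T\<close> (\<open>p'_element_centralizes_factor\<close>). So \<open>x\<close> may be replaced by a product
  \<open>a c\<close> of a \<open>q\<close>-element of \<open>A\<close> and an element of a Sylow \<open>q\<close>-subgroup of \<open>B\<close>. Since \<open>A\<close> is
  normal, coprime action moves the commutators of \<open>a\<close> into the residual of \<open>A\<close>
  (\<open>normal_subgroup_contribution\<close>). For \<open>c\<close>, the group \<open>T\<close> is the product of the \<open>p\<close>-part of
  \<open>B'\<close>, which contributes to the residual of \<open>B\<close>, and of \<open>T \<inter> A\<close>, which contributes nothing: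
  this is the effect of permutability (\<open>permuting_sylow_centralizes\<close>).\<close>

section \<open>Commutators, powers and quotients\<close>

definition commutator :: "('a, 'b) monoid_scheme \<Rightarrow> 'a \<Rightarrow> 'a \<Rightarrow> 'a" where
  "commutator G x y = x \<otimes>\<^bsub>G\<^esub> y \<otimes>\<^bsub>G\<^esub> inv\<^bsub>G\<^esub> x \<otimes>\<^bsub>G\<^esub> inv\<^bsub>G\<^esub> y"

context group
begin

lemma inv_mult_cancel [simp]:
  "\<lbrakk>x \<in> carrier G; y \<in> carrier G\<rbrakk> \<Longrightarrow> inv x \<otimes> (x \<otimes> y) = y"
  "\<lbrakk>x \<in> carrier G; y \<in> carrier G\<rbrakk> \<Longrightarrow> x \<otimes> (inv x \<otimes> y) = y"
  by (simp_all add: m_assoc [symmetric])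

lemmas word_simps = m_assoc inv_mult_group

lemma commutator_closed [simp]:
  "\<lbrakk>x \<in> carrier G; y \<in> carrier G\<rbrakk> \<Longrightarrow> commutator G x y \<in> carrier G"
  by (simp add: commutator_def)

lemma commutator_one_iff:
  assumes "x \<in> carrier G" "y \<in> carrier G"
  shows "commutator G x y = \<one> \<longleftrightarrow> x \<otimes> y = y \<otimes> x"
proof -
  have "commutator G x y = (x \<otimes> y) \<otimes> inv (y \<otimes> x)"
    using assms by (simp add: commutator_def word_simps)
  then show ?thesis
    using assms by (metis inv_equality inv_inv inv_closed m_closed r_inv)
qed

lemma commutator_mult_eq:
  assumes "x \<in> carrier G" "y \<in> carrier G"
  shows "x \<otimes> y \<otimes> inv x = commutator G x y \<otimes> y"
  using assms by (simp add: commutator_def word_simps)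

lemma conj_commutator:
  assumes "g \<in> carrier G" "x \<in> carrier G" "y \<in> carrier G"
  shows "g \<otimes> commutator G x y \<otimes> inv g = commutator G (g \<otimes> x \<otimes> inv g) (g \<otimes> y \<otimes> inv g)"
  using assms by (simp add: commutator_def word_simps)

lemma inv_commutator:
  assumes "x \<in> carrier G" "y \<in> carrier G"
  shows "inv (commutator G x y) = commutator G y x"
  using assms by (simp add: commutator_def word_simps)

lemma inv_commutator_mult:
  assumes "x \<in> carrier G" "g \<in> carrier G"
  shows "inv (commutator G x g) \<otimes> x = g \<otimes> x \<otimes> inv g"
  using assms by (simp add: commutator_def word_simps)

lemma commutator_mem:
  assumes "subgroup H G" "x \<in> H" "y \<in> H"
  shows "commutator G x y \<in> H"
  unfolding commutator_def using assms by (intro subgroup.m_closed subgroup.m_inv_closed)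

lemma commutator_in_derived:
  assumes "x \<in> H" "y \<in> H"
  shows "commutator G x y \<in> derived G H"
  unfolding derived_def commutator_def using assms by (intro generate.incl) auto

lemma conj_pow:
  fixes n :: nat
  assumes "g \<in> carrier G" "x \<in> carrier G"
  shows "(g \<otimes> x \<otimes> inv g) [^] n = g \<otimes> x [^] n \<otimes> inv g"
proof (induction n)
  case (Suc n)
  then show ?case using assms by (simp add: word_simps)
qed (use assms in simp)

lemma pow_mem:
  fixes n :: nat
  assumes "subgroup H G" "x \<in> H"
  shows "x [^] n \<in> H"
  using assms by (induction n) (auto simp: subgroup.one_closed subgroup.m_closed)

lemma subgroup_conj_mem:
  assumes "subgroup H G" "g \<in> H" "x \<in> H"
  shows "g \<otimes> x \<otimes> inv g \<in> H"
  using subgroup.m_closed[OF assms(1) subgroup.m_closed[OF assms] subgroup.m_inv_closed[OF assms(1,2)]] .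

lemma set_mult_contains:
  assumes "subgroup H G" "subgroup K G"
  shows "H \<subseteq> H <#> K" "K \<subseteq> H <#> K"
proof -
  have "h = h \<otimes> \<one>" if "h \<in> H" for h using subgroup.mem_carrier[OF assms(1) that] by simp
  then show "H \<subseteq> H <#> K" using subgroup.one_closed[OF assms(2)] unfolding set_mult_def by blast
  have "k = \<one> \<otimes> k" if "k \<in> K" for k using subgroup.mem_carrier[OF assms(2) that] by simp
  then show "K \<subseteq> H <#> K" using subgroup.one_closed[OF assms(1)] unfolding set_mult_def by blast
qed

lemma pow_coprime_eq_one:
  fixes m n :: nat
  assumes "x \<in> carrier G" "x [^] m = \<one>" "x [^] n = \<one>" "coprime m n"
  shows "x = \<one>"
proof -
  have "ord x dvd m" "ord x dvd n"
    using assms by (simp_all add: pow_eq_id)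
  then have "ord x = 1"
    using assms(4) coprime_common_divisor_nat by blast
  then show ?thesis using assms(1) ord_eq_1 by blast
qed

lemma pow_coprime_mem:
  fixes m n :: nat
  assumes "subgroup H G" "x \<in> carrier G" "x [^] m \<in> H" "x [^] n \<in> H" "coprime m n"
  shows "x \<in> H"
proof (cases "m = 0")
  case True
  then show ?thesis using assms by simp
next
  case False
  then obtain a b where ab: "m * a = n * b + 1"
    using bezout_nat[of m n] assms(5) by auto
  have 1: "(x [^] m) [^] a = (x [^] n) [^] b \<otimes> x"
    using assms(2) ab by (simp add: nat_pow_pow)
  have "x = inv ((x [^] n) [^] b) \<otimes> (x [^] m) [^] a"
    unfolding 1 using assms(2) by simp
  then show ?thesis
    using assms by (metis pow_mem subgroup.m_closed subgroup.m_inv_closed)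
qed

lemma coprime_decomposition:
  fixes m n :: nat
  assumes "x \<in> carrier G" "x [^] (m * n) = \<one>" "coprime m n"
  obtains a b :: nat where "x = x [^] a \<otimes> x [^] b" "(x [^] a) [^] m = \<one>" "(x [^] b) [^] n = \<one>"
proof -
  obtain a where a: "[a = 1] (mod m)" "[a = 0] (mod n)"
    using binary_chinese_remainder_nat[OF assms(3)] by blast
  obtain b where b: "[b = 0] (mod m)" "[b = 1] (mod n)"
    using binary_chinese_remainder_nat[OF assms(3)] by blast
  have ord: "ord x dvd m * n"
    using assms by (simp add: pow_eq_id)
  have "[a + b = 1 + 0] (mod m)" "[a + b = 0 + 1] (mod n)"
    using a b by (blast intro: cong_add)+
  then have "[a + b = 1] (mod (m * n))"
    using assms(3) coprime_cong_mult_nat by simp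
  then have "[a + b = 1] (mod ord x)"
    using ord cong_dvd_modulus_nat by blast
  then have "int (ord x) dvd int 1 - int (a + b)"
    by (metis cong_iff_dvd_diff cong_int_iff cong_sym)
  then have "x [^] (a + b) = x [^] (1::nat)"
    using int_pow_eq[OF assms(1), of "int (a + b)" "int 1"] assms(1) by (simp only: int_pow_int)
  then have "x = x [^] a \<otimes> x [^] b"
    using assms(1) by (simp add: nat_pow_mult)
  moreover have "n dvd a" "m dvd b"
    using a b by (simp_all add: cong_0_iff)
  then have "m * n dvd a * m" "m * n dvd b * n"
    by (auto simp: mult.commute mult_dvd_mono)
  then have "(x [^] a) [^] m = \<one>" "(x [^] b) [^] n = \<one>"
    using dvd_trans[OF ord] assms(1) by (auto simp only: nat_pow_pow pow_eq_id)
  ultimately show thesis using that by blast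
qed

lemma commutator_pow_left:
  fixes m :: nat
  assumes "z \<in> carrier G" "h \<in> carrier G"
    and "commutator G z h \<otimes> z = z \<otimes> commutator G z h"
  shows "commutator G (z [^] m) h = commutator G z h [^] m"
proof -
  define c where "c = commutator G z h"
  have c: "c \<in> carrier G" using assms by (simp add: c_def)
  have eq: "h \<otimes> inv z \<otimes> inv h = inv z \<otimes> c"
    using assms unfolding c_def commutator_def by (simp add: word_simps)
  have comm: "inv z \<otimes> c = c \<otimes> inv z"
    using assms(3) c assms(1) unfolding c_def[symmetric]
    by (metis inv_closed inv_solve_left m_assoc m_closed r_inv r_one)
  have zc: "(inv z \<otimes> c) [^] m = inv z [^] m \<otimes> c [^] m"
    using pow_mult_distrib[OF comm] c assms by simp
  have "commutator G (z [^] m) h = z [^] m \<otimes> (h \<otimes> (inv z) [^] m \<otimes> inv h)"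
    using assms by (simp add: commutator_def word_simps nat_pow_inv)
  also have "\<dots> = z [^] m \<otimes> (inv z \<otimes> c) [^] m"
    using conj_pow[of h "inv z" m] assms eq by simp
  also have "\<dots> = c [^] m"
    unfolding zc using assms c by (simp add: nat_pow_inv)
  finally show ?thesis by (simp add: c_def)
qed

end

lemma (in normal) in_mod_eq_one_iff:
  assumes "x \<in> carrier G"
  shows "H #> x = \<one>\<^bsub>G Mod H\<^esub> \<longleftrightarrow> x \<in> H"
  using assms by (metis coset_join1 coset_join2 is_subgroup one_FactGroup subset)

lemma (in normal) mod_hom: "group_hom G (G Mod H) (\<lambda>x. H #> x)"
  by (simp add: group_hom_def group_hom_axioms_def is_group factorgroup_is_group r_coset_hom_Mod)

lemma (in group_hom) hom_commutator:
  assumes "x \<in> carrier G" "y \<in> carrier G"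
  shows "h (commutator G x y) = commutator H (h x) (h y)"
  using assms by (simp add: commutator_def)

lemma (in normal) pow_mult_mem:
  assumes "x \<in> carrier G" "y \<in> carrier G" "commutator G x y \<in> H"
    and "x [^] (m::nat) \<in> H" "y [^] m \<in> H"
  shows "(x \<otimes> y) [^] m \<in> H"
proof -
  interpret \<pi>: group_hom G "G Mod H" "\<lambda>x. H #> x" by (rule mod_hom)
  have "commutator (G Mod H) (H #> x) (H #> y) = \<one>\<^bsub>G Mod H\<^esub>"
    using assms(1-3) by (simp only: in_mod_eq_one_iff commutator_closed flip: \<pi>.hom_commutator)
  then have comm: "(H #> x) \<otimes>\<^bsub>G Mod H\<^esub> (H #> y) = (H #> y) \<otimes>\<^bsub>G Mod H\<^esub> (H #> x)"
    using assms(1,2) by (simp only: \<pi>.H.commutator_one_iff \<pi>.hom_closed)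
  have "H #> ((x \<otimes> y) [^] m) = ((H #> x) \<otimes>\<^bsub>G Mod H\<^esub> (H #> y)) [^]\<^bsub>G Mod H\<^esub> m"
    using assms(1,2) by (simp only: \<pi>.hom_nat_pow \<pi>.hom_mult m_closed)
  also have "\<dots> = (H #> (x [^] m)) \<otimes>\<^bsub>G Mod H\<^esub> (H #> (y [^] m))"
    using assms(1,2) by (simp only: \<pi>.H.pow_mult_distrib[OF comm] \<pi>.hom_closed \<pi>.hom_nat_pow)
  also have "\<dots> = \<one>\<^bsub>G Mod H\<^esub>"
  proof -
    have "H #> (x [^] m) = \<one>\<^bsub>G Mod H\<^esub>" "H #> (y [^] m) = \<one>\<^bsub>G Mod H\<^esub>"
      using assms by (simp_all only: in_mod_eq_one_iff nat_pow_closed)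
    then show ?thesis by (simp only: \<pi>.H.l_one \<pi>.H.one_closed)
  qed
  finally show ?thesis
    using in_mod_eq_one_iff[of "(x \<otimes> y) [^] m"] assms(1,2) by (simp only: nat_pow_closed m_closed)
qed

lemma (in normal) commutator_pow_mem:
  assumes "z \<in> carrier G" "h \<in> carrier G"
    and "commutator G (commutator G z h) z \<in> H" "commutator G (z [^] (m::nat)) h \<in> H"
  shows "commutator G z h [^] m \<in> H"
proof -
  interpret \<pi>: group_hom G "G Mod H" "\<lambda>x. H #> x" by (rule mod_hom)
  define a b where "a = H #> z" and "b = H #> h"
  have ab: "a \<in> carrier (G Mod H)" "b \<in> carrier (G Mod H)"
    using assms(1,2) \<pi>.hom_closed by (simp_all only: a_def b_def)
  have "commutator (G Mod H) (commutator (G Mod H) a b) a = H #> commutator G (commutator G z h) z"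
    using assms(1,2) by (simp only: a_def b_def commutator_closed \<pi>.hom_commutator)
  also have "\<dots> = \<one>\<^bsub>G Mod H\<^esub>"
    using assms(1-3) by (simp only: in_mod_eq_one_iff commutator_closed)
  finally have "commutator (G Mod H) a b \<otimes>\<^bsub>G Mod H\<^esub> a = a \<otimes>\<^bsub>G Mod H\<^esub> commutator (G Mod H) a b"
    using ab by (simp only: \<pi>.H.commutator_one_iff \<pi>.H.commutator_closed)
  then have "commutator (G Mod H) a b [^]\<^bsub>G Mod H\<^esub> m = commutator (G Mod H) (a [^]\<^bsub>G Mod H\<^esub> m) b"
    using \<pi>.H.commutator_pow_left[OF ab] by (simp only:)
  also have "\<dots> = H #> commutator G (z [^] m) h"
    using assms(1,2) by (simp only: a_def b_def nat_pow_closed \<pi>.hom_commutator \<pi>.hom_nat_pow)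
  also have "\<dots> = \<one>\<^bsub>G Mod H\<^esub>"
    using assms(1,2,4) by (simp only: in_mod_eq_one_iff commutator_closed nat_pow_closed)
  finally have "H #> (commutator G z h [^] m) = \<one>\<^bsub>G Mod H\<^esub>"
    using assms(1,2) by (simp only: a_def b_def commutator_closed \<pi>.hom_commutator \<pi>.hom_nat_pow)
  then show ?thesis
    using assms(1,2) by (simp only: in_mod_eq_one_iff commutator_closed nat_pow_closed)
qed

definition centralizer_mod :: "('a, 'b) monoid_scheme \<Rightarrow> 'a set \<Rightarrow> 'a set \<Rightarrow> 'a set" where
  "centralizer_mod G K T = {c \<in> carrier G. \<forall>t\<in>T. commutator G c t \<in> K}"

context group
begin

lemma subgroup_centralizer_mod:
  assumes T: "T \<lhd> G" and K: "subgroup K G"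
  shows "subgroup (centralizer_mod G K T) G"
proof (rule subgroupI)
  have Tc: "t \<in> T \<Longrightarrow> t \<in> carrier G" for t using subgroup.mem_carrier[OF normal_imp_subgroup[OF T]] .
  show "centralizer_mod G K T \<subseteq> carrier G" unfolding centralizer_mod_def by blast
  have "commutator G \<one> t = \<one>" if "t \<in> T" for t using commutator_one_iff[of \<one> t] Tc[OF that] by simp
  then have "\<one> \<in> centralizer_mod G K T" using subgroup.one_closed[OF K] unfolding centralizer_mod_def by simp
  then show "centralizer_mod G K T \<noteq> {}" by blast
  fix a assume "a \<in> centralizer_mod G K T"
  then have a: "a \<in> carrier G" "\<And>t. t \<in> T \<Longrightarrow> commutator G a t \<in> K" unfolding centralizer_mod_def by blast+
  have "commutator G (inv a) t \<in> K" if t: "t \<in> T" for t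
  proof -
    have s: "inv a \<otimes> t \<otimes> a \<in> T" using normal_invE(2)[OF T, of "inv a" t] a(1) t by simp
    have "commutator G (inv a) t = inv (commutator G a (inv a \<otimes> t \<otimes> a))"
      using a(1) Tc[OF t] by (simp add: commutator_def word_simps)
    then show ?thesis using subgroup.m_inv_closed[OF K a(2)[OF s]] by simp
  qed
  then show "inv a \<in> centralizer_mod G K T" using a(1) unfolding centralizer_mod_def by simp
  fix b assume "b \<in> centralizer_mod G K T"
  then have b: "b \<in> carrier G" "\<And>t. t \<in> T \<Longrightarrow> commutator G b t \<in> K" unfolding centralizer_mod_def by blast+
  have "commutator G (a \<otimes> b) t \<in> K" if t: "t \<in> T" for t
  proof -
    have "commutator G (a \<otimes> b) t = commutator G a (b \<otimes> t \<otimes> inv b) \<otimes> commutator G b t"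
      using a(1) b(1) Tc[OF t] by (simp add: commutator_def word_simps)
    then show ?thesis
      using subgroup.m_closed[OF K a(2)[OF normal_invE(2)[OF T b(1) t]] b(2)[OF t]] by simp
  qed
  then show "a \<otimes> b \<in> centralizer_mod G K T" using a(1) b(1) unfolding centralizer_mod_def by simp
qed

lemma conj_centralizer_mod:
  assumes T: "T \<lhd> G" and g: "g \<in> carrier G" "\<And>k. k \<in> K \<Longrightarrow> g \<otimes> k \<otimes> inv g \<in> K"
    and c: "c \<in> centralizer_mod G K T"
  shows "g \<otimes> c \<otimes> inv g \<in> centralizer_mod G K T"
proof -
  have cc: "c \<in> carrier G" using c unfolding centralizer_mod_def by blast
  have "commutator G (g \<otimes> c \<otimes> inv g) t \<in> K" if t: "t \<in> T" for t
  proof -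
    have tc: "t \<in> carrier G" using subgroup.mem_carrier[OF normal_imp_subgroup[OF T] t] .
    have "inv g \<otimes> t \<otimes> g \<in> T" using normal_invE(2)[OF T, of "inv g" t] g(1) t by simp
    then have "g \<otimes> commutator G c (inv g \<otimes> t \<otimes> g) \<otimes> inv g \<in> K"
      using g(2) c unfolding centralizer_mod_def by blast
    then show ?thesis using g(1) cc tc by (simp add: commutator_def word_simps)
  qed
  then show ?thesis using g(1) cc unfolding centralizer_mod_def by simp
qed

end

section \<open>Nilpotency\<close>

context group
begin

lemma lower_central_subgroup: "subgroup (lower_central G n) G"
proof (induction n)
  case 0
  show ?case by (simp add: subgroup_self)
next
  case (Suc n)
  have "lower_central G n \<subseteq> carrier G" by (rule subgroup.subset[OF Suc])
  then show ?case by (auto intro!: generate_is_subgroup)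
qed

lemma lower_central_commutator:
  assumes "x \<in> lower_central G n" "y \<in> carrier G"
  shows "commutator G x y \<in> lower_central G (Suc n)"
  unfolding lower_central.simps commutator_def
  using assms by (intro generate.incl) blast

lemma lower_central_decreasing: "lower_central G (Suc n) \<subseteq> lower_central G n"
proof (induction n)
  case 0
  show ?case
    using subgroup.subset[OF lower_central_subgroup[of "Suc 0"]] by simp
next
  case (Suc n)
  show ?case
    unfolding lower_central.simps(2)[of G "Suc n"]
  proof (rule generate_subgroup_incl[OF _ lower_central_subgroup])
    show "(\<Union>x\<in>lower_central G (Suc n). \<Union>y\<in>carrier G. {x \<otimes> y \<otimes> inv x \<otimes> inv y})
       \<subseteq> lower_central G (Suc n)"
      using Suc lower_central_commutator[unfolded commutator_def] by blast
  qed
qed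

lemma lower_central_normal: "lower_central G n \<lhd> G"
proof (rule normal_invI[OF lower_central_subgroup])
  fix g x assume g: "g \<in> carrier G" and x: "x \<in> lower_central G n"
  have xc: "x \<in> carrier G"
    using subgroup.mem_carrier[OF lower_central_subgroup x] .
  have "commutator G x g \<in> lower_central G n"
    using lower_central_commutator[OF x g] lower_central_decreasing by blast
  then have "inv (commutator G x g) \<otimes> x \<in> lower_central G n"
    using x lower_central_subgroup subgroup.m_closed subgroup.m_inv_closed by metis
  moreover have "inv (commutator G x g) \<otimes> x = g \<otimes> x \<otimes> inv g"
    using g xc by (rule inv_commutator_mult[rotated])
  ultimately show "g \<otimes> x \<otimes> inv g \<in> lower_central G n" by simp
qed

text \<open>Commutation with a fixed element is bilinear on the factors of the lower central series, so
  the exponent of the generators bounds the exponent of every factor.\<close>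
lemma lower_central_exponent:
  assumes X: "carrier G = generate G X" "X \<subseteq> carrier G" "\<And>x. x \<in> X \<Longrightarrow> x [^] (m::nat) = \<one>"
    and "z \<in> lower_central G n"
  shows "z [^] m \<in> lower_central G (Suc n)"
  using assms(4)
proof (induction n arbitrary: z)
  case (0 z)
  define N where "N = lower_central G (Suc 0)"
  interpret N: normal N G unfolding N_def by (rule lower_central_normal)
  have "z \<in> generate G X" using 0 X by simp
  then have "z \<in> carrier G \<and> z [^] m \<in> N"
  proof (induction z rule: generate.induct)
    case one then show ?case using N.one_closed by simp
  next
    case (incl h)
    then have "h \<in> carrier G" "h [^] m = \<one>" using X(2,3) by blast+
    then show ?case using N.one_closed by simp
  next
    case (inv h)
    then have "h \<in> carrier G" "h [^] m = \<one>" using X(2,3) by blast+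
    then show ?case using N.one_closed nat_pow_inv by simp
  next
    case (eng g h)
    have "commutator G g h \<in> N"
      unfolding N_def using lower_central_commutator[of g 0 h] eng(3,4) by (simp only: lower_central.simps(1) simp_thms)
    then show ?case
      using eng(3,4) N.pow_mult_mem[of g h m] by (simp only: m_closed simp_thms)
  qed
  then show ?case by (simp only: N_def)
next
  case (Suc n z)
  define L where "L = lower_central G (Suc n)"
  define N where "N = lower_central G (Suc (Suc n))"
  interpret N: normal N G unfolding N_def by (rule lower_central_normal)
  have Lc: "x \<in> L \<Longrightarrow> x \<in> carrier G" for x
    unfolding L_def using subgroup.mem_carrier[OF lower_central_subgroup] by blast
  have gen: "(x \<otimes> y \<otimes> inv x \<otimes> inv y) [^] m \<in> N"
    if x: "x \<in> lower_central G n" and y: "y \<in> carrier G" for x y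
  proof -
    have xc: "x \<in> carrier G" using subgroup.mem_carrier[OF lower_central_subgroup x] .
    have cL: "commutator G x y \<in> L" unfolding L_def by (rule lower_central_commutator[OF x y])
    have "commutator G x y [^] m \<in> N"
    proof (rule N.commutator_pow_mem[OF xc y])
      show "commutator G (commutator G x y) x \<in> N"
        using cL xc lower_central_commutator unfolding L_def N_def by blast
      show "commutator G (x [^] m) y \<in> N"
        unfolding N_def by (rule lower_central_commutator[OF Suc.IH[OF x] y])
    qed
    then show ?thesis by (simp only: commutator_def)
  qed
  have "z \<in> generate G (\<Union>x\<in>lower_central G n. \<Union>y\<in>carrier G. {x \<otimes> y \<otimes> inv x \<otimes> inv y})"
    using Suc.prems by simp
  then have "z \<in> L \<and> z [^] m \<in> N"
  proof (induction z rule: generate.induct)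
    case one then show ?case
      using N.one_closed subgroup.one_closed[OF lower_central_subgroup[of "Suc n"]]
      unfolding L_def nat_pow_one by blast
  next
    case (incl h)
    then obtain x y where "x \<in> lower_central G n" "y \<in> carrier G" "h = x \<otimes> y \<otimes> inv x \<otimes> inv y"
      by blast
    then show ?case
      using gen[of x y] lower_central_commutator[of x n y] by (simp only: commutator_def L_def simp_thms)
  next
    case (inv h)
    then obtain x y where "x \<in> lower_central G n" "y \<in> carrier G" "h = x \<otimes> y \<otimes> inv x \<otimes> inv y"
      by blast
    then have h: "h \<in> L" "h [^] m \<in> N"
      using gen[of x y] lower_central_commutator[of x n y] by (simp_all only: commutator_def L_def)
    then have "inv h [^] m \<in> N" using Lc nat_pow_inv N.m_inv_closed by simp
    then show ?case
      using h subgroup.m_inv_closed[OF lower_central_subgroup, of h "Suc n"] by (simp only: L_def simp_thms)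
  next
    case (eng g h)
    then have gh: "g \<in> L" "h \<in> L" "g \<in> carrier G" "h \<in> carrier G" using Lc by (simp_all only: simp_thms)
    have "commutator G g h \<in> N"
      unfolding N_def using lower_central_commutator[of g "Suc n" h] gh by (simp only: L_def)
    then have "(g \<otimes> h) [^] m \<in> N"
      using eng(3,4) gh N.pow_mult_mem[of g h m] by (simp only: simp_thms)
    then show ?case
      using gh subgroup.m_closed[OF lower_central_subgroup, of g "Suc n" h] by (simp only: L_def simp_thms)
  qed
  then show ?case by (simp only: N_def)
qed

lemma lower_central_generated_exponent:
  assumes X: "carrier G = generate G X" "X \<subseteq> carrier G" "\<And>x. x \<in> X \<Longrightarrow> x [^] (m::nat) = \<one>"
    and "z \<in> carrier G"
  shows "z [^] (m ^ n) \<in> lower_central G n"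
proof (induction n)
  case (Suc n)
  show ?case
    using lower_central_exponent[OF X Suc] assms(4) by (simp add: nat_pow_pow mult.commute)
qed (use assms in simp)

end

text \<open>Nilpotency of a subgroup, witnessed by some descending central series. Unlike the lower
  central series, such a series can simply be intersected with a subgroup or mapped to an image.\<close>
definition nilpotent_in :: "('a, 'b) monoid_scheme \<Rightarrow> 'a set \<Rightarrow> bool" where
  "nilpotent_in G D \<longleftrightarrow> (\<exists>n L. L 0 = D \<and> L (n::nat) = {\<one>\<^bsub>G\<^esub>} \<and>
     (\<forall>i. subgroup (L i) G \<and> L (Suc i) \<subseteq> L i \<and>
       (\<forall>x\<in>L i. \<forall>y\<in>D. commutator G x y \<in> L (Suc i))))"

lemma nilpotent_inE:
  assumes "nilpotent_in G D"
  obtains n L where "L 0 = D" "L (n::nat) = {\<one>\<^bsub>G\<^esub>}" "\<And>i. subgroup (L i) G"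
    "\<And>i. L (Suc i) \<subseteq> L i" "\<And>i. L i \<subseteq> D"
    "\<And>i x y. \<lbrakk>x \<in> L i; y \<in> D\<rbrakk> \<Longrightarrow> commutator G x y \<in> L (Suc i)"
proof -
  obtain n L where L: "L 0 = D" "L (n::nat) = {\<one>\<^bsub>G\<^esub>}" "\<And>i. subgroup (L i) G"
    "\<And>i. L (Suc i) \<subseteq> L i" "\<And>i x y. \<lbrakk>x \<in> L i; y \<in> D\<rbrakk> \<Longrightarrow> commutator G x y \<in> L (Suc i)"
    using assms unfolding nilpotent_in_def by metis
  have "L i \<subseteq> D" for i
    by (induction i) (use L(1,4) in blast)+
  then show thesis by (rule that[OF L(1-4) _ L(5)])
qed

context group
begin

lemma commutator_consistent:
  assumes "subgroup H G" "x \<in> H" "y \<in> H"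
  shows "commutator (G\<lparr>carrier := H\<rparr>) x y = commutator G x y"
  using assms by (simp add: commutator_def)

lemma nilpotent_in_if_nilpotent_group:
  assumes "subgroup D G" "nilpotent_group (G\<lparr>carrier := D\<rparr>)"
  shows "nilpotent_in G D"
proof -
  define H where "H = G\<lparr>carrier := D\<rparr>"
  interpret H: group H
    unfolding H_def using assms(1) by (rule subgroup_imp_group)
  obtain n where n: "lower_central H n = {\<one>\<^bsub>H\<^esub>}"
    using assms(2) unfolding nilpotent_group_def H_def by blast
  show ?thesis
    unfolding nilpotent_in_def
  proof (intro exI[of _ n] exI[of _ "lower_central H"] conjI allI ballI)
    fix i
    show "subgroup (lower_central H i) G"
      using incl_subgroup[OF assms(1)] H.lower_central_subgroup unfolding H_def by blast
    show "lower_central H (Suc i) \<subseteq> lower_central H i"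
      by (rule H.lower_central_decreasing)
    fix x y assume "x \<in> lower_central H i" "y \<in> D"
    moreover have "lower_central H i \<subseteq> D"
      using subgroup.subset[OF H.lower_central_subgroup] unfolding H_def by simp
    ultimately show "commutator G x y \<in> lower_central H (Suc i)"
      using H.lower_central_commutator[of x i y] commutator_consistent[OF assms(1), of x y]
      unfolding H_def by auto
  qed (use n in \<open>simp_all add: H_def\<close>)
qed

lemma nilpotent_in_subset:
  assumes "nilpotent_in G D" "subgroup E G" "E \<subseteq> D"
  shows "nilpotent_in G E"
proof -
  obtain n L where L: "L 0 = D" "L (n::nat) = {\<one>}" "\<And>i. subgroup (L i) G"
    "\<And>i. L (Suc i) \<subseteq> L i" "\<And>i. L i \<subseteq> D"
    "\<And>i x y. \<lbrakk>x \<in> L i; y \<in> D\<rbrakk> \<Longrightarrow> commutator G x y \<in> L (Suc i)"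
    using nilpotent_inE[OF assms(1)] by metis
  show ?thesis
    unfolding nilpotent_in_def
  proof (intro exI[of _ n] exI[of _ "\<lambda>i. L i \<inter> E"] conjI allI ballI)
    fix i
    show "subgroup (L i \<inter> E) G" by (rule subgroups_Inter_pair[OF L(3) assms(2)])
    show "L (Suc i) \<inter> E \<subseteq> L i \<inter> E" using L(4) by blast
    fix x y assume "x \<in> L i \<inter> E" "y \<in> E"
    then show "commutator G x y \<in> L (Suc i) \<inter> E"
      using L(6) assms(3) commutator_mem[OF assms(2)] by blast
  qed (use L assms subgroup.one_closed in auto)
qed

lemma nilpotent_in_restrict:
  assumes "nilpotent_in G D" "subgroup H G" "D \<subseteq> H"
  shows "nilpotent_in (G\<lparr>carrier := H\<rparr>) D"
proof -
  obtain n L where L: "L 0 = D" "L (n::nat) = {\<one>}" "\<And>i. subgroup (L i) G"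
    "\<And>i. L (Suc i) \<subseteq> L i" "\<And>i. L i \<subseteq> D"
    "\<And>i x y. \<lbrakk>x \<in> L i; y \<in> D\<rbrakk> \<Longrightarrow> commutator G x y \<in> L (Suc i)"
    using nilpotent_inE[OF assms(1)] by metis
  show ?thesis
    unfolding nilpotent_in_def
  proof (intro exI[of _ n] exI[of _ L] conjI allI ballI)
    fix i
    show "subgroup (L i) (G\<lparr>carrier := H\<rparr>)"
      by (rule subgroup_incl[OF L(3) assms(2)]) (use L(5) assms(3) in blast)
    show "L (Suc i) \<subseteq> L i" by (rule L(4))
    fix x y assume *: "x \<in> L i" "y \<in> D"
    then have "x \<in> H" "y \<in> H" using L(5) assms(3) by blast+
    then show "commutator (G\<lparr>carrier := H\<rparr>) x y \<in> L (Suc i)"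
      using L(6)[OF *] commutator_consistent[OF assms(2)] by simp
  qed (use L in auto)
qed

text \<open>If \<open>L\<^sub>i\<close> is the last term of the central series not contained in \<open>M\<close>, then
  \<open>[L\<^sub>i, M] \<subseteq> M\<close>.\<close>
lemma nilpotent_in_normalizer_grows:
  assumes "nilpotent_in G D" "subgroup M G" "M \<subset> D"
  obtains x where "x \<in> D" "x \<notin> M" "\<And>h. h \<in> M \<Longrightarrow> x \<otimes> h \<otimes> inv x \<in> M"
proof -
  obtain n L where L: "L 0 = D" "L (n::nat) = {\<one>}" "\<And>i. subgroup (L i) G"
    "\<And>i. L (Suc i) \<subseteq> L i" "\<And>i. L i \<subseteq> D"
    "\<And>i x y. \<lbrakk>x \<in> L i; y \<in> D\<rbrakk> \<Longrightarrow> commutator G x y \<in> L (Suc i)"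
    using nilpotent_inE[OF assms(1)] by metis
  have "L n \<subseteq> M" using L(2) assms(2) subgroup.one_closed by auto
  moreover have "\<not> L 0 \<subseteq> M" using L(1) assms(3) by blast
  ultimately obtain i where i: "\<not> L i \<subseteq> M" "L (Suc i) \<subseteq> M"
    using inc_induct[of 0 n "\<lambda>i. L i \<subseteq> M"] by blast
  then obtain x where x: "x \<in> L i" "x \<notin> M" by blast
  have "x \<otimes> h \<otimes> inv x \<in> M" if h: "h \<in> M" for h
  proof -
    have "commutator G x h \<in> M" using L(6)[OF x(1)] i(2) assms(3) h by blast
    then have "commutator G x h \<otimes> h \<in> M" using assms(2) h subgroup.m_closed by metis
    then show ?thesis
      using commutator_mult_eq subgroup.mem_carrier[OF L(3) x(1)] subgroup.mem_carrier[OF assms(2) h]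
      by simp
  qed
  then show thesis using that x L(5) by blast
qed

lemma nilpotent_in_center:
  assumes "nilpotent_in G D" "D \<noteq> {\<one>}"
  obtains z where "z \<in> D" "z \<noteq> \<one>" "\<And>d. d \<in> D \<Longrightarrow> z \<otimes> d = d \<otimes> z"
proof -
  obtain n L where L: "L 0 = D" "L (n::nat) = {\<one>}" "\<And>i. subgroup (L i) G"
    "\<And>i. L (Suc i) \<subseteq> L i" "\<And>i. L i \<subseteq> D"
    "\<And>i x y. \<lbrakk>x \<in> L i; y \<in> D\<rbrakk> \<Longrightarrow> commutator G x y \<in> L (Suc i)"
    using nilpotent_inE[OF assms(1)] by metis
  have D: "subgroup D G" using L(1,3) by metis
  obtain i where i: "\<not> L i \<subseteq> {\<one>}" "L (Suc i) \<subseteq> {\<one>}"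
    using inc_induct[of 0 n "\<lambda>i. L i \<subseteq> {\<one>}"] L(1,2) assms(2) subgroup.one_closed[OF D] by blast
  then obtain z where z: "z \<in> L i" "z \<noteq> \<one>" by blast
  have "z \<otimes> d = d \<otimes> z" if "d \<in> D" for d
    using L(6)[OF z(1) that] i(2) commutator_one_iff subgroup.mem_carrier[OF L(3) z(1)]
      subgroup.mem_carrier[OF D that] by blast
  then show thesis using that z L(5) by blast
qed

text \<open>For elements \<open>x\<close>, \<open>y\<close> of coprime orders the commutator is forced down the central series:
  if it lies in one term, then modulo the next term its order divides both orders.\<close>
lemma nilpotent_in_coprime_commute:
  assumes "nilpotent_in G D" "x \<in> D" "y \<in> D"
    and "x [^] (m::nat) = \<one>" "y [^] (n::nat) = \<one>" "coprime m n"
  shows "x \<otimes> y = y \<otimes> x"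
proof -
  obtain k L where L: "L 0 = D" "L (k::nat) = {\<one>}" "\<And>i. subgroup (L i) G"
    "\<And>i. L (Suc i) \<subseteq> L i" "\<And>i. L i \<subseteq> D"
    "\<And>i x y. \<lbrakk>x \<in> L i; y \<in> D\<rbrakk> \<Longrightarrow> commutator G x y \<in> L (Suc i)"
    using nilpotent_inE[OF assms(1)] by metis
  have D: "subgroup D G" using L(1,3) by metis
  define H where "H = G\<lparr>carrier := D\<rparr>"
  interpret H: group H
    unfolding H_def using D by (rule subgroup_imp_group)
  have H_simps [simp]: "carrier H = D" "monoid.mult H = monoid.mult G" "one H = \<one>" by (simp_all add: H_def)
  have H_pow [simp]: "a [^]\<^bsub>H\<^esub> (j::nat) = a [^] j" for a j
    unfolding H_def by (rule nat_pow_consistent[symmetric])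
  have H_com: "a \<in> D \<Longrightarrow> b \<in> D \<Longrightarrow> commutator H a b = commutator G a b" for a b
    using commutator_consistent[OF D] by (simp add: H_def)
  have "commutator H x y \<in> L i" for i
  proof (induction i)
    case 0
    then show ?case using H.commutator_closed[of x y] assms L(1) by simp
  next
    case (Suc i)
    define c where "c = commutator H x y"
    define N where "N = L (Suc i)"
    have NH: "subgroup N H"
      unfolding N_def H_def by (rule subgroup_incl[OF L(3) D L(5)])
    have c: "c \<in> L i" "c \<in> D" using Suc L(5) by (auto simp: c_def)
    have N: "N \<lhd> H"
    proof (rule H.normal_invI[OF NH])
      fix g h assume g: "g \<in> carrier H" and h: "h \<in> N"
      have hD: "h \<in> D" using h L(5) N_def by blast
      have "commutator G h g \<in> N" using L(4,6) g h unfolding N_def by fastforce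
      then have "inv\<^bsub>H\<^esub> (commutator H h g) \<otimes>\<^bsub>H\<^esub> h \<in> N"
        using H_com[of h g] g hD NH h subgroup.m_closed subgroup.m_inv_closed by (metis H_simps(1))
      moreover have "inv\<^bsub>H\<^esub> (commutator H h g) \<otimes>\<^bsub>H\<^esub> h = g \<otimes>\<^bsub>H\<^esub> h \<otimes>\<^bsub>H\<^esub> inv\<^bsub>H\<^esub> g"
        using g hD by (intro H.inv_commutator_mult) simp_all
      ultimately show "g \<otimes>\<^bsub>H\<^esub> h \<otimes>\<^bsub>H\<^esub> inv\<^bsub>H\<^esub> g \<in> N" by simp
    qed
    interpret N: normal N H by (rule N)
    have next_term: "commutator H d e \<in> N" if "d \<in> L i" "e \<in> D" for d e
      using L(6)[OF that] H_com[of d e] that L(5) unfolding N_def by fastforce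
    have xy: "x \<in> carrier H" "y \<in> carrier H" using assms by simp_all
    have one: "commutator H \<one>\<^bsub>H\<^esub> e \<in> N" if e: "e \<in> carrier H" for e
    proof -
      have "commutator H \<one>\<^bsub>H\<^esub> e = \<one>\<^bsub>H\<^esub>"
        using e by (simp only: H.commutator_one_iff H.one_closed H.l_one H.r_one)
      then show ?thesis using N.one_closed by (simp only:)
    qed
    have 1: "c [^]\<^bsub>H\<^esub> m \<in> N"
      unfolding c_def
    proof (rule N.commutator_pow_mem[OF xy])
      show "commutator H (commutator H x y) x \<in> N"
        using next_term c assms unfolding c_def by blast
      show "commutator H (x [^]\<^bsub>H\<^esub> m) y \<in> N"
        using one[OF xy(2)] assms by simp
    qed
    have c': "inv\<^bsub>H\<^esub> c = commutator H y x"
      unfolding c_def by (rule H.inv_commutator[OF xy])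
    have "inv\<^bsub>H\<^esub> c \<in> L i"
      using c L(3) D m_inv_consistent[OF D c(2)] subgroup.m_inv_closed unfolding H_def by metis
    then have "commutator H y x [^]\<^bsub>H\<^esub> n \<in> N"
      unfolding c'
    proof (intro N.commutator_pow_mem[OF xy(2,1)])
      assume "commutator H y x \<in> L i"
      then show "commutator H (commutator H y x) y \<in> N"
        using next_term assms by blast
      show "commutator H (y [^]\<^bsub>H\<^esub> n) x \<in> N"
        using one[OF xy(1)] assms by simp
    qed
    then have "inv\<^bsub>H\<^esub> (c [^]\<^bsub>H\<^esub> n) \<in> N"
      using H.nat_pow_inv[of c n] c c' by simp
    then have 2: "c [^]\<^bsub>H\<^esub> n \<in> N"
      using c by (metis H.inv_inv H.nat_pow_closed H_simps(1) N.m_inv_closed)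
    show ?case
      using H.pow_coprime_mem[OF NH _ 1 2 assms(6)] c by (simp add: c_def N_def)
  qed
  then have "commutator G x y = \<one>"
    using L(2) H_com assms by (metis singletonD)
  then show ?thesis
    using commutator_one_iff subgroup.mem_carrier[OF D] assms by blast
qed

text \<open>Closure under products is the point: two elements of exponent \<open>m\<close> generate a nilpotent
  group, whose exponent then divides a power of \<open>m\<close>.\<close>
lemma nilpotent_in_exponent_mult:
  assumes "nilpotent_in G D" "x \<in> D" "y \<in> D" "x [^] (m::nat) = \<one>" "y [^] m = \<one>"
  obtains k where "(x \<otimes> y) [^] (m ^ k) = \<one>"
proof -
  obtain k L where L: "L 0 = D" "L (k::nat) = {\<one>}" "\<And>i. subgroup (L i) G"
    "\<And>i. L (Suc i) \<subseteq> L i" "\<And>i. L i \<subseteq> D"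
    "\<And>i x y. \<lbrakk>x \<in> L i; y \<in> D\<rbrakk> \<Longrightarrow> commutator G x y \<in> L (Suc i)"
    using nilpotent_inE[OF assms(1)] by metis
  have D: "subgroup D G" using L(1,3) by metis
  define E where "E = generate G {x, y}"
  have xy: "{x, y} \<subseteq> carrier G" using assms subgroup.mem_carrier[OF D] by blast
  have E: "subgroup E G" unfolding E_def by (rule generate_is_subgroup[OF xy])
  have ED: "E \<subseteq> D" unfolding E_def by (rule generate_subgroup_incl[OF _ D]) (use assms in auto)
  have xyE: "x \<in> E" "y \<in> E" by (auto simp: E_def intro: generate.incl)
  define H where "H = G\<lparr>carrier := E\<rparr>"
  interpret H: group H
    unfolding H_def using E by (rule subgroup_imp_group)
  have H_simps [simp]: "carrier H = E" "monoid.mult H = monoid.mult G" "one H = \<one>" by (simp_all add: H_def)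
  have H_pow [simp]: "a [^]\<^bsub>H\<^esub> (j::nat) = a [^] j" for a j
    unfolding H_def by (rule nat_pow_consistent[symmetric])
  have sub: "lower_central H i \<subseteq> L i" for i
  proof (induction i)
    case 0
    show ?case using ED L(1) by simp
  next
    case (Suc i)
    have *: "(\<Union>x\<in>lower_central H i. \<Union>y\<in>carrier H. {x \<otimes>\<^bsub>H\<^esub> y \<otimes>\<^bsub>H\<^esub> inv\<^bsub>H\<^esub> x \<otimes>\<^bsub>H\<^esub> inv\<^bsub>H\<^esub> y})
        \<subseteq> L (Suc i) \<inter> E"
    proof
      fix w assume "w \<in> (\<Union>x\<in>lower_central H i. \<Union>y\<in>carrier H. {x \<otimes>\<^bsub>H\<^esub> y \<otimes>\<^bsub>H\<^esub> inv\<^bsub>H\<^esub> x \<otimes>\<^bsub>H\<^esub> inv\<^bsub>H\<^esub> y})"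
      then obtain a b where w: "w = commutator H a b" and a: "a \<in> lower_central H i" and b: "b \<in> E"
        unfolding commutator_def by auto
      have aE: "a \<in> E" using a subgroup.subset[OF H.lower_central_subgroup] by auto
      have "w = commutator G a b"
        using w commutator_consistent[OF E aE b] by (simp only: H_def)
      then show "w \<in> L (Suc i) \<inter> E"
        using L(6)[of a i b] a b Suc ED commutator_mem[OF E aE b] by blast
    qed
    have "subgroup (L (Suc i) \<inter> E) H"
      unfolding H_def by (rule subgroup_incl[OF subgroups_Inter_pair[OF L(3) E] E]) auto
    then show ?case
      using H.generate_subgroup_incl[OF *] by auto
  qed
  have "(x \<otimes> y) [^]\<^bsub>H\<^esub> (m ^ k) \<in> lower_central H k"
  proof (rule H.lower_central_generated_exponent[of "{x, y}"])
    show "carrier H = generate H {x, y}"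
      unfolding H_def using generate_consistent[OF _ E, of "{x, y}"] xyE by (simp add: E_def)
  qed (use assms xyE E subgroup.m_closed in auto)
  then show thesis using that sub L(2) by auto
qed

end

lemma (in group_hom) nilpotent_in_image:
  assumes "nilpotent_in G D"
  shows "nilpotent_in H (h ` D)"
proof -
  obtain n L where L: "L 0 = D" "L (n::nat) = {\<one>}" "\<And>i. subgroup (L i) G"
    "\<And>i. L (Suc i) \<subseteq> L i" "\<And>i. L i \<subseteq> D"
    "\<And>i x y. \<lbrakk>x \<in> L i; y \<in> D\<rbrakk> \<Longrightarrow> commutator G x y \<in> L (Suc i)"
    using nilpotent_inE[OF assms(1)] by metis
  show ?thesis
    unfolding nilpotent_in_def
  proof (intro exI[of _ n] exI[of _ "\<lambda>i. h ` L i"] conjI allI ballI)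
    fix i
    show "subgroup (h ` L i) H" by (rule subgroup_img_is_subgroup[OF L(3)])
    show "h ` L (Suc i) \<subseteq> h ` L i" using L(4) by blast
    fix x y assume "x \<in> h ` L i" "y \<in> h ` D"
    then obtain a b where "x = h a" "a \<in> L i" "y = h b" "b \<in> D" by blast
    moreover have "L i \<subseteq> carrier G" "D \<subseteq> carrier G" using subgroup.subset L(1,3) by metis+
    ultimately show "commutator H x y \<in> h ` L (Suc i)"
      using L(6)[of a i b] hom_commutator[of a b] L(5)[of i]
      by (metis image_eqI subsetD)
  qed (use L in auto)
qed

section \<open>Eigenvectors over the prime field\<close>

text \<open>Multiplication by a primitive root \<open>g\<close> permutes the nonzero residues, so the sum is invariant
  under multiplication by \<open>g\<^sup>i\<close>, which is not \<open>1\<close> modulo \<open>p\<close>.\<close>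
lemma power_sum_mod_prime:
  fixes p i :: nat
  assumes p: "prime p" and i: "0 < i" "i < p - 1"
  shows "p dvd (\<Sum>c\<in>{1..<p}. c ^ i)"
proof -
  obtain g where g: "residue_primroot p g"
    using prime_primitive_root_exists[of p] p prime_gt_1_nat by blast
  have ordg: "ord p g = p - 1" "coprime p g"
    using g p by (auto simp: residue_primroot_def totient_prime)
  have gi: "\<not> [g ^ i = 1] (mod p)"
    using ordg(1) i ord_divides[of g i p] by (auto dest: dvd_imp_le)
  define S where "S = (\<Sum>c\<in>{1..<p}. c ^ i)"
  have ran: "g * c mod p \<in> {1..<p}" if "c \<in> {1..<p}" for c
  proof -
    have "\<not> p dvd c" using that by (auto dest: dvd_imp_le)
    then have "\<not> p dvd g * c"
      using ordg(2) p coprime_dvd_mult_right_iff by blast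
    then show ?thesis using p prime_gt_0_nat by (simp add: mod_greater_zero_iff_not_dvd Suc_leI)
  qed
  have inj: "inj_on (\<lambda>c. g * c mod p) {1..<p}"
  proof (rule inj_onI)
    fix a b assume ab: "a \<in> {1..<p}" "b \<in> {1..<p}" "g * a mod p = g * b mod p"
    then have "[g * a = g * b] (mod p)" by (simp add: cong_def)
    then have "[a = b] (mod p)"
      using cong_mult_lcancel_nat ordg(2) coprime_commute by blast
    then show "a = b" using ab(1,2) by (simp add: cong_def)
  qed
  have "S = (\<Sum>c\<in>(\<lambda>c. g * c mod p) ` {1..<p}. c ^ i)"
    unfolding S_def using endo_inj_surj[OF _ _ inj] ran by (intro sum.cong refl) (metis finite_atLeastLessThan image_subsetI)
  also have "\<dots> = (\<Sum>c\<in>{1..<p}. (g * c mod p) ^ i)"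
    by (subst sum.reindex[OF inj]) simp
  finally have "[S = (\<Sum>c\<in>{1..<p}. (g * c) ^ i)] (mod p)"
    by (auto intro!: cong_sum cong_pow simp: cong_def[of _ "_ * _"])
  then have "[S * 1 = S * g ^ i] (mod p)"
    by (simp add: power_mult_distrib S_def sum_distrib_left mult.commute)
  then have "\<not> coprime S p"
    using gi cong_mult_lcancel_nat cong_sym by blast
  then show ?thesis
    using p prime_imp_coprime_nat coprime_commute unfolding S_def by blast
qed

context comm_group
begin

lemma finprod_swap:
  assumes "finite A" "finite B" "\<And>a b. \<lbrakk>a \<in> A; b \<in> B\<rbrakk> \<Longrightarrow> f a b \<in> carrier G"
  shows "finprod G (\<lambda>a. finprod G (\<lambda>b. f a b) B) A = finprod G (\<lambda>b. finprod G (\<lambda>a. f a b) A) B"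
  using assms(1,3)
proof (induction A rule: finite_induct)
  case (insert x A)
  have "finprod G (\<lambda>b. finprod G (\<lambda>a. f a b) (insert x A)) B
      = finprod G (\<lambda>b. f x b \<otimes> finprod G (\<lambda>a. f a b) A) B"
    using insert by (intro finprod_cong) (auto intro!: finprod_insert simp: simp_implies_def)
  also have "\<dots> = finprod G (\<lambda>b. f x b) B \<otimes> finprod G (\<lambda>b. finprod G (\<lambda>a. f a b) A) B"
    using insert by (intro finprod_multf) auto
  finally show ?case
    using insert by (subst finprod_insert) auto
qed (use assms(2) in simp)

lemma finprod_pow_sum:
  assumes "finite A" "x \<in> carrier G"
  shows "finprod G (\<lambda>a. x [^] (e a :: nat)) A = x [^] sum e A"
  using assms(1)
proof (induction A rule: finite_induct)
  case (insert a A)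
  then show ?case using assms(2) by (subst finprod_insert) (auto simp: nat_pow_mult)
qed simp

lemma finprod_pow:
  assumes "finite A" "\<And>a. a \<in> A \<Longrightarrow> f a \<in> carrier G"
  shows "finprod G f A [^] (n::nat) = finprod G (\<lambda>a. f a [^] n) A"
  using assms
proof (induction A rule: finite_induct)
  case (insert a A)
  then have "finprod G f A \<in> carrier G" by (intro finprod_closed) auto
  then show ?case
    using insert by (subst (1 2) finprod_insert) (auto simp: nat_pow_distrib)
qed simp

lemma hom_finprod_endo:
  assumes "finite A" "\<And>a. a \<in> A \<Longrightarrow> f a \<in> carrier G" "\<sigma> \<in> hom G G"
  shows "\<sigma> (finprod G f A) = finprod G (\<lambda>a. \<sigma> (f a)) A"
  using assms(1,2)
proof (induction A rule: finite_induct)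
  case empty
  then show ?case using hom_one[OF assms(3) is_group is_group] by simp
next
  case (insert a A)
  have \<sigma>: "\<And>x. x \<in> carrier G \<Longrightarrow> \<sigma> x \<in> carrier G"
    using assms(3) by (auto simp: hom_def)
  have "finprod G f A \<in> carrier G" using insert by (intro finprod_closed) auto
  then have "\<sigma> (f a \<otimes> finprod G f A) = \<sigma> (f a) \<otimes> \<sigma> (finprod G f A)"
    using hom_mult[OF assms(3)] insert.prems by blast
  then show ?case
    using insert \<sigma> by (subst (1 2) finprod_insert) auto
qed

text \<open>The polynomial \<open>X\<^sup>p\<^sup>-\<^sup>1 - 1\<close> has \<open>p - 1\<close> distinct roots in the field with \<open>p\<close> elements. The
  eigenvectors are the projections \<open>\<Sum>i. c\<^sup>-\<^sup>i \<sigma>\<^sup>i v\<close>, here in multiplicative notation and with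
  \<open>c\<^sup>-\<^sup>i\<close> replaced by \<open>c\<^sup>p\<^sup>-\<^sup>1\<^sup>-\<^sup>i\<close>; by the vanishing of power sums they add up to \<open>- v\<close>, so one
  of them is nonzero.\<close>
lemma exists_eigenvector:
  assumes p: "prime (p::nat)" and \<sigma>: "\<sigma> \<in> hom G G"
    and exp: "\<And>x. x \<in> carrier G \<Longrightarrow> x [^] p = \<one>"
    and per: "\<And>x. x \<in> carrier G \<Longrightarrow> (\<sigma> ^^ (p - 1)) x = x"
    and v: "v \<in> carrier G" "v \<noteq> \<one>"
  obtains w c where "w \<in> carrier G" "w \<noteq> \<one>" "\<sigma> w = w [^] (c::nat)"
proof -
  obtain n where n: "p = n + 2"
    using prime_ge_2_nat[OF p] by (metis add.commute le_Suc_ex)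
  have \<sigma>c: "\<sigma> x \<in> carrier G" if "x \<in> carrier G" for x
    using \<sigma> that by (auto simp: hom_def)
  define u where "u i = (\<sigma> ^^ i) v" for i
  have u: "u i \<in> carrier G" for i
    by (induction i) (use v \<sigma>c in \<open>auto simp: u_def\<close>)
  have cong: "x [^] a = x [^] b" if "x \<in> carrier G" "[a = b] (mod p)" for x and a b :: nat
  proof -
    have "ord x dvd p" using exp[OF that(1)] that(1) by (simp add: pow_eq_id)
    then have "[a = b] (mod ord x)" using that(2) cong_dvd_modulus_nat by blast
    then have "int (ord x) dvd int b - int a"
      by (metis cong_iff_dvd_diff cong_int_iff cong_sym)
    then show ?thesis
      using int_pow_eq[OF that(1), of "int a" "int b"] by (simp only: int_pow_int)
  qed
  define w where "w c = finprod G (\<lambda>i. u i [^] (c ^ (Suc n - i))) {..n}" for c :: nat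
  have wc: "w c \<in> carrier G" for c
    unfolding w_def using u by (intro finprod_closed) auto
  have eig: "\<sigma> (w c) = w c [^] c" for c
  proof -
    define f where "f i = u i [^] (c ^ (Suc (Suc n) - i))" for i
    have f: "f i \<in> carrier G" for i using u by (simp add: f_def)
    have pow: "\<sigma> (x [^] k) = \<sigma> x [^] k" if "x \<in> carrier G" for x and k :: nat
      using hom_nat_pow[OF \<sigma> that is_group is_group] .
    have "\<sigma> (w c) = finprod G (\<lambda>i. f (Suc i)) {..n}"
      unfolding w_def using u \<sigma>
      by (subst hom_finprod_endo) (auto simp: f_def u_def pow intro!: finprod_cong simp: simp_implies_def)
    moreover have "w c [^] c = finprod G f {..n}"
      unfolding w_def using u
      by (subst finprod_pow)
        (auto simp: f_def nat_pow_pow Suc_diff_le mult.commute intro!: finprod_cong simp: simp_implies_def)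
    moreover have "f 0 = f (Suc n)"
    proof -
      have "u (Suc n) = v" using per[OF v(1)] n by (simp add: u_def)
      moreover have "[c ^ p = c] (mod p)"
      proof (cases "p dvd c")
        case True
        then have "p dvd c ^ p" using prime_gt_0_nat[OF p] by (simp add: dvd_power_iff dvd_trans)
        then show ?thesis using True by (simp add: cong_def mod_0_imp_dvd dvd_imp_mod_0)
      next
        case False
        then have "[c ^ (p - 1) * c = 1 * c] (mod p)"
          using fermat_theorem[OF p False] by (rule_tac cong_mult) auto
        then show ?thesis using n by (simp add: mult.commute)
      qed
      ultimately show ?thesis
        using cong[of v "c ^ p" c] v n by (simp add: f_def u_def)
    qed
    moreover have "f (Suc n) \<otimes> finprod G f {..n} = finprod G (\<lambda>i. f (Suc i)) {..n} \<otimes> f 0"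
      using finprod_Suc[of f n] finprod_Suc2[of f n] f by (simp add: Pi_def)
    ultimately show ?thesis
      using f by (metis finprod_closed m_comm right_cancel Pi_I)
  qed
  show thesis
  proof (rule ccontr)
    assume "\<not> thesis"
    then have w1: "w c = \<one>" for c using that[of "w c" c] wc eig by blast
    have "\<one> = finprod G (\<lambda>c. w c) {1..<p}" by (simp add: w1)
    also have "\<dots> = finprod G (\<lambda>i. finprod G (\<lambda>c. u i [^] (c ^ (Suc n - i))) {1..<p}) {..n}"
      unfolding w_def using u by (intro finprod_swap) auto
    also have "\<dots> = finprod G (\<lambda>i. u i [^] (\<Sum>c\<in>{1..<p}. c ^ (Suc n - i))) {..n}"
      using u by (intro finprod_cong) (auto simp: finprod_pow_sum simp_implies_def)
    also have "\<dots> = finprod G (\<lambda>i. if i = 0 then v [^] (p - 1) else \<one>) {..n}"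
    proof (rule finprod_cong)
      fix i
      have "u i [^] (\<Sum>c\<in>{1..<p}. c ^ (Suc n - i)) = (if i = 0 then v [^] (p - 1) else \<one>)"
        if i: "i \<in> {..n}"
      proof (cases "i = 0")
        case True
        have "[(\<Sum>c\<in>{1..<p}. c ^ (p - 1)) = (\<Sum>c\<in>{1..<p}. 1)] (mod p)"
          by (intro cong_sum fermat_theorem[OF p]) (auto dest: dvd_imp_le)
        then show ?thesis
          using cong[of v "\<Sum>c\<in>{1..<p}. c ^ (p - 1)" "p - 1"] True v n by (simp add: u_def)
      next
        case False
        then have "[(\<Sum>c\<in>{1..<p}. c ^ (Suc n - i)) = 0] (mod p)"
          using power_sum_mod_prime[OF p, of "Suc n - i"] i n by (simp add: cong_0_iff)
        then show ?thesis using cong[OF u, of _ 0 i] False by simp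
      qed
      then show "i \<in> {..n} =simp=> u i [^] (\<Sum>c\<in>{1..<p}. c ^ (Suc n - i)) = (if i = 0 then v [^] (p - 1) else \<one>)"
        by (simp add: simp_implies_def)
    qed (use u v in auto)
    also have "\<dots> = v [^] (p - 1)"
      using v finprod_singleton_swap[of 0 "{..n}" "\<lambda>i. v [^] (p - 1)"] by simp
    finally have "v [^] (p - 1) = \<one>" by simp
    moreover have "coprime (p - 1) p"
      using n by (metis coprime_Suc_right_nat add_2_eq_Suc' diff_Suc_1)
    ultimately show False
      using pow_coprime_eq_one[of v "p - 1" p] v exp by blast
  qed
qed

end

section \<open>p-groups and coprime action\<close>

text \<open>The class equation: an orbit has \<open>p\<close>-power size, so it is a fixed point or has size
  divisible by \<open>p\<close>.\<close>
lemma (in group) p_group_fixed_points: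
  assumes p: "prime (p::nat)" and ord: "order G = p ^ k" and E: "finite E"
    and act: "\<And>g x. \<lbrakk>g \<in> carrier G; x \<in> E\<rbrakk> \<Longrightarrow> a g x \<in> E" "\<And>x. x \<in> E \<Longrightarrow> a \<one> x = x"
      "\<And>g h x. \<lbrakk>g \<in> carrier G; h \<in> carrier G; x \<in> E\<rbrakk> \<Longrightarrow> a (g \<otimes> h) x = a g (a h x)"
  shows "[card E = card {x \<in> E. \<forall>g\<in>carrier G. a g x = x}] (mod p)"
proof -
  define \<phi> where "\<phi> g = restrict (a g) E" for g
  have bij: "\<phi> g \<in> carrier (BijGroup E)" if g: "g \<in> carrier G" for g
  proof -
    have "bij_betw (\<phi> g) E E"
    proof (rule bij_betw_byWitness[where f' = "a (inv g)"])
      show "\<forall>x\<in>E. a (inv g) (\<phi> g x) = x" "\<forall>x\<in>E. \<phi> g (a (inv g) x) = x"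
        using act(1)[of "inv g"] act(2) act(3)[of "inv g" g, symmetric] act(3)[of g "inv g", symmetric] g
        by (auto simp: \<phi>_def)
    qed (use act g in \<open>auto simp: \<phi>_def\<close>)
    then show ?thesis by (auto simp: BijGroup_def Bij_def \<phi>_def)
  qed
  interpret \<phi>: group_action G E \<phi>
    unfolding group_action_def group_hom_def group_hom_axioms_def hom_def
  proof (intro conjI is_group group_BijGroup CollectI ballI Pi_I bij)
    fix g h assume gh: "g \<in> carrier G" "h \<in> carrier G"
    then show "\<phi> (g \<otimes> h) = \<phi> g \<otimes>\<^bsub>BijGroup E\<^esub> \<phi> h"
      using bij act by (auto simp: BijGroup_def \<phi>_def restrict_def compose_def fun_eq_iff)
  qed
  define \<Omega> where "\<Omega> = orbits G E \<phi>"
  define F where "F = {x \<in> E. \<forall>g\<in>carrier G. a g x = x}"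
  have un: "\<Union>\<Omega> = E" unfolding \<Omega>_def by (rule \<phi>.orbits_coverture)
  have fin: "finite \<Omega>" using E un by (simp add: finite_UnionD)
  have finorb: "finite orb" if "orb \<in> \<Omega>" for orb using that un E by (metis Union_upper finite_subset)
  have disj: "pairwise disjnt \<Omega>"
    using \<phi>.disjoint_union unfolding \<Omega>_def pairwise_def disjnt_def by blast
  have orb_card: "card orb = 1 \<or> p dvd card orb" if orb: "orb \<in> \<Omega>" for orb
  proof -
    obtain x where x: "x \<in> E" "orb = orbit G \<phi> x" using orb unfolding \<Omega>_def orbits_def by blast
    then have "card orb dvd p ^ k" using \<phi>.orbit_stabilizer_theorem[OF x(1)] ord by (metis dvd_triv_left)
    then obtain i where "card orb = p ^ i" using p divides_primepow_nat by blast
    then show ?thesis by (cases i) auto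
  qed
  have single: "{orb \<in> \<Omega>. card orb = 1} = (\<lambda>x. {x}) ` F"
  proof (intro equalityI subsetI)
    fix orb assume "orb \<in> {orb \<in> \<Omega>. card orb = 1}"
    then obtain x where x: "x \<in> E" "orb = orbit G \<phi> x" "card orb = 1" unfolding \<Omega>_def orbits_def by blast
    then have "orb = {x}" using \<phi>.orbit_refl[OF x(1)] by (metis card_1_singletonE singletonD)
    moreover have "a g x = x" if "g \<in> carrier G" for g
      using that x \<open>orb = {x}\<close> unfolding orbit_def \<phi>_def by auto
    ultimately show "orb \<in> (\<lambda>x. {x}) ` F" using x(1) unfolding F_def by blast
  next
    fix orb assume "orb \<in> (\<lambda>x. {x}) ` F"
    then obtain x where x: "x \<in> E" "\<forall>g\<in>carrier G. a g x = x" "orb = {x}" unfolding F_def by blast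
    then have "orbit G \<phi> x = {x}"
      unfolding orbit_def \<phi>_def by (auto intro!: exI[of _ \<one>])
    then show "orb \<in> {orb \<in> \<Omega>. card orb = 1}" using x unfolding \<Omega>_def orbits_def by auto
  qed
  have "card E = (\<Sum>orb\<in>\<Omega>. card orb)"
    using card_Union_disjoint[OF disj finorb] un by simp
  moreover have "[(\<Sum>orb\<in>\<Omega>. card orb) = (\<Sum>orb\<in>\<Omega>. if card orb = 1 then 1 else 0)] (mod p)"
    using orb_card by (intro cong_sum) (auto simp: cong_0_iff)
  moreover have "(\<Sum>orb\<in>\<Omega>. if card orb = 1 then 1 else 0) = card {orb \<in> \<Omega>. card orb = 1}"
    using fin by (simp add: sum.If_cases Int_def)
  moreover have "card {orb \<in> \<Omega>. card orb = 1} = card F"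
    unfolding single by (rule card_image) (simp add: inj_on_def)
  ultimately show ?thesis by (simp add: F_def)
qed

lemma (in group) cyclic_p_group_fixed_points:
  assumes p: "prime (p::nat)" and y: "y \<in> carrier G" "y [^] (p ^ k) = \<one>" and E: "finite E"
    and act: "\<And>x. x \<in> E \<Longrightarrow> a y x \<in> E" "\<And>x. x \<in> E \<Longrightarrow> a \<one> x = x"
      "\<And>g h x. \<lbrakk>g \<in> carrier G; h \<in> carrier G; x \<in> E\<rbrakk> \<Longrightarrow> a (g \<otimes> h) x = a g (a h x)"
  shows "[card E = card {x \<in> E. a y x = x}] (mod p)"
proof -
  define C where "C = generate G {y}"
  have C: "subgroup C G" unfolding C_def using y by (intro generate_is_subgroup) simp
  interpret C: group "G\<lparr>carrier := C\<rparr>" by (rule subgroup_imp_group[OF C])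
  have "ord y dvd p ^ k" using y pow_eq_id by blast
  then obtain j where j: "ord y = p ^ j" using p divides_primepow_nat by blast
  then have "ord y \<noteq> 0" using prime_gt_0_nat[OF p] by simp
  then have Cpow: "C = {y [^] n |n. n \<in> (UNIV :: nat set)}"
    unfolding C_def by (rule generate_pow_nat[OF y(1)])
  have ord: "order (G\<lparr>carrier := C\<rparr>) = p ^ j"
    using generate_pow_card[OF y(1)] j by (simp add: order_def C_def)
  have powE: "a (y [^] n) x \<in> E" if "x \<in> E" for n :: nat and x
    using that by (induction n arbitrary: x) (use act y in simp_all)
  have fixpow: "a (y [^] n) x = x" if "x \<in> E" "a y x = x" for n :: nat and x
    using that by (induction n) (use act y in simp_all)
  have "[card E = card {x \<in> E. \<forall>g\<in>carrier (G\<lparr>carrier := C\<rparr>). a g x = x}] (mod p)"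
  proof (rule C.p_group_fixed_points[OF p ord E])
    fix g x assume "g \<in> carrier (G\<lparr>carrier := C\<rparr>)" "x \<in> E"
    then show "a g x \<in> E" using Cpow powE by auto
  qed (use act subgroup.mem_carrier[OF C] in auto)
  moreover have "{x \<in> E. \<forall>g\<in>carrier (G\<lparr>carrier := C\<rparr>). a g x = x} = {x \<in> E. a y x = x}"
    using Cpow fixpow generate.incl[of y "{y}" G] unfolding C_def by auto
  ultimately show ?thesis by simp
qed

context group
begin

lemma conj_mem_if_subset:
  assumes "finite K" "subgroup K G" "y \<in> carrier G" "\<And>k. k \<in> K \<Longrightarrow> y \<otimes> k \<otimes> inv y \<in> K"
    and "k \<in> K"
  shows "inv y \<otimes> k \<otimes> y \<in> K"
proof -
  have Kc: "x \<in> K \<Longrightarrow> x \<in> carrier G" for x using subgroup.mem_carrier[OF assms(2)] .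
  have "inj_on (\<lambda>k. y \<otimes> k \<otimes> inv y) K"
  proof (rule inj_onI)
    fix a b assume "a \<in> K" "b \<in> K" and eq: "y \<otimes> a \<otimes> inv y = y \<otimes> b \<otimes> inv y"
    then have "inv y \<otimes> (y \<otimes> a \<otimes> inv y) \<otimes> y = inv y \<otimes> (y \<otimes> b \<otimes> inv y) \<otimes> y" by simp
    then show "a = b" using assms(3) Kc \<open>a \<in> K\<close> \<open>b \<in> K\<close> by (simp add: word_simps)
  qed
  then have "(\<lambda>k. y \<otimes> k \<otimes> inv y) ` K = K"
    using endo_inj_surj[OF assms(1)] assms(4) by (metis image_subsetI)
  then obtain k' where "k' \<in> K" "k = y \<otimes> k' \<otimes> inv y" using assms(5) by blast
  then show ?thesis using assms(3) Kc by (simp add: word_simps)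
qed

lemma subgroup_normalizer:
  assumes "finite K" "subgroup K G"
  shows "subgroup {g \<in> carrier G. \<forall>k\<in>K. g \<otimes> k \<otimes> inv g \<in> K} G"
proof (rule subgroupI)
  have Kc: "k \<in> K \<Longrightarrow> k \<in> carrier G" for k using subgroup.mem_carrier[OF assms(2)] .
  have "\<one> \<in> {g \<in> carrier G. \<forall>k\<in>K. g \<otimes> k \<otimes> inv g \<in> K}" using Kc by auto
  then show "{g \<in> carrier G. \<forall>k\<in>K. g \<otimes> k \<otimes> inv g \<in> K} \<noteq> {}" by blast
  fix g assume g: "g \<in> {g \<in> carrier G. \<forall>k\<in>K. g \<otimes> k \<otimes> inv g \<in> K}"
  then show "inv g \<in> {g \<in> carrier G. \<forall>k\<in>K. g \<otimes> k \<otimes> inv g \<in> K}"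
    using conj_mem_if_subset[OF assms, of g] by auto
  fix h assume h: "h \<in> {g \<in> carrier G. \<forall>k\<in>K. g \<otimes> k \<otimes> inv g \<in> K}"
  have "g \<otimes> h \<otimes> k \<otimes> inv (g \<otimes> h) = g \<otimes> (h \<otimes> k \<otimes> inv h) \<otimes> inv g" if "k \<in> K" for k
    using g h Kc[OF that] by (simp add: word_simps)
  then show "g \<otimes> h \<in> {g \<in> carrier G. \<forall>k\<in>K. g \<otimes> k \<otimes> inv g \<in> K}" using g h by simp
qed auto

lemma conj_coset:
  assumes N: "subgroup N G" and x: "x \<in> carrier G" "v \<in> carrier G"
    and xN: "\<And>n. n \<in> N \<Longrightarrow> x \<otimes> n \<otimes> inv x \<in> N" "\<And>n. n \<in> N \<Longrightarrow> inv x \<otimes> n \<otimes> x \<in> N"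
  shows "(\<lambda>a. x \<otimes> a \<otimes> inv x) ` (N #> v) = N #> (x \<otimes> v \<otimes> inv x)"
proof (intro equalityI subsetI)
  fix a assume "a \<in> (\<lambda>a. x \<otimes> a \<otimes> inv x) ` (N #> v)"
  then obtain n where n: "n \<in> N" "a = x \<otimes> (n \<otimes> v) \<otimes> inv x" unfolding r_coset_def by blast
  then have "a = (x \<otimes> n \<otimes> inv x) \<otimes> (x \<otimes> v \<otimes> inv x)"
    using x subgroup.mem_carrier[OF N n(1)] by (simp add: word_simps)
  then show "a \<in> N #> (x \<otimes> v \<otimes> inv x)" using xN(1)[OF n(1)] unfolding r_coset_def by blast
next
  fix a assume "a \<in> N #> (x \<otimes> v \<otimes> inv x)"
  then obtain n where n: "n \<in> N" "a = n \<otimes> (x \<otimes> v \<otimes> inv x)" unfolding r_coset_def by blast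
  then have "a = x \<otimes> ((inv x \<otimes> n \<otimes> x) \<otimes> v) \<otimes> inv x"
    using x subgroup.mem_carrier[OF N n(1)] by (simp add: word_simps)
  then show "a \<in> (\<lambda>a. x \<otimes> a \<otimes> inv x) ` (N #> v)" using xN(2)[OF n(1)] unfolding r_coset_def by blast
qed

text \<open>The \<open>q\<close>-element \<open>y\<close> acts by conjugation on the cosets of \<open>W\<close> in \<open>t K\<close>. Their number
  \<open>\<bar>K : W\<bar>\<close> is not divisible by \<open>q\<close>, so one of them is fixed.\<close>
lemma coprime_action_fixed_coset:
  assumes fin: "finite (carrier G)" and q: "prime (q::nat)" and y: "y \<in> carrier G" "y [^] (q ^ j) = \<one>"
    and W: "W \<lhd> G" and K: "subgroup K G" "W \<subseteq> K" "card K = card W * m" "\<not> q dvd m"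
    and yK: "\<And>k. k \<in> K \<Longrightarrow> y \<otimes> k \<otimes> inv y \<in> K"
    and t: "t \<in> carrier G" "inv t \<otimes> (y \<otimes> t \<otimes> inv y) \<in> K"
  obtains k where "k \<in> K" "commutator G y (t \<otimes> k) \<in> W"
proof -
  interpret W: normal W G by (rule W)
  have Kc: "k \<in> K \<Longrightarrow> k \<in> carrier G" for k using subgroup.mem_carrier[OF K(1)] .
  define E where "E = (\<lambda>k. W #> (t \<otimes> k)) ` K"
  have finK: "finite K" using fin K(1) finite_subset subgroup.subset by metis
  have finE: "finite E" unfolding E_def using finK by simp
  have un: "\<Union>E = (\<lambda>k. t \<otimes> k) ` K"
  proof (intro equalityI subsetI)
    fix x assume "x \<in> \<Union>E"
    then obtain k w where k: "k \<in> K" "w \<in> W" "x = w \<otimes> (t \<otimes> k)" unfolding E_def r_coset_def by blast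
    then have "x = t \<otimes> ((inv t \<otimes> w \<otimes> t) \<otimes> k)" using t Kc by (simp add: word_simps)
    moreover have "inv t \<otimes> w \<otimes> t \<in> K" using W.inv_op_closed1[OF t(1) k(2)] K(2) by blast
    ultimately show "x \<in> (\<lambda>k. t \<otimes> k) ` K" using k(1) subgroup.m_closed[OF K(1)] by blast
  next
    fix x assume "x \<in> (\<lambda>k. t \<otimes> k) ` K"
    then obtain k where k: "k \<in> K" "x = t \<otimes> k" by blast
    then have "x \<in> W #> (t \<otimes> k)" using rcos_self[OF _ W.is_subgroup] t Kc by simp
    then show "x \<in> \<Union>E" using k(1) unfolding E_def by blast
  qed
  have rc: "S \<in> rcosets W" if "S \<in> E" for S
    using that t Kc unfolding E_def RCOSETS_def by auto
  have rcosets_carrier': "S \<subseteq> carrier G" if "S \<in> rcosets W" for S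
    using W.rcosets_carrier[OF is_group that] .
  have "card W * card E = card (\<Union>E)"
  proof (rule card_partition)
    show "finite (\<Union>E)" unfolding un using finK by simp
    show "card S = card W" if "S \<in> E" for S
      using card_rcosets_equal[OF rc[OF that] W.subset] by simp
    show "c1 \<inter> c2 = {}" if "c1 \<in> E" "c2 \<in> E" "c1 \<noteq> c2" for c1 c2
      using rcos_disjoint[OF W.is_subgroup] rc that unfolding pairwise_def disjnt_def by blast
  qed (rule finE)
  also have "card (\<Union>E) = card K"
    unfolding un using t Kc by (intro card_image inj_onI) (metis inv_mult_cancel(1))
  finally have "card W * card E = card W * m" using K(3) by simp
  moreover have "card W > 0" using W.finite_imp_card_positive[OF fin] .
  ultimately have cardE: "card E = m" by simp
  define a where "a g S = (\<lambda>x. g \<otimes> x \<otimes> inv g) ` S" for g and S :: "'a set"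
  have acos: "a g (W #> v) = W #> (g \<otimes> v \<otimes> inv g)" if "g \<in> carrier G" "v \<in> carrier G" for g v
    unfolding a_def
    using conj_coset[OF W.subgroup_axioms that] W.inv_op_closed1[OF that(1)] W.inv_op_closed2[OF that(1)] by blast
  have "[card E = card {S \<in> E. a y S = S}] (mod q)"
  proof (rule cyclic_p_group_fixed_points[OF q y finE])
    fix S assume "S \<in> E"
    then obtain k where k: "k \<in> K" "S = W #> (t \<otimes> k)" unfolding E_def by blast
    have "y \<otimes> (t \<otimes> k) \<otimes> inv y = t \<otimes> ((inv t \<otimes> (y \<otimes> t \<otimes> inv y)) \<otimes> (y \<otimes> k \<otimes> inv y))"
      using y t Kc[OF k(1)] by (simp add: word_simps)
    moreover have "(inv t \<otimes> (y \<otimes> t \<otimes> inv y)) \<otimes> (y \<otimes> k \<otimes> inv y) \<in> K"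
      using subgroup.m_closed[OF K(1) t(2) yK[OF k(1)]] .
    ultimately show "a y S \<in> E"
      using acos[of y "t \<otimes> k"] y t Kc[OF k(1)] k(2) unfolding E_def by auto
  next
    fix S assume "S \<in> E"
    then have "S \<subseteq> carrier G" using rcosets_carrier' rc by blast
    then have "\<one> \<otimes> x \<otimes> inv \<one> = x" if "x \<in> S" for x using that by auto
    then show "a \<one> S = S" unfolding a_def by simp
  next
    fix g h S assume gh: "g \<in> carrier G" "h \<in> carrier G" and "S \<in> E"
    then have "S \<subseteq> carrier G" using rcosets_carrier' rc by blast
    then have "g \<otimes> h \<otimes> x \<otimes> inv (g \<otimes> h) = g \<otimes> (h \<otimes> x \<otimes> inv h) \<otimes> inv g" if "x \<in> S" for x
      using that gh by (auto simp: word_simps subset_iff)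
    then show "a (g \<otimes> h) S = a g (a h S)" unfolding a_def image_image by (intro image_cong) auto
  qed
  then have "card {S \<in> E. a y S = S} \<noteq> 0"
    using K(4) unfolding cardE[symmetric] by (metis cong_0_iff)
  then obtain S where "S \<in> E" "a y S = S" by (metis (mono_tags, lifting) Collect_empty_eq card.empty)
  then obtain k where k: "k \<in> K" "a y (W #> (t \<otimes> k)) = W #> (t \<otimes> k)" unfolding E_def by blast
  define v where "v = t \<otimes> k"
  have v: "v \<in> carrier G" using t Kc[OF k(1)] by (simp add: v_def)
  have "W #> (y \<otimes> v \<otimes> inv y) = W #> v" using acos[OF y(1) v] k(2) by (simp add: v_def)
  then have "y \<otimes> v \<otimes> inv y \<in> W #> v"
    using rcos_self[OF _ W.is_subgroup, of "y \<otimes> v \<otimes> inv y"] y v by simp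
  then obtain w where w: "w \<in> W" "y \<otimes> v \<otimes> inv y = w \<otimes> v" unfolding r_coset_def by blast
  then have "commutator G y v = w"
    using v y by (simp add: commutator_mult_eq)
  then show thesis using that k(1) w(1) by (simp add: v_def)
qed

lemma conj_pow_Suc:
  fixes n :: nat
  assumes "x \<in> carrier G" "a \<in> carrier G"
  shows "x [^] Suc n \<otimes> a \<otimes> inv (x [^] Suc n) = x \<otimes> (x [^] n \<otimes> a \<otimes> inv (x [^] n)) \<otimes> inv x"
proof -
  have "x [^] Suc n = x \<otimes> x [^] n" using assms(1) by (rule nat_pow_Suc2)
  then show ?thesis
    using assms by (simp only: m_assoc inv_mult_group nat_pow_closed inv_closed m_closed)
qed

lemma card_normal_set_mult:
  assumes "finite (carrier G)" "N \<lhd> G" "subgroup H G"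
  shows "card (N <#> H) * card (N \<inter> H) = card N * card H"
proof -
  have N: "subgroup N G" by (rule normal_imp_subgroup[OF assms(2)])
  have S: "subgroup (N <#> H) G" by (rule mult_norm_subgroup[OF assms(2,3)])
  interpret S: group "G\<lparr>carrier := N <#> H\<rparr>" by (rule subgroup_imp_group[OF S])
  interpret H: group "G\<lparr>carrier := H\<rparr>" by (rule subgroup_imp_group[OF assms(3)])
  have "card (rcosets\<^bsub>G\<lparr>carrier := N <#> H\<rparr>\<^esub> N) = card (rcosets\<^bsub>G\<lparr>carrier := H\<rparr>\<^esub> (N \<inter> H))"
    using iso_same_card[OF weak_snd_iso_thme[OF assms(3,2)]] by (simp add: FactGroup_def)
  moreover have "card (rcosets\<^bsub>G\<lparr>carrier := N <#> H\<rparr>\<^esub> N) * card N = card (N <#> H)"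
    using S.lagrange[OF subgroup_incl[OF N S set_mult_contains(1)[OF N assms(3)]]] by (simp add: order_def)
  moreover have "card (rcosets\<^bsub>G\<lparr>carrier := H\<rparr>\<^esub> (N \<inter> H)) * card (N \<inter> H) = card H"
    using H.lagrange[OF subgroup_incl[OF subgroups_Inter_pair[OF N assms(3)] assms(3)]] by (simp add: order_def)
  ultimately show ?thesis by (metis mult.assoc mult.commute)
qed

lemma cyclic_mod_normal:
  assumes fin: "finite (carrier G)" and N: "N \<lhd> G" and p: "prime p" "order G = p * card N"
    and t: "t \<in> carrier G" "t \<notin> N" and x: "x \<in> carrier G"
  obtains n :: nat where "x \<in> N #> (t [^] n)"
proof -
  interpret N: normal N G by (rule N)
  interpret Q: group "G Mod N" by (rule N.factorgroup_is_group)
  have "card (rcosets N) * card N = p * card N" using lagrange[OF N.is_subgroup] p by simp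
  then have ordQ: "order (G Mod N) = p"
    using N.finite_imp_card_positive[OF fin] by (simp add: order_def FactGroup_def)
  define a where "a = N #> t"
  have a: "a \<in> carrier (G Mod N)" "a \<noteq> \<one>\<^bsub>G Mod N\<^esub>"
    using t N.in_mod_eq_one_iff[OF t(1)] by (auto simp: a_def carrier_FactGroup)
  have "Q.ord a dvd p" using Q.ord_dvd_group_order[OF a(1)] ordQ by simp
  then have orda: "Q.ord a = p" using a p Q.ord_eq_1 prime_nat_iff by blast
  have sub: "generate (G Mod N) {a} \<subseteq> carrier (G Mod N)"
    using a(1) Q.generate_incl by simp
  have "card (generate (G Mod N) {a}) = card (carrier (G Mod N))"
    using Q.generate_pow_card[OF a(1)] orda ordQ by (simp add: order_def)
  moreover have "finite (carrier (G Mod N))" using fin by (simp add: carrier_FactGroup)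
  ultimately have "generate (G Mod N) {a} = carrier (G Mod N)" using sub card_subset_eq by blast
  moreover have "Q.ord a \<noteq> 0" using orda p by auto
  ultimately have "N #> x \<in> {a [^]\<^bsub>G Mod N\<^esub> n |n. n \<in> (UNIV :: nat set)}"
    using Q.generate_pow_nat[OF a(1)] x by (auto simp: carrier_FactGroup)
  then obtain n :: nat where "N #> x = a [^]\<^bsub>G Mod N\<^esub> n" by blast
  then have "N #> x = N #> (t [^] n)" using N.FactGroup_pow[OF t(1)] by (simp add: a_def)
  then have "x \<in> N #> (t [^] n)" using rcos_self[OF x N.is_subgroup] by simp
  then show thesis using that by blast
qed

text \<open>On the group \<open>X / N\<close> of order \<open>p\<close>, conjugation by \<open>x\<close> is \<open>a \<mapsto> a\<^sup>c\<close> for some \<open>c\<close> prime to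
  \<open>p\<close>, and \<open>c\<^sup>p\<^sup>-\<^sup>1 \<equiv> 1\<close> modulo \<open>p\<close>.\<close>
lemma pow_pred_prime_centralizes_factor:
  assumes fin: "finite (carrier G)" and p: "prime p" and X: "subgroup X G" and N: "subgroup N G" "N \<subseteq> X"
    and card: "card X = p * card N" and norm: "\<And>a n. \<lbrakk>a \<in> X; n \<in> N\<rbrakk> \<Longrightarrow> a \<otimes> n \<otimes> inv a \<in> N"
    and x: "x \<in> carrier G" "\<And>a. a \<in> X \<Longrightarrow> x \<otimes> a \<otimes> inv x \<in> X" "\<And>n. n \<in> N \<Longrightarrow> x \<otimes> n \<otimes> inv x \<in> N"
    and t: "t \<in> X"
  shows "commutator G (x [^] (p - 1)) t \<in> N"
proof -
  have Xc: "a \<in> X \<Longrightarrow> a \<in> carrier G" for a using subgroup.mem_carrier[OF X] .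
  have Nc: "a \<in> N \<Longrightarrow> a \<in> carrier G" for a using subgroup.mem_carrier[OF N(1)] .
  have finN: "finite N" using fin N(1) finite_subset subgroup.subset by metis
  have xN: "inv x \<otimes> n \<otimes> x \<in> N" if "n \<in> N" for n
    using conj_mem_if_subset[OF finN N(1) x(1,3) that] .
  have powX: "x [^] n \<otimes> a \<otimes> inv (x [^] n) \<in> Y" if Y: "\<And>a. a \<in> Y \<Longrightarrow> x \<otimes> a \<otimes> inv x \<in> Y" "Y \<subseteq> X" "a \<in> Y"
    for Y a and n :: nat
  proof (induction n)
    case (Suc n)
    have "a \<in> carrier G" using Y(2,3) Xc by blast
    then show ?case using Y(1)[OF Suc] by (simp only: conj_pow_Suc[OF x(1)])
  qed (use that Xc in auto)
  show ?thesis
  proof (cases "t \<in> N")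
    case True
    have "x [^] (p - 1) \<otimes> t \<otimes> inv (x [^] (p - 1)) \<otimes> inv t \<in> N"
      using subgroup.m_closed[OF N(1) powX[OF x(3) N(2) True] subgroup.m_inv_closed[OF N(1) True]] .
    then show ?thesis by (simp add: commutator_def)
  next
    case False
    define H where "H = G\<lparr>carrier := X\<rparr>"
    interpret H: group H unfolding H_def by (rule subgroup_imp_group[OF X])
    have Hs: "carrier H = X" "monoid.mult H = monoid.mult G" "\<And>a n. a [^]\<^bsub>H\<^esub> (n::nat) = a [^] n"
      "\<And>a S. S #>\<^bsub>H\<^esub> a = S #> a"
      by (simp_all add: H_def nat_pow_consistent[symmetric])
    have NH: "N \<lhd> H"
    proof (rule H.normal_invI)
      show "subgroup N H" unfolding H_def by (rule subgroup_incl[OF N(1) X N(2)])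
      show "a \<otimes>\<^bsub>H\<^esub> n \<otimes>\<^bsub>H\<^esub> inv\<^bsub>H\<^esub> a \<in> N" if "a \<in> carrier H" "n \<in> N" for a n
        using that norm m_inv_consistent[OF X] by (simp add: H_def)
    qed
    interpret N: normal N H by (rule NH)
    interpret Q: group "H Mod N" by (rule N.factorgroup_is_group)
    have finH: "finite (carrier H)" using fin X finite_subset subgroup.subset Hs(1) by metis
    have ordH: "order H = p * card N" using card Hs(1) by (simp add: order_def)
    have "card (rcosets\<^bsub>H\<^esub> N) * card N = p * card N" using H.lagrange[OF N.is_subgroup] ordH by simp
    then have ordQ: "order (H Mod N) = p"
      using N.finite_imp_card_positive[OF finH] by (simp add: order_def FactGroup_def)
    have cQ: "carrier (H Mod N) = (\<lambda>a. N #> a) ` X" by (simp add: carrier_FactGroup Hs)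
    have powQ: "(N #> a) [^]\<^bsub>H Mod N\<^esub> (n::nat) = N #> (a [^] n)" if "a \<in> X" for a n
      using N.FactGroup_pow[of a n] that by (simp add: Hs)
    have one: "N #> a = \<one>\<^bsub>H Mod N\<^esub> \<longleftrightarrow> a \<in> N" if "a \<in> X" for a
      using N.in_mod_eq_one_iff[of a] that by (simp only: Hs)
    define \<sigma> where "\<sigma> S = (\<lambda>a. x \<otimes> a \<otimes> inv x) ` S" for S
    have \<sigma>: "\<sigma> (N #> a) = N #> (x \<otimes> a \<otimes> inv x)" if "a \<in> X" for a
      unfolding \<sigma>_def by (rule conj_coset[OF N(1) x(1) Xc[OF that] x(3) xN])
    have mulQ: "(N #> a) \<otimes>\<^bsub>H Mod N\<^esub> (N #> b) = N #> (a \<otimes> b)" if "a \<in> X" "b \<in> X" for a b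
      using N.rcos_sum[of a b] that by (simp add: Hs FactGroup_def)
    have \<sigma>hom: "\<sigma> \<in> hom (H Mod N) (H Mod N)"
      unfolding hom_def
    proof (intro CollectI conjI Pi_I ballI)
      fix S assume "S \<in> carrier (H Mod N)"
      then obtain a where a: "a \<in> X" "S = N #> a" unfolding cQ by blast
      show "\<sigma> S \<in> carrier (H Mod N)" unfolding a(2) \<sigma>[OF a(1)] cQ using x(2)[OF a(1)] by blast
      fix R assume "R \<in> carrier (H Mod N)"
      then obtain b where b: "b \<in> X" "R = N #> b" unfolding cQ by blast
      have "x \<otimes> (a \<otimes> b) \<otimes> inv x = (x \<otimes> a \<otimes> inv x) \<otimes> (x \<otimes> b \<otimes> inv x)"
        using x(1) Xc[OF a(1)] Xc[OF b(1)] by (simp add: word_simps)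
      then show "\<sigma> (S \<otimes>\<^bsub>H Mod N\<^esub> R) = \<sigma> S \<otimes>\<^bsub>H Mod N\<^esub> \<sigma> R"
        unfolding a(2) b(2) mulQ[OF a(1) b(1)] \<sigma>[OF a(1)] \<sigma>[OF b(1)] \<sigma>[OF subgroup.m_closed[OF X a(1) b(1)]]
          mulQ[OF x(2)[OF a(1)] x(2)[OF b(1)]] by simp
    qed
    define a where "a = N #> t"
    have a: "a \<in> carrier (H Mod N)" unfolding a_def cQ using t by blast
    obtain c :: nat where "x \<otimes> t \<otimes> inv x \<in> N #> (t [^] c)"
      using H.cyclic_mod_normal[OF finH NH p ordH, of t "x \<otimes> t \<otimes> inv x"] t False x(2)[OF t] Hs by auto
    then have "N #> (x \<otimes> t \<otimes> inv x) = N #> (t [^] c)"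
      using repr_independence[OF _ _ N(1)] Xc[OF t] by (metis nat_pow_closed)
    then have \<sigma>a: "\<sigma> a = a [^]\<^bsub>H Mod N\<^esub> c" unfolding a_def \<sigma>[OF t] powQ[OF t] .
    have iter: "N #> (x [^] n \<otimes> t \<otimes> inv (x [^] n)) = a [^]\<^bsub>H Mod N\<^esub> (c ^ n)" for n :: nat
    proof (induction n)
      case 0
      show ?case unfolding power_0 Q.nat_pow_eone[OF a] using Xc[OF t] by (simp add: a_def)
    next
      case (Suc n)
      have "N #> (x [^] Suc n \<otimes> t \<otimes> inv (x [^] Suc n)) = \<sigma> (N #> (x [^] n \<otimes> t \<otimes> inv (x [^] n)))"
        unfolding conj_pow_Suc[OF x(1) Xc[OF t]] by (rule \<sigma>[OF powX[OF x(2) subset_refl t], symmetric])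
      also have "\<dots> = \<sigma> a [^]\<^bsub>H Mod N\<^esub> (c ^ n)"
        unfolding Suc by (rule hom_nat_pow[OF \<sigma>hom a Q.is_group Q.is_group])
      also have "\<dots> = a [^]\<^bsub>H Mod N\<^esub> (c ^ Suc n)" unfolding \<sigma>a using a by (simp add: Q.nat_pow_pow)
      finally show ?case .
    qed
    have ap: "a [^]\<^bsub>H Mod N\<^esub> p = \<one>\<^bsub>H Mod N\<^esub>" using Q.pow_order_eq_1[OF a] ordQ by simp
    have "\<not> p dvd c"
    proof
      assume "p dvd c"
      then obtain d where "c = p * d" by blast
      then have "a [^]\<^bsub>H Mod N\<^esub> c = (a [^]\<^bsub>H Mod N\<^esub> p) [^]\<^bsub>H Mod N\<^esub> d"
        by (simp only: Q.nat_pow_pow[OF a])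
      then have "a [^]\<^bsub>H Mod N\<^esub> c = \<one>\<^bsub>H Mod N\<^esub>" by (simp only: ap Q.nat_pow_one)
      then have "x \<otimes> t \<otimes> inv x \<in> N" using one[OF x(2)[OF t]] \<sigma>a \<sigma>[OF t] by (simp only: a_def)
      then have "inv x \<otimes> (x \<otimes> t \<otimes> inv x) \<otimes> x \<in> N" by (rule xN)
      then show False using False x(1) Xc[OF t] by (simp add: word_simps)
    qed
    then have "[c ^ (p - 1) = 1] (mod p)" by (rule fermat_theorem[OF p])
    moreover have "c ^ (p - 1) \<ge> 1" using \<open>\<not> p dvd c\<close> by (metis One_nat_def Suc_leI dvd_0_right gr0I power_not_zero)
    ultimately obtain d where d: "c ^ (p - 1) = 1 + p * d"
      by (metis cong_le_nat cong_sym add.commute mult.commute)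
    have "a [^]\<^bsub>H Mod N\<^esub> (c ^ (p - 1)) = a [^]\<^bsub>H Mod N\<^esub> (1::nat) \<otimes>\<^bsub>H Mod N\<^esub> (a [^]\<^bsub>H Mod N\<^esub> p) [^]\<^bsub>H Mod N\<^esub> d"
      by (simp only: d Q.nat_pow_pow[OF a] Q.nat_pow_mult[OF a])
    then have "a [^]\<^bsub>H Mod N\<^esub> (c ^ (p - 1)) = a"
      using a by (simp only: ap Q.nat_pow_one Q.nat_pow_eone Q.r_one)
    then have "N #> (x [^] (p - 1) \<otimes> t \<otimes> inv (x [^] (p - 1))) = N #> t" using iter[of "p - 1"] by (simp only: a_def)
    moreover have cl: "x [^] (p - 1) \<otimes> t \<otimes> inv (x [^] (p - 1)) \<in> carrier G" using x(1) Xc[OF t] by simp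
    ultimately have "x [^] (p - 1) \<otimes> t \<otimes> inv (x [^] (p - 1)) \<in> N #> t" using rcos_self[OF cl N(1)] by simp
    then obtain n where n: "n \<in> N" "x [^] (p - 1) \<otimes> t \<otimes> inv (x [^] (p - 1)) = n \<otimes> t" unfolding r_coset_def by blast
    then have "commutator G (x [^] (p - 1)) t = n"
      using Xc[OF t] Nc unfolding commutator_def by (simp add: m_assoc)
    then show ?thesis using n(1) by simp
  qed
qed

text \<open>Some power \<open>b\<close> of an element outside \<open>M\<close> has prime order modulo \<open>M\<close>, and \<open>M\<close> and \<open>b\<close>
  generate \<open>G\<close> by maximality.\<close>
lemma normal_maximal_prime_index:
  assumes fin: "finite (carrier G)" and M: "maximal_subgroup M G" "M \<lhd> G"
  obtains p where "prime p" "order G = p * card M"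
proof -
  interpret M: normal M G by (rule M(2))
  interpret Q: group "G Mod M" by (rule M.factorgroup_is_group)
  interpret \<pi>: group_hom G "G Mod M" "\<lambda>x. M #> x" by (rule M.mod_hom)
  have "M \<noteq> carrier G" using M(1) unfolding maximal_subgroup_def by blast
  then obtain x where x: "x \<in> carrier G" "x \<notin> M" using M.subset by blast
  have finQ: "finite (carrier (G Mod M))" using fin by (simp add: carrier_FactGroup)
  define a where "a = M #> x"
  have a: "a \<in> carrier (G Mod M)" "Q.ord a \<noteq> 1"
    using x M.in_mod_eq_one_iff[OF x(1)] Q.ord_eq_1 by (auto simp: a_def carrier_FactGroup)
  then obtain p where p: "prime p" "p dvd Q.ord a" using prime_factor_nat by blast
  have "Q.ord a \<noteq> 0" using Q.ord_ge_1[OF finQ a(1)] by simp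
  define b where "b = x [^] (Q.ord a div p)"
  have b: "b \<in> carrier G" "M #> b = a [^]\<^bsub>G Mod M\<^esub> (Q.ord a div p)"
    using x by (simp_all add: a_def b_def \<pi>.hom_nat_pow del: one_FactGroup)
  have ordb: "Q.ord (M #> b) = p"
  proof -
    obtain e where e: "Q.ord a = p * e" using p(2) by blast
    then have "e \<noteq> 0" "Q.ord a div p = e" using \<open>Q.ord a \<noteq> 0\<close> by auto
    then show ?thesis
      using Q.ord_pow[OF a(1), of e] e by (simp only: b(2)) simp
  qed
  define K where "K = {g \<in> carrier G. M #> g \<in> generate (G Mod M) {M #> b}}"
  have bQ: "{M #> b} \<subseteq> carrier (G Mod M)" using b(1) by (auto simp: carrier_FactGroup)
  have genS: "subgroup (generate (G Mod M) {M #> b}) (G Mod M)" by (rule Q.generate_is_subgroup[OF bQ])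
  have K: "subgroup K G"
    using M.factgroup_subgroup_union_subgroup[OF genS] M.factgroup_subgroup_union_char[OF genS] by (simp only: K_def)
  have "M \<subseteq> K"
  proof
    fix m assume m: "m \<in> M"
    then have "m \<in> carrier G" using M.mem_carrier by blast
    moreover have "M #> m = \<one>\<^bsub>G Mod M\<^esub>" using M.in_mod_eq_one_iff[of m] m calculation by blast
    ultimately show "m \<in> K" using subgroup.one_closed[OF genS] unfolding K_def by simp
  qed
  moreover have "b \<in> K" unfolding K_def using b generate.incl[of "M #> b" "{M #> b}" "G Mod M"] by simp
  moreover have "b \<notin> M"
    using ordb p(1) Q.ord_id M.in_mod_eq_one_iff[OF b(1)] not_prime_1 by metis
  ultimately have "K = carrier G" using M(1) K unfolding maximal_subgroup_def by blast
  then have "carrier (G Mod M) = generate (G Mod M) {M #> b}"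
    using subgroup.subset[OF genS] unfolding K_def by (auto simp: carrier_FactGroup)
  then have "order (G Mod M) = p"
    using Q.generate_pow_card[of "M #> b"] bQ ordb by (simp add: order_def)
  then have "order G = p * card M"
    using lagrange[OF M.is_subgroup] by (simp add: order_def FactGroup_def)
  then show thesis using that p(1) by blast
qed

text \<open>Normalizers grow in a \<open>p\<close>-group: the cosets fixed by a proper subgroup \<open>M\<close> are those of its
  normalizer, and their number is divisible by \<open>p\<close>.\<close>
lemma p_group_maximal_subgroup:
  assumes p: "prime (p::nat)" and ord: "order G = p ^ k" and M: "maximal_subgroup M G"
  shows "M \<lhd> G" "order G = p * card M"
proof -
  have "order G > 0" using ord prime_gt_0_nat[OF p] by simp
  then have fin: "finite (carrier G)" using order_gt_0_iff_finite by blast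
  have MG: "subgroup M G" "M \<noteq> carrier G" using M unfolding maximal_subgroup_def by blast+
  have Mc: "m \<in> M \<Longrightarrow> m \<in> carrier G" for m using subgroup.mem_carrier[OF MG(1)] .
  interpret M: group "G\<lparr>carrier := M\<rparr>" by (rule subgroup_imp_group[OF MG(1)])
  have idx: "card (rcosets M) * card M = p ^ k" using lagrange[OF MG(1)] ord by simp
  obtain j where j: "card M = p ^ j" using idx p divides_primepow_nat by (metis dvd_triv_right)
  obtain i where i: "card (rcosets M) = p ^ i" using idx p divides_primepow_nat by (metis dvd_triv_left)
  have "card (rcosets M) \<noteq> 1"
  proof
    assume "card (rcosets M) = 1"
    then have "card M = card (carrier G)" using idx ord by (simp add: order_def)
    then show False using MG fin card_subset_eq subgroup.subset by metis
  qed
  then have pd: "p dvd card (rcosets M)" using i by (cases i) auto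
  define a where "a g S = S #> inv g" for g S
  have Rc: "S \<subseteq> carrier G" if "S \<in> rcosets M" for S
    using subgroup.rcosets_carrier[OF MG(1) is_group that] .
  have aR: "a g S \<in> rcosets M" if "g \<in> carrier G" "S \<in> rcosets M" for g S
  proof -
    obtain x where "x \<in> carrier G" "S = M #> x" using \<open>S \<in> rcosets M\<close> unfolding RCOSETS_def by blast
    then show ?thesis
      using that coset_mult_assoc[of M x "inv g"] subgroup.subset[OF MG(1)] rcosetsI unfolding a_def by simp
  qed
  define F where "F = {S \<in> rcosets M. \<forall>g\<in>carrier (G\<lparr>carrier := M\<rparr>). a g S = S}"
  have "[card (rcosets M) = card F] (mod p)"
    unfolding F_def
  proof (rule M.p_group_fixed_points[OF p])
    show "order (G\<lparr>carrier := M\<rparr>) = p ^ j" using j by (simp add: order_def)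
    show "finite (rcosets M)" using fin by (simp add: RCOSETS_def)
    show "a g S \<in> rcosets M" if "g \<in> carrier (G\<lparr>carrier := M\<rparr>)" "S \<in> rcosets M" for g S
      using that aR Mc by simp
    show "a \<one>\<^bsub>G\<lparr>carrier := M\<rparr>\<^esub> S = S" if "S \<in> rcosets M" for S
      using that Rc by (simp add: a_def)
    show "a (g \<otimes>\<^bsub>G\<lparr>carrier := M\<rparr>\<^esub> h) S = a g (a h S)"
      if "g \<in> carrier (G\<lparr>carrier := M\<rparr>)" "h \<in> carrier (G\<lparr>carrier := M\<rparr>)" "S \<in> rcosets M" for g h S
      using that Rc Mc by (simp add: a_def inv_mult_group coset_mult_assoc)
  qed
  then have "p dvd card F" using pd by (metis cong_0_iff cong_sym cong_trans)
  moreover have "M \<in> F"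
  proof -
    have "M \<in> rcosets M" using subgroup.subgroup_in_rcosets[OF MG(1) is_group] .
    moreover have "M #> inv m = M" if "m \<in> M" for m
      using that coset_join2[of "inv m" M] MG(1) Mc subgroup.m_inv_closed[OF MG(1)] by simp
    ultimately show ?thesis unfolding F_def a_def by simp
  qed
  moreover have "finite F" using fin unfolding F_def by (simp add: RCOSETS_def)
  ultimately have "F \<noteq> {M}" using p by auto
  then obtain S where S: "S \<in> F" "S \<noteq> M" using \<open>M \<in> F\<close> by blast
  then obtain x where x: "x \<in> carrier G" "S = M #> x" unfolding F_def RCOSETS_def by blast
  have xM: "x \<notin> M" using S(2) x coset_join2[OF x(1) MG(1)] by blast
  have xnorm: "x \<otimes> m \<otimes> inv x \<in> M" if m: "m \<in> M" for m
  proof -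
    have "(M #> x) #> inv (inv m) = M #> x"
      using S(1) x m subgroup.m_inv_closed[OF MG(1) m] unfolding F_def a_def by simp
    then have "M #> (x \<otimes> m) = M #> x"
      using coset_mult_assoc[of M x m] x Mc[OF m] subgroup.subset[OF MG(1)] by simp
    then have "x \<otimes> m \<in> M #> x" using rcos_self[OF _ MG(1), of "x \<otimes> m"] x Mc[OF m] by simp
    then obtain m' where "m' \<in> M" "x \<otimes> m = m' \<otimes> x" unfolding r_coset_def by blast
    then show ?thesis using x Mc by (simp add: m_assoc)
  qed
  define N where "N = {g \<in> carrier G. \<forall>m\<in>M. g \<otimes> m \<otimes> inv g \<in> M}"
  have finM: "finite M" using fin MG(1) finite_subset subgroup.subset by metis
  have "subgroup N G" unfolding N_def by (rule subgroup_normalizer[OF finM MG(1)])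
  moreover have "M \<subseteq> N"
    using Mc subgroup.m_closed[OF MG(1)] subgroup.m_inv_closed[OF MG(1)] unfolding N_def by auto
  moreover have "x \<in> N" using x(1) xnorm unfolding N_def by blast
  ultimately have "N = carrier G" using M xM unfolding maximal_subgroup_def by blast
  then show normal: "M \<lhd> G" using normal_invI[OF MG(1)] unfolding N_def by blast
  obtain r where r: "prime r" "order G = r * card M"
    using normal_maximal_prime_index[OF fin M normal] .
  then have "r dvd p ^ k" using ord by (metis dvd_triv_left)
  then have "r = p" using r(1) p prime_dvd_power primes_dvd_imp_eq by blast
  then show "order G = p * card M" using r(2) by simp
qed

end

section \<open>The p-part and the p'-part of a nilpotent subgroup\<close>

definition p_elements :: "('a, 'b) monoid_scheme \<Rightarrow> nat \<Rightarrow> 'a set \<Rightarrow> 'a set" where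
  "p_elements G p S = {x \<in> S. \<exists>k. x [^]\<^bsub>G\<^esub> (p ^ k) = \<one>\<^bsub>G\<^esub>}"

definition p'_elements :: "('a, 'b) monoid_scheme \<Rightarrow> nat \<Rightarrow> 'a set \<Rightarrow> 'a set" where
  "p'_elements G p S = {x \<in> S. \<exists>m. coprime m p \<and> x [^]\<^bsub>G\<^esub> m = \<one>\<^bsub>G\<^esub>}"

context group
begin

lemma p_elements_restrict [simp]:
  "p_elements (G\<lparr>carrier := H\<rparr>) p S = p_elements G p S"
  by (simp add: p_elements_def flip: nat_pow_consistent)

lemma conj_pow_one:
  assumes "g \<in> carrier G" "x \<in> carrier G" "x [^] (n::nat) = \<one>"
  shows "(g \<otimes> x \<otimes> inv g) [^] n = \<one>"
  using assms by (simp add: conj_pow)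

lemma conj_mem_p_elements:
  assumes "S \<lhd> G" "g \<in> carrier G" "x \<in> p_elements G p S"
  shows "g \<otimes> x \<otimes> inv g \<in> p_elements G p S"
proof -
  obtain k where "x \<in> S" "x [^] (p ^ k) = \<one>" using assms(3) unfolding p_elements_def by blast
  moreover from this have "(g \<otimes> x \<otimes> inv g) [^] (p ^ k) = \<one>"
    using conj_pow_one[OF assms(2) subgroup.mem_carrier[OF normal_imp_subgroup[OF assms(1)]]] by blast
  moreover have "g \<otimes> x \<otimes> inv g \<in> S"
    using normal_invE(2)[OF assms(1,2)] \<open>x \<in> S\<close> by blast
  ultimately show ?thesis unfolding p_elements_def by blast
qed

lemma conj_mem_p'_elements:
  assumes "S \<lhd> G" "g \<in> carrier G" "x \<in> p'_elements G p S"
  shows "g \<otimes> x \<otimes> inv g \<in> p'_elements G p S"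
proof -
  obtain m where "x \<in> S" "x [^] m = \<one>" "coprime m p" using assms(3) unfolding p'_elements_def by blast
  moreover from this have "(g \<otimes> x \<otimes> inv g) [^] m = \<one>"
    using conj_pow_one[OF assms(2) subgroup.mem_carrier[OF normal_imp_subgroup[OF assms(1)]]] by blast
  moreover have "g \<otimes> x \<otimes> inv g \<in> S"
    using normal_invE(2)[OF assms(1,2)] \<open>x \<in> S\<close> by blast
  ultimately show ?thesis unfolding p'_elements_def by blast
qed

lemma p'_elements_if_p_elements:
  assumes "prime p" "prime q" "p \<noteq> q"
  shows "p_elements G q S \<subseteq> p'_elements G p S"
  using assms primes_coprime[of q p] unfolding p_elements_def p'_elements_def
  by (auto intro: coprime_power_left_iff[THEN iffD2])

lemma nat_factor_coprime:
  fixes n p :: nat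
  assumes "n > 0" "prime p"
  obtains k m where "n = p ^ k * m" "coprime m p"
proof -
  obtain m where m: "n = p ^ multiplicity p n * m" "\<not> p dvd m"
    using multiplicity_decompose'[of n p] assms not_prime_unit by (metis not_gr_zero)
  then have "coprime m p" using assms(2) prime_imp_coprime_nat coprime_commute by blast
  then show thesis using that m(1) by blast
qed

lemma p_elements_mult_p'_elements:
  assumes fin: "finite (carrier G)" and p: "prime p" and D: "subgroup D G" and d: "d \<in> D"
  obtains u v where "u \<in> p_elements G p D" "v \<in> p'_elements G p D" "d = u \<otimes> v"
proof -
  have "order G > 0" using fin order_gt_0_iff_finite by blast
  then obtain k m where km: "order G = p ^ k * m" "coprime m p" using nat_factor_coprime p by blast
  have dc: "d \<in> carrier G" using subgroup.mem_carrier[OF D d] .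
  have 1: "d [^] (p ^ k * m) = \<one>" using pow_order_eq_1[OF dc] km by simp
  have 2: "coprime (p ^ k) m" using km(2) by (simp add: coprime_commute)
  obtain a b :: nat where ab: "d = d [^] a \<otimes> d [^] b" "(d [^] a) [^] (p ^ k) = \<one>" "(d [^] b) [^] m = \<one>"
    using coprime_decomposition[OF dc 1 2] .
  show thesis
  proof (rule that[of "d [^] a" "d [^] b"])
    show "d [^] a \<in> p_elements G p D" using ab(2) pow_mem[OF D d] unfolding p_elements_def by blast
    show "d [^] b \<in> p'_elements G p D" using ab(3) pow_mem[OF D d] km(2) unfolding p'_elements_def by blast
  qed (rule ab(1))
qed

lemma cauchy:
  assumes "finite (carrier G)" "prime p" "p dvd order G"
  obtains x where "x \<in> carrier G" "x \<noteq> \<one>" "x [^] p = \<one>"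
proof -
  obtain m where "order G = p ^ 1 * m" using assms(3) by auto
  then obtain H where H: "subgroup H G" "card H = p ^ 1" using sylow_thm[OF assms(2) is_group _ assms(1)] by blast
  have "H \<noteq> {\<one>}" using H(2) assms(2) by auto
  then obtain x where x: "x \<in> H" "x \<noteq> \<one>" using subgroup.one_closed[OF H(1)] by blast
  interpret H: group "G\<lparr>carrier := H\<rparr>" by (rule subgroup_imp_group[OF H(1)])
  have "x [^] p = \<one>"
    using H.pow_order_eq_1[of x] x(1) H(2) by (simp add: order_def flip: nat_pow_consistent)
  then show thesis using that[OF subgroup.mem_carrier[OF H(1) x(1)] x(2)] by blast
qed

lemma prime_not_dvd_card_subgroup:
  assumes "finite (carrier G)" "prime r" "subgroup S G"
    and "\<And>x. x \<in> S \<Longrightarrow> \<exists>m. coprime m r \<and> x [^] (m::nat) = \<one>"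
  shows "\<not> r dvd card S"
proof
  assume r: "r dvd card S"
  interpret S: group "G\<lparr>carrier := S\<rparr>" by (rule subgroup_imp_group[OF assms(3)])
  have "finite S" using assms(1,3) finite_subset subgroup.subset by metis
  then obtain x where x: "x \<in> S" "x \<noteq> \<one>" "x [^] r = \<one>"
    using S.cauchy[of r] assms(2) r by (auto simp: order_def simp flip: nat_pow_consistent)
  then show False
    using assms(4)[OF x(1)] pow_coprime_eq_one[OF subgroup.mem_carrier[OF assms(3) x(1)]] by blast
qed

lemma card_p_group:
  assumes "finite (carrier G)" "prime p" "subgroup S G"
    and "\<And>x. x \<in> S \<Longrightarrow> \<exists>k. x [^] (p ^ k :: nat) = \<one>"
  obtains k where "card S = p ^ k"
proof -
  have "card S > 0" using subgroup.finite_imp_card_positive[OF assms(3,1)] .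
  then obtain k m where km: "card S = p ^ k * m" "coprime m p" using nat_factor_coprime assms(2) by blast
  have "m = 1"
  proof (rule ccontr)
    assume "m \<noteq> 1"
    then obtain r where r: "prime r" "r dvd m" using prime_factor_nat by blast
    have "r \<noteq> p"
    proof
      assume "r = p"
      then have "is_unit p" using r(2) coprime_common_divisor[OF km(2), of p] by simp
      then show False using not_prime_unit assms(2) by blast
    qed
    then have "coprime p r" using r(1) assms(2) primes_coprime by blast
    then have "coprime (p ^ j) r" for j by simp
    then have "\<exists>m. coprime m r \<and> x [^] (m::nat) = \<one>" if "x \<in> S" for x
      using assms(4)[OF that] by blast
    then have "\<not> r dvd card S" by (rule prime_not_dvd_card_subgroup[OF assms(1) r(1) assms(3)])
    then show False using r(2) km(1) by simp
  qed
  then show thesis using that km(1) by simp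
qed

lemma p_elements_of_card:
  assumes "finite (carrier G)" "subgroup S G" "card S = p ^ k"
  shows "p_elements G p S = S"
proof -
  interpret S: group "G\<lparr>carrier := S\<rparr>" by (rule subgroup_imp_group[OF assms(2)])
  have "x [^] (p ^ k) = \<one>" if "x \<in> S" for x
    using S.pow_order_eq_1[of x] that assms(3) by (simp add: order_def flip: nat_pow_consistent)
  then show ?thesis unfolding p_elements_def by blast
qed

end

locale nilpotent_subgroup = group G + D: subgroup D G for G :: "('a, 'b) monoid_scheme" (structure) and D +
  assumes fin: "finite (carrier G)" and nil: "nilpotent_in G D"
begin

lemma p_p'_commute:
  assumes "u \<in> p_elements G p D" "v \<in> p'_elements G p D"
  shows "u \<otimes> v = v \<otimes> u"
proof -
  obtain k m where "u [^] (p ^ k) = \<one>" "v [^] m = \<one>" "coprime m p" "u \<in> D" "v \<in> D"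
    using assms unfolding p_elements_def p'_elements_def by blast
  then show ?thesis
    using nilpotent_in_coprime_commute[OF nil, of u v "p ^ k" m] by (simp add: coprime_commute)
qed

lemma subgroup_p_elements: "subgroup (p_elements G p D) G"
proof (rule subgroupI)
  show "p_elements G p D \<subseteq> carrier G" using D.subset unfolding p_elements_def by blast
  show "p_elements G p D \<noteq> {}" using D.one_closed nat_pow_one unfolding p_elements_def by blast
  show "inv x \<in> p_elements G p D" if "x \<in> p_elements G p D" for x
    using that nat_pow_inv[of x] D.mem_carrier unfolding p_elements_def by auto
  show "x \<otimes> y \<in> p_elements G p D" if xy: "x \<in> p_elements G p D" "y \<in> p_elements G p D" for x y
  proof -
    obtain a b where ab: "x \<in> D" "y \<in> D" "x [^] (p ^ a) = \<one>" "y [^] (p ^ b) = \<one>"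
      using xy unfolding p_elements_def by blast
    have "x [^] (p ^ (a + b)) = (x [^] (p ^ a)) [^] (p ^ b)"
      using D.mem_carrier[OF ab(1)] by (simp add: nat_pow_pow power_add)
    moreover have "y [^] (p ^ (a + b)) = (y [^] (p ^ b)) [^] (p ^ a)"
      using D.mem_carrier[OF ab(2)] by (simp add: nat_pow_pow power_add mult.commute)
    ultimately have "x [^] (p ^ (a + b)) = \<one>" "y [^] (p ^ (a + b)) = \<one>"
      using ab(3,4) by simp_all
    then obtain k where "(x \<otimes> y) [^] ((p ^ (a + b)) ^ k) = \<one>"
      using nilpotent_in_exponent_mult[OF nil ab(1,2)] by blast
    then show ?thesis using ab(1,2) unfolding p_elements_def by (auto simp flip: power_mult)
  qed
qed

lemma subgroup_p'_elements: "subgroup (p'_elements G p D) G"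
proof (rule subgroupI)
  show "p'_elements G p D \<subseteq> carrier G" using D.subset unfolding p'_elements_def by blast
  show "p'_elements G p D \<noteq> {}"
    using D.one_closed nat_pow_one coprime_1_left unfolding p'_elements_def by blast
  show "inv x \<in> p'_elements G p D" if "x \<in> p'_elements G p D" for x
    using that nat_pow_inv[of x] D.mem_carrier unfolding p'_elements_def by auto
  show "x \<otimes> y \<in> p'_elements G p D" if xy: "x \<in> p'_elements G p D" "y \<in> p'_elements G p D" for x y
  proof -
    obtain a b where ab: "x \<in> D" "y \<in> D" "x [^] a = \<one>" "y [^] b = \<one>" "coprime a p" "coprime b p"
      using xy unfolding p'_elements_def by blast
    have "x [^] (a * b) = \<one>" using ab(3) nat_pow_pow[of x a b] D.mem_carrier[OF ab(1)] by simp
    moreover have "y [^] (a * b) = \<one>"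
      using ab(4) nat_pow_pow[of y b a] D.mem_carrier[OF ab(2)] by (simp add: mult.commute)
    ultimately obtain k where "(x \<otimes> y) [^] ((a * b) ^ k) = \<one>"
      using nilpotent_in_exponent_mult[OF nil ab(1,2)] by blast
    moreover have "coprime ((a * b) ^ k) p" using ab(5,6) by simp
    moreover have "x \<otimes> y \<in> D" using ab(1,2) by simp
    ultimately show ?thesis unfolding p'_elements_def by blast
  qed
qed

lemma p_p'_inter:
  assumes "x \<in> p_elements G p D" "x \<in> p'_elements G p D"
  shows "x = \<one>"
proof -
  obtain k m where "x [^] (p ^ k) = \<one>" "x [^] m = \<one>" "coprime m p" "x \<in> D"
    using assms unfolding p_elements_def p'_elements_def by blast
  then show ?thesis
    using pow_coprime_eq_one[of x "p ^ k" m] by (simp add: coprime_commute)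
qed

lemma card_p_elements:
  assumes "prime p"
  obtains k where "card (p_elements G p D) = p ^ k"
  using card_p_group[OF fin assms subgroup_p_elements[of p]] unfolding p_elements_def by blast

end

section \<open>Scalar defects\<close>

text \<open>If a finite group with nilpotent derived subgroup is \<open>w\<close>-supersoluble, then it is
  supersoluble, and an element acts on a chief factor of order \<open>p\<close> through a group of order
  dividing \<open>p - 1\<close>. The commutators below are the obstructions to this. It suffices to look at the
  \<open>p\<close>-parts of \<open>G'\<close>, because \<open>G\<close> centralizes the chief factors above \<open>G'\<close>, and to let elements of
  prime power order prime to \<open>p\<close> act, because \<open>p\<close>-elements centralize chief factors of order \<open>p\<close>.\<close>
definition scalar_defects :: "('a, 'b) monoid_scheme \<Rightarrow> 'a set" where
  "scalar_defects G = {commutator G (x [^]\<^bsub>G\<^esub> (p - 1 :: nat)) t | p q x t. prime p \<and> prime q \<and> p \<noteq> q \<and>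
     x \<in> p_elements G q (carrier G) \<and> t \<in> p_elements G p (derived G (carrier G))}"

definition scalar_residual :: "('a, 'b) monoid_scheme \<Rightarrow> 'a set" where
  "scalar_residual G = generate G (scalar_defects G)"

lemma (in group) scalar_defectsI:
  assumes "prime p" "prime q" "p \<noteq> q" "x \<in> p_elements G q (carrier G)"
    "t \<in> p_elements G p (derived G (carrier G))"
  shows "commutator G (x [^] (p - 1 :: nat)) t \<in> scalar_defects G"
  using assms unfolding scalar_defects_def by blast

lemma (in group) derived_carrier_subset: "derived G (carrier G) \<subseteq> carrier G"
  by (simp add: derived_in_carrier)

lemma (in group) scalar_defects_carrier: "scalar_defects G \<subseteq> carrier G"
  using derived_carrier_subset unfolding scalar_defects_def p_elements_def by auto

lemma (in group) scalar_residualI: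
  "x \<in> scalar_defects G \<Longrightarrow> x \<in> scalar_residual G"
  unfolding scalar_residual_def by (rule generate.incl)

lemma (in group) scalar_defects_restrict:
  assumes H: "subgroup H G"
  shows "scalar_defects (G\<lparr>carrier := H\<rparr>) = {commutator G (x [^] (p - 1 :: nat)) t | p q x t.
    prime p \<and> prime q \<and> p \<noteq> q \<and> x \<in> p_elements G q H \<and> t \<in> p_elements G p (derived G H)}"
proof -
  have dH: "derived (G\<lparr>carrier := H\<rparr>) H = derived G H" by (rule derived_consistent[OF subset_refl H])
  have "derived G H \<subseteq> H" by (rule derived_incl[OF subset_refl H])
  then have com: "commutator (G\<lparr>carrier := H\<rparr>) (x [^]\<^bsub>G\<lparr>carrier := H\<rparr>\<^esub> (n::nat)) t = commutator G (x [^] n) t"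
    if "x \<in> p_elements G q H" "t \<in> p_elements G p (derived G H)" for x n t p q
    using that commutator_consistent[OF H pow_mem[OF H]] unfolding p_elements_def by (auto simp flip: nat_pow_consistent)
  show ?thesis
    unfolding scalar_defects_def
    by (intro Collect_cong iff_exI) (use com in \<open>auto simp: dH\<close>)
qed

lemma (in group) scalar_residual_restrict:
  assumes H: "subgroup H G"
  shows "scalar_residual (G\<lparr>carrier := H\<rparr>) = generate G (scalar_defects (G\<lparr>carrier := H\<rparr>))"
    "scalar_defects (G\<lparr>carrier := H\<rparr>) \<subseteq> H"
proof -
  show "scalar_defects (G\<lparr>carrier := H\<rparr>) \<subseteq> H"
    using group.scalar_defects_carrier[OF subgroup_imp_group[OF H]] by simp
  then show "scalar_residual (G\<lparr>carrier := H\<rparr>) = generate G (scalar_defects (G\<lparr>carrier := H\<rparr>))"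
    unfolding scalar_residual_def by (rule generate_consistent[OF _ H])
qed

lemma (in group) scalar_residual_normal_subgroup:
  assumes A: "A \<lhd> G"
  shows "scalar_residual (G\<lparr>carrier := A\<rparr>) \<lhd> G"
proof -
  have AG: "subgroup A G" by (rule normal_imp_subgroup[OF A])
  show ?thesis
    unfolding scalar_residual_restrict(1)[OF AG]
  proof (rule normal_generateI)
    show "scalar_defects (G\<lparr>carrier := A\<rparr>) \<subseteq> carrier G"
      using scalar_residual_restrict(2)[OF AG] subgroup.subset[OF AG] by blast
    fix h g assume "h \<in> scalar_defects (G\<lparr>carrier := A\<rparr>)" and g: "g \<in> carrier G"
    then obtain p q x t where h: "h = commutator G (x [^] (p - 1 :: nat)) t" "prime p" "prime q" "p \<noteq> q"
      and x: "x \<in> p_elements G q A" and t: "t \<in> p_elements G p (derived G A)"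
      unfolding scalar_defects_restrict[OF AG] by blast
    have c: "x \<in> carrier G" "t \<in> carrier G"
      using x t subgroup.subset[OF AG] derived_in_carrier[of A] unfolding p_elements_def by blast+
    have "g \<otimes> h \<otimes> inv g = commutator G ((g \<otimes> x \<otimes> inv g) [^] (p - 1)) (g \<otimes> t \<otimes> inv g)"
      unfolding h(1) using g c by (simp add: conj_commutator conj_pow)
    then show "g \<otimes> h \<otimes> inv g \<in> scalar_defects (G\<lparr>carrier := A\<rparr>)"
      unfolding scalar_defects_restrict[OF AG]
      using h(2-4) conj_mem_p_elements[OF A g x] conj_mem_p_elements[OF derived_is_normal[OF A] g t] by blast
  qed
qed

lemma (in group) scalar_residual_normal: "scalar_residual G \<lhd> G"
  using scalar_residual_normal_subgroup[OF normal_self] by simp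

lemma (in group) scalar_residual_subgroup:
  assumes H: "subgroup H G"
  shows "scalar_residual (G\<lparr>carrier := H\<rparr>) \<subseteq> scalar_residual G"
proof -
  have "scalar_defects (G\<lparr>carrier := H\<rparr>) \<subseteq> scalar_defects G"
    using mono_derived[OF subgroup.subset[OF H]] subgroup.subset[OF H]
    unfolding scalar_defects_restrict[OF H] scalar_defects_def[of G] p_elements_def by blast
  then show ?thesis
    unfolding scalar_residual_restrict(1)[OF H] scalar_residual_def[of G] by (rule mono_generate)
qed

lemma (in group) scalar_residual_restrictI:
  assumes H: "subgroup H G" and p: "prime p" "prime q" "p \<noteq> q" and x: "x \<in> p_elements G q H"
    and t: "t \<in> p_elements G p (derived G H)"
  shows "commutator G (x [^] (p - 1 :: nat)) t \<in> scalar_residual (G\<lparr>carrier := H\<rparr>)"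
  unfolding scalar_residual_restrict(1)[OF H] scalar_defects_restrict[OF H]
  by (rule generate.incl) (use assms in blast)

lemma (in group_hom) p_elements_image:
  "h ` p_elements G p S \<subseteq> p_elements H p (h ` S)" if "S \<subseteq> carrier G"
proof
  fix y assume "y \<in> h ` p_elements G p S"
  then obtain x k where x: "x \<in> S" "x [^] (p ^ k) = \<one>" "y = h x" unfolding p_elements_def by blast
  then have "y [^]\<^bsub>H\<^esub> (p ^ k) = \<one>\<^bsub>H\<^esub>"
    using hom_nat_pow[of x "p ^ k"] that by auto
  then show "y \<in> p_elements H p (h ` S)" using x unfolding p_elements_def by blast
qed

text \<open>A preimage \<open>s\<close> of \<open>y\<close> is the product of powers of \<open>s\<close> of \<open>p\<close>-power order and of order prime to
  \<open>p\<close>; the image of the second is trivial.\<close>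
lemma (in group_hom) p_elements_lift:
  assumes "finite (carrier G)" "prime p" "subgroup S G" "y \<in> p_elements H p (h ` S)"
  obtains x where "x \<in> p_elements G p S" "h x = y"
proof -
  obtain s j where s: "s \<in> S" "y = h s" "y [^]\<^bsub>H\<^esub> (p ^ j) = \<one>\<^bsub>H\<^esub>"
    using assms(4) unfolding p_elements_def by blast
  have Sc: "s \<in> carrier G" using subgroup.mem_carrier[OF assms(3) s(1)] .
  have "order G > 0" using assms(1) G.order_gt_0_iff_finite by blast
  then obtain k m where km: "order G = p ^ k * m" "coprime m p" using G.nat_factor_coprime assms(2) by blast
  have 1: "s [^] (p ^ k * m) = \<one>" using G.pow_order_eq_1[OF Sc] km by simp
  have 2: "coprime (p ^ k) m" using km(2) by (simp add: coprime_commute)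
  obtain a b :: nat where ab: "s = s [^] a \<otimes> s [^] b" "(s [^] a) [^] (p ^ k) = \<one>" "(s [^] b) [^] m = \<one>"
    using G.coprime_decomposition[OF Sc 1 2] .
  have "h (s [^] b) = \<one>\<^bsub>H\<^esub>"
  proof (rule H.pow_coprime_eq_one)
    show "h (s [^] b) \<in> carrier H" using Sc by simp
    show "h (s [^] b) [^]\<^bsub>H\<^esub> m = \<one>\<^bsub>H\<^esub>" using ab(3) hom_nat_pow[of "s [^] b" m] Sc by simp
    show "h (s [^] b) [^]\<^bsub>H\<^esub> (p ^ j) = \<one>\<^bsub>H\<^esub>"
    proof -
      have "h (s [^] b) [^]\<^bsub>H\<^esub> (p ^ j) = (y [^]\<^bsub>H\<^esub> (p ^ j)) [^]\<^bsub>H\<^esub> b"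
        using s(2) Sc by (simp add: hom_nat_pow H.nat_pow_pow mult.commute)
      then show ?thesis using s(3) by simp
    qed
    show "coprime m (p ^ j)" using km(2) by simp
  qed
  then have "h (s [^] a) = y" using s(2) ab(1) Sc hom_mult[of "s [^] a" "s [^] b"] by simp
  moreover have "s [^] a \<in> p_elements G p S"
    using ab(2) G.pow_mem[OF assms(3) s(1)] unfolding p_elements_def by blast
  ultimately show thesis using that by blast
qed

lemma (in normal) derived_Mod: "derived (G Mod H) (carrier (G Mod H)) = (\<lambda>x. H #> x) ` derived G (carrier G)"
proof -
  interpret \<pi>: group_hom G "G Mod H" "\<lambda>x. H #> x" by (rule mod_hom)
  show ?thesis using \<pi>.derived_img[OF subset_refl] by (simp add: carrier_FactGroup)
qed

text \<open>The \<open>q\<close>-elements of \<open>G\<close> and the \<open>p\<close>-elements of \<open>G'\<close> map onto those of the quotient, so the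
  defects of the quotient are the images of the defects of \<open>G\<close>.\<close>
lemma (in normal) scalar_residual_Mod_trivial_iff:
  assumes fin: "finite (carrier G)"
  shows "scalar_residual (G Mod H) = {\<one>\<^bsub>G Mod H\<^esub>} \<longleftrightarrow> scalar_residual G \<subseteq> H"
proof -
  interpret Q: group "G Mod H" by (rule factorgroup_is_group)
  interpret \<pi>: group_hom G "G Mod H" "\<lambda>x. H #> x" by (rule mod_hom)
  have car: "carrier (G Mod H) = (\<lambda>x. H #> x) ` carrier G" by (rule carrier_FactGroup)
  have "scalar_defects (G Mod H) = (\<lambda>x. H #> x) ` scalar_defects G"
  proof (intro equalityI subsetI)
    fix z assume "z \<in> scalar_defects (G Mod H)"
    then obtain p q x t where z: "z = commutator (G Mod H) (x [^]\<^bsub>G Mod H\<^esub> (p - 1 :: nat)) t"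
      "prime p" "prime q" "p \<noteq> q" "x \<in> p_elements (G Mod H) q (carrier (G Mod H))"
      "t \<in> p_elements (G Mod H) p (derived (G Mod H) (carrier (G Mod H)))"
      unfolding scalar_defects_def by blast
    have z5: "x \<in> p_elements (G Mod H) q ((\<lambda>x. H #> x) ` carrier G)" using z(5) by (simp only: car)
    have z6: "t \<in> p_elements (G Mod H) p ((\<lambda>x. H #> x) ` derived G (carrier G))"
      using z(6) by (simp only: derived_Mod)
    obtain a where a: "a \<in> p_elements G q (carrier G)" "H #> a = x"
      using \<pi>.p_elements_lift[OF fin z(3) subgroup_self z5] .
    obtain b where b: "b \<in> p_elements G p (derived G (carrier G))" "H #> b = t"
      using \<pi>.p_elements_lift[OF fin z(2) derived_is_subgroup[OF subset_refl] z6] .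
    have "a \<in> carrier G" "b \<in> carrier G" using a b derived_carrier_subset unfolding p_elements_def by blast+
    then have "z = H #> commutator G (a [^] (p - 1)) b"
      unfolding z(1) a(2)[symmetric] b(2)[symmetric] by (simp only: \<pi>.hom_commutator \<pi>.hom_nat_pow nat_pow_closed)
    then show "z \<in> (\<lambda>x. H #> x) ` scalar_defects G" using scalar_defectsI[OF z(2-4) a(1) b(1)] by blast
  next
    fix z assume "z \<in> (\<lambda>x. H #> x) ` scalar_defects G"
    then obtain p q x t where z: "z = H #> commutator G (x [^] (p - 1 :: nat)) t"
      "prime p" "prime q" "p \<noteq> q" "x \<in> p_elements G q (carrier G)" "t \<in> p_elements G p (derived G (carrier G))"
      unfolding scalar_defects_def by blast
    have xt: "x \<in> carrier G" "t \<in> carrier G" using z(5,6) derived_carrier_subset unfolding p_elements_def by blast+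
    have "H #> x \<in> p_elements (G Mod H) q (carrier (G Mod H))"
      using \<pi>.p_elements_image[OF subset_refl, of q] z(5) car by auto
    moreover have "H #> t \<in> p_elements (G Mod H) p (derived (G Mod H) (carrier (G Mod H)))"
      unfolding derived_Mod using \<pi>.p_elements_image[OF derived_carrier_subset, of p] z(6) by blast
    ultimately have "commutator (G Mod H) ((H #> x) [^]\<^bsub>G Mod H\<^esub> (p - 1)) (H #> t) \<in> scalar_defects (G Mod H)"
      by (rule Q.scalar_defectsI[OF z(2-4)])
    then show "z \<in> scalar_defects (G Mod H)"
      using z(1) xt by (simp only: \<pi>.hom_commutator \<pi>.hom_nat_pow nat_pow_closed)
  qed
  then have img: "scalar_residual (G Mod H) = (\<lambda>x. H #> x) ` scalar_residual G"
    unfolding scalar_residual_def using \<pi>.generate_img[OF scalar_defects_carrier] by (simp only:)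
  define R where "R = scalar_residual G"
  have R: "subgroup R G" unfolding R_def by (rule normal_imp_subgroup[OF scalar_residual_normal])
  have "H #> \<one> = \<one>\<^bsub>G Mod H\<^esub>" using in_mod_eq_one_iff[of \<one>] one_closed by simp
  then have "(\<lambda>x. H #> x) ` R = {\<one>\<^bsub>G Mod H\<^esub>} \<longleftrightarrow> (\<forall>x\<in>R. H #> x = \<one>\<^bsub>G Mod H\<^esub>)"
    using subgroup.one_closed[OF R] by (auto simp only: image_iff)
  also have "\<dots> \<longleftrightarrow> R \<subseteq> H"
    using in_mod_eq_one_iff subgroup.mem_carrier[OF R] by (metis subset_eq)
  finally show ?thesis by (simp only: img R_def)
qed

context group
begin

lemma card_subgroup_dvd:
  assumes "finite (carrier G)" "subgroup A G" "subgroup B G" "A \<subseteq> B"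
  shows "card A dvd card B"
proof -
  interpret B: group "G\<lparr>carrier := B\<rparr>" by (rule subgroup_imp_group[OF assms(3)])
  have "card (rcosets\<^bsub>G\<lparr>carrier := B\<rparr>\<^esub> A) * card A = order (G\<lparr>carrier := B\<rparr>)"
    by (rule B.lagrange[OF subgroup_incl[OF assms(2-4)]])
  then have "card B = card (rcosets\<^bsub>G\<lparr>carrier := B\<rparr>\<^esub> A) * card A" by (simp add: order_def)
  then show ?thesis by (rule dvdI[where k = "card (rcosets\<^bsub>G\<lparr>carrier := B\<rparr>\<^esub> A)", OF trans[OF _ mult.commute]])
qed

lemma pow_mod_normal:
  assumes N: "N \<lhd> G" and ab: "a \<in> carrier G" "b \<in> carrier G" "inv a \<otimes> b \<in> N"
  shows "inv (a [^] (n::nat)) \<otimes> b [^] n \<in> N"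
proof (induction n)
  case 0
  show ?case using subgroup.one_closed[OF normal_imp_subgroup[OF N]] by simp
next
  case (Suc n)
  have "inv (a [^] Suc n) \<otimes> b [^] Suc n = (inv a \<otimes> (inv (a [^] n) \<otimes> b [^] n) \<otimes> a) \<otimes> (inv a \<otimes> b)"
    using ab(1,2) by (simp add: word_simps)
  moreover have "inv a \<otimes> (inv (a [^] n) \<otimes> b [^] n) \<otimes> a \<in> N"
    by (rule normal.inv_op_closed1[OF N ab(1) Suc])
  ultimately show ?case
    using subgroup.m_closed[OF normal_imp_subgroup[OF N] _ ab(3)] by simp
qed

text \<open>The least positive \<open>d\<close> with \<open>g\<^sup>d \<in> Z\<close> divides every exponent \<open>m\<close> with \<open>g\<^sup>m \<in> Z\<close>. A prime
  factor \<open>q\<close> of \<open>d\<close> would thus divide the part of \<open>\<bar>G\<bar>\<close> prime to \<open>q\<close>.\<close>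
lemma mem_if_prime_power_parts_mem:
  assumes fin: "finite (carrier G)" and Z: "subgroup Z G" and g: "g \<in> carrier G"
    and parts: "\<And>q a m. \<lbrakk>prime q; order G = q ^ a * m; coprime m q\<rbrakk> \<Longrightarrow> g [^] (m::nat) \<in> Z"
  shows "g \<in> Z"
proof -
  have pos: "order G > 0" using fin order_gt_0_iff_finite by blast
  define d where "d = (LEAST d::nat. d > 0 \<and> g [^] d \<in> Z)"
  have ex: "order G > 0 \<and> g [^] order G \<in> Z"
    using pos pow_order_eq_1[OF g] subgroup.one_closed[OF Z] by simp
  have "d > 0 \<and> g [^] d \<in> Z" unfolding d_def using ex by (rule LeastI)
  then have d: "d > 0" "g [^] d \<in> Z" by simp_all
  have dvd: "d dvd k" if k: "g [^] k \<in> Z" for k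
  proof -
    have dc: "g [^] (d * i + r) = (g [^] d) [^] i \<otimes> g [^] r" for i r
      using g by (simp add: nat_pow_pow nat_pow_mult)
    have "g [^] k = (g [^] d) [^] (k div d) \<otimes> g [^] (k mod d)" using dc[of "k div d" "k mod d"] by simp
    then have "g [^] (k mod d) = inv ((g [^] d) [^] (k div d)) \<otimes> g [^] k" using g by simp
    then have "g [^] (k mod d) \<in> Z"
      using subgroup.m_closed[OF Z subgroup.m_inv_closed[OF Z pow_mem[OF Z d(2)]] k] by simp
    moreover have "\<not> (k mod d > 0 \<and> g [^] (k mod d) \<in> Z)"
      using not_less_Least[of "k mod d" "\<lambda>d. d > 0 \<and> g [^] d \<in> Z"] d(1) by (simp add: d_def[symmetric])
    ultimately have "k mod d = 0" by simp
    then show ?thesis by blast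
  qed
  have "d = 1"
  proof (rule ccontr)
    assume "d \<noteq> 1"
    then obtain q where q: "prime q" "q dvd d" using prime_factor_nat by blast
    obtain a m where m: "order G = q ^ a * m" "coprime m q" using nat_factor_coprime[OF pos q(1)] .
    have "q dvd m" using dvd[OF parts[OF q(1) m]] q(2) by (rule dvd_trans[rotated])
    then have "is_unit q" using coprime_common_divisor[OF m(2)] by simp
    then show False using q(1) not_prime_unit by blast
  qed
  then show ?thesis using d(2) g by simp
qed

text \<open>The subgroup \<open>Q G'\<close> is normal and its index is prime to \<open>q\<close>, so it contains all
  \<open>q\<close>-elements.\<close>
lemma sylow_mult_derived:
  assumes fin: "finite (carrier G)" and q: "prime q" and Q: "subgroup Q G" "card Q = q ^ multiplicity q (order G)"
    and x: "x \<in> p_elements G q (carrier G)"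
  obtains c where "c \<in> Q" "inv c \<otimes> x \<in> derived G (carrier G)"
proof -
  define D where "D = derived G (carrier G)"
  have D: "D \<lhd> G" unfolding D_def by (rule derived_self_is_normal)
  define S where "S = Q <#> D"
  have SD: "S = D <#> Q" unfolding S_def using commut_normal[OF Q(1) D] by simp
  have S: "subgroup S G" unfolding SD by (rule mult_norm_subgroup[OF D Q(1)])
  have QS: "Q \<subseteq> S" and DS: "D \<subseteq> S"
    unfolding S_def using set_mult_contains[OF Q(1) normal_imp_subgroup[OF D]] by simp_all
  have SN: "S \<lhd> G"
  proof (rule normal_invI[OF S])
    fix g s assume g: "g \<in> carrier G" and s: "s \<in> S"
    have sc: "s \<in> carrier G" using subgroup.mem_carrier[OF S s] .
    have "commutator G g s \<in> S" using commutator_in_derived[OF g sc] DS unfolding D_def by blast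
    then show "g \<otimes> s \<otimes> inv g \<in> S"
      using subgroup.m_closed[OF S _ s] commutator_mult_eq[OF g sc] by simp
  qed
  interpret S: normal S G by (rule SN)
  interpret SQ: group "G Mod S" by (rule S.factorgroup_is_group)
  define m where "m = card (rcosets S)"
  have xc: "x \<in> carrier G" using x unfolding p_elements_def by blast
  have "order (G Mod S) = m" by (simp add: order_def m_def FactGroup_def)
  then have "(S #> x) [^]\<^bsub>G Mod S\<^esub> m = \<one>\<^bsub>G Mod S\<^esub>"
    using SQ.pow_order_eq_1[of "S #> x"] xc by (simp add: carrier_FactGroup)
  then have xm: "x [^] m \<in> S" using S.FactGroup_pow[OF xc] S.in_mod_eq_one_iff[of "x [^] m"] xc by simp
  have "\<not> q dvd m"
  proof
    assume "q dvd m"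
    moreover have "q ^ multiplicity q (order G) dvd card S"
      using card_subgroup_dvd[OF fin Q(1) S QS] Q(2) by simp
    ultimately have "q * q ^ multiplicity q (order G) dvd m * card S" by (rule mult_dvd_mono)
    then have "q ^ Suc (multiplicity q (order G)) dvd order G"
      using lagrange[OF S] by (simp add: m_def)
    moreover have "order G \<noteq> 0" using fin order_gt_0_iff_finite by simp
    ultimately show False
      using q power_dvd_iff_le_multiplicity[of "order G" q] not_prime_unit by (metis Suc_n_not_le_n)
  qed
  then have "coprime m q" using q prime_imp_coprime_nat coprime_commute by blast
  moreover obtain j where "x [^] (q ^ j) = \<one>" using x unfolding p_elements_def by blast
  ultimately have "x \<in> S"
    using pow_coprime_mem[OF S xc xm, of "q ^ j"] subgroup.one_closed[OF S] by simp
  then obtain c d where cd: "c \<in> Q" "d \<in> D" "x = c \<otimes> d" unfolding S_def set_mult_def by blast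
  then have "inv c \<otimes> x = d"
    using subgroup.mem_carrier[OF Q(1)] subgroup.mem_carrier[OF normal_imp_subgroup[OF D]] by simp
  then show thesis using that cd unfolding D_def by blast
qed

end

section \<open>Finite groups with nilpotent derived subgroup\<close>

locale nilpotent_derived = group +
  assumes finite_carrier: "finite (carrier G)"
    and nilpotent_derived_subgroup: "nilpotent_in G (derived G (carrier G))"

sublocale nilpotent_derived \<subseteq> nilpotent_subgroup G "derived G (carrier G)"
  using nilpotent_derived_subgroup finite_carrier derived_is_subgroup[OF subset_refl]
  by (simp add: nilpotent_subgroup_def nilpotent_subgroup_axioms_def is_group)

context nilpotent_derived
begin

lemma nilpotent_derived_restrict:
  assumes H: "subgroup H G"
  shows "nilpotent_derived (G\<lparr>carrier := H\<rparr>)"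
proof -
  have dH: "derived (G\<lparr>carrier := H\<rparr>) H = derived G H" by (rule derived_consistent[OF subset_refl H])
  have "nilpotent_in G (derived G H)"
    by (rule nilpotent_in_subset[OF nil derived_is_subgroup mono_derived]) (rule subgroup.subset[OF H])+
  then have "nilpotent_in (G\<lparr>carrier := H\<rparr>) (derived G H)"
    by (rule nilpotent_in_restrict[OF _ H derived_incl[OF subset_refl H]])
  moreover have "finite H" using fin subgroup.subset[OF H] finite_subset by blast
  ultimately show ?thesis
    using subgroup_imp_group[OF H] dH by (simp add: nilpotent_derived_def nilpotent_derived_axioms_def)
qed

lemma nilpotent_derived_Mod:
  assumes N: "N \<lhd> G"
  shows "nilpotent_derived (G Mod N)"
proof -
  interpret N: normal N G by (rule N)
  interpret \<pi>: group_hom G "G Mod N" "\<lambda>x. N #> x" by (rule N.mod_hom)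
  have "nilpotent_in (G Mod N) (derived (G Mod N) (carrier (G Mod N)))"
    unfolding N.derived_Mod by (rule \<pi>.nilpotent_in_image[OF nil])
  moreover have "finite (carrier (G Mod N))" using fin by (simp add: carrier_FactGroup)
  ultimately show ?thesis
    using N.factorgroup_is_group by (simp add: nilpotent_derived_def nilpotent_derived_axioms_def)
qed

text \<open>Let \<open>T\<close> be the \<open>p\<close>-part of \<open>G'\<close> and let \<open>C\<close> consist of the elements acting trivially on
  \<open>T / K\<close>. The part of \<open>G'\<close> prime to \<open>p\<close> centralizes \<open>T\<close>, so \<open>z \<in> u C\<close> for some \<open>u \<in> T\<close>, and some
  \<open>z\<close> to a power of \<open>p\<close> lies in \<open>C\<close>. The order of \<open>z\<close> being prime to \<open>p\<close>, so does \<open>z\<close>.\<close>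
lemma p'_element_centralizes_factor:
  assumes p: "prime p" and K: "subgroup K G" "K \<subseteq> p_elements G p (derived G (carrier G))"
    and Kn: "\<And>t k. \<lbrakk>t \<in> p_elements G p (derived G (carrier G)); k \<in> K\<rbrakk> \<Longrightarrow> t \<otimes> k \<otimes> inv t \<in> K"
    and g: "g \<in> carrier G" "\<And>t. t \<in> p_elements G p (derived G (carrier G)) \<Longrightarrow> commutator G g t \<in> K"
    and z: "z \<in> p'_elements G p (carrier G)" "inv g \<otimes> z \<in> derived G (carrier G)"
    and t: "t \<in> p_elements G p (derived G (carrier G))"
  shows "commutator G z t \<in> K"
proof -
  define D where "D = derived G (carrier G)"
  define T where "T = p_elements G p D"
  define C where "C = centralizer_mod G K T"
  have D: "D \<lhd> G" unfolding D_def by (rule derived_self_is_normal)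
  have T: "subgroup T G" unfolding T_def D_def by (rule subgroup_p_elements)
  have Tc: "t \<in> T \<Longrightarrow> t \<in> carrier G" for t using subgroup.mem_carrier[OF T] .
  have TN: "T \<lhd> G" using normal_invI[OF T] conj_mem_p_elements[OF D] unfolding T_def by blast
  have C: "subgroup C G" unfolding C_def by (rule subgroup_centralizer_mod[OF TN K(1)])
  have CT: "u \<otimes> c \<otimes> inv u \<in> C" if u: "u \<in> T" and c: "c \<in> C" for u c
    using conj_centralizer_mod[OF TN Tc[OF u] Kn c[unfolded C_def]] u unfolding C_def T_def D_def by blast
  have gC: "g \<in> C" using g unfolding C_def centralizer_mod_def T_def D_def by blast
  obtain n where n: "z \<in> carrier G" "z [^] n = \<one>" "coprime n p" using z(1) unfolding p'_elements_def by blast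
  obtain u v where uv: "u \<in> T" "v \<in> p'_elements G p D" "inv g \<otimes> z = u \<otimes> v"
    using p_elements_mult_p'_elements[OF fin p D.subgroup_axioms z(2)] unfolding T_def D_def by blast
  have vD: "v \<in> D" using uv(2) unfolding p'_elements_def by blast
  have vc: "v \<in> carrier G" using subgroup.mem_carrier[OF normal_imp_subgroup[OF D] vD] .
  have "commutator G v t = \<one>" if "t \<in> T" for t
    using p_p'_commute[of t p v] that uv(2) vc Tc[OF that] commutator_one_iff[of v t] unfolding T_def D_def by simp
  then have vC: "v \<in> C" using vc subgroup.one_closed[OF K(1)] unfolding C_def centralizer_mod_def by simp
  define w where "w = inv u \<otimes> z"
  have uc: "u \<in> carrier G" using Tc[OF uv(1)] .
  have "z = g \<otimes> (u \<otimes> v)" using uv(3) g(1) n(1) by (metis inv_mult_cancel(2))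
  then have "w = (inv u \<otimes> g \<otimes> u) \<otimes> v" using g(1) uc vc by (simp add: w_def word_simps)
  moreover have "inv u \<otimes> g \<otimes> u \<in> C" using CT[OF subgroup.m_inv_closed[OF T uv(1)] gC] uc by simp
  ultimately have wC: "w \<in> C" using subgroup.m_closed[OF C _ vC] by simp
  have pw: "inv (u [^] j) \<otimes> z [^] j \<in> C" for j :: nat
  proof (induction j)
    case 0
    show ?case using subgroup.one_closed[OF C] by simp
  next
    case (Suc j)
    have "inv (u [^] Suc j) \<otimes> z [^] Suc j = (inv u \<otimes> (inv (u [^] j) \<otimes> z [^] j) \<otimes> u) \<otimes> w"
      using uc n(1) by (simp add: w_def word_simps)
    moreover have "inv u \<otimes> (inv (u [^] j) \<otimes> z [^] j) \<otimes> u \<in> C"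
      using CT[OF subgroup.m_inv_closed[OF T uv(1)] Suc] uc by simp
    ultimately show ?case using subgroup.m_closed[OF C _ wC] by simp
  qed
  obtain k where "u [^] (p ^ k) = \<one>" using uv(1) unfolding T_def p_elements_def by blast
  then have "z [^] (p ^ k) \<in> C" using pw[of "p ^ k"] n(1) by simp
  moreover have "z [^] n \<in> C" using n(2) subgroup.one_closed[OF C] by simp
  moreover have "coprime (p ^ k) n" using n(3) by (simp add: coprime_commute)
  ultimately have "z \<in> C" using pow_coprime_mem[OF C n(1)] by blast
  then show ?thesis using t unfolding C_def centralizer_mod_def T_def D_def by blast
qed

text \<open>As a minimal normal subgroup, the nilpotent group \<open>G'\<close> is elementary abelian, so \<open>G\<close> acts
  on it through an abelian group. A \<open>p\<close>-element has nontrivial fixed points, which form a normal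
  subgroup, so it acts trivially; together with the vanishing of the defects, the \<open>(p - 1)\<close>-st
  power of every element acts trivially. Hence every element has an eigenvector; the eigenspace is
  normal, hence everything, and the element acts as a scalar. Then every cyclic subgroup of \<open>G'\<close> is
  normal.\<close>
lemma minimal_derived_prime_order:
  assumes triv: "scalar_residual G = {\<one>}" and ne: "derived G (carrier G) \<noteq> {\<one>}"
    and min: "\<And>Y. \<lbrakk>Y \<lhd> G; Y \<subseteq> derived G (carrier G)\<rbrakk> \<Longrightarrow> Y = {\<one>} \<or> Y = derived G (carrier G)"
  shows "prime (card (derived G (carrier G)))"
proof -
  define D where "D = derived G (carrier G)"
  have DN: "D \<lhd> G" unfolding D_def by (rule derived_self_is_normal)
  have D: "subgroup D G" by (rule normal_imp_subgroup[OF DN])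
  have Dc: "d \<in> D \<Longrightarrow> d \<in> carrier G" for d using subgroup.mem_carrier[OF D] .
  have Dconj: "g \<otimes> d \<otimes> inv g \<in> D" if "g \<in> carrier G" "d \<in> D" for g d
    using normal_invE(2)[OF DN that] .
  have finD: "finite D" using fin subgroup.subset[OF D] finite_subset by blast
  have minD: "Y = D" if "Y \<lhd> G" "Y \<subseteq> D" "y \<in> Y" "y \<noteq> \<one>" for Y y
    using min[of Y] that unfolding D_def by blast
  obtain z where z: "z \<in> D" "z \<noteq> \<one>" "\<And>d. d \<in> D \<Longrightarrow> z \<otimes> d = d \<otimes> z"
    using nilpotent_in_center[OF nil ne, folded D_def] by metis
  define C where "C = centralizer_mod G {\<one>} D"
  have C: "subgroup C G" unfolding C_def by (rule subgroup_centralizer_mod[OF DN triv_subgroup])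
  have C_iff: "g \<in> C \<longleftrightarrow> g \<in> carrier G \<and> (\<forall>d\<in>D. g \<otimes> d \<otimes> inv g = d)" for g
    using commutator_mult_eq[of g] Dc unfolding C_def centralizer_mod_def by auto
  have CN: "C \<lhd> G"
  proof (rule normal_invI[OF C])
    show "g \<otimes> c \<otimes> inv g \<in> C" if "g \<in> carrier G" "c \<in> C" for g c
      using conj_centralizer_mod[OF DN that(1) _ that(2)[unfolded C_def]] that(1) by (simp add: C_def)
  qed
  have "z \<in> C" using z(1,3) Dc unfolding C_iff by (simp add: m_assoc)
  then have "D \<inter> C = D"
    using minD[OF normal_subgroup_intersect[OF DN CN] _ _ z(2)] z(1) by blast
  then have comm: "a \<otimes> b = b \<otimes> a" if "a \<in> D" "b \<in> D" for a b
    using that C_iff[of a] Dc inv_solve_right'[of b "a \<otimes> b" a] by blast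
  define V where "V = G\<lparr>carrier := D\<rparr>"
  interpret V: comm_group V
    unfolding V_def by (rule group.group_comm_groupI[OF subgroup_imp_group[OF D]]) (use comm in simp)
  have Vs: "carrier V = D" "monoid.mult V = monoid.mult G" "\<one>\<^bsub>V\<^esub> = \<one>" by (simp_all add: V_def)
  have Vpow: "a [^]\<^bsub>V\<^esub> (n::nat) = a [^] n" for a n unfolding V_def by (rule nat_pow_consistent[symmetric])
  have "card D \<noteq> 1" using z subgroup.one_closed[OF D] by (metis card_1_singletonE singletonD)
  then obtain p where p: "prime p" "p dvd card D" using prime_factor_nat by blast
  obtain x where x: "x \<in> D" "x \<noteq> \<one>" "x [^] p = \<one>"
  proof (rule V.cauchy[OF _ p(1)])
    show "finite (carrier V)" "p dvd order V" using finD p(2) Vs by (simp_all add: order_def)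
  qed (simp add: Vs Vpow)
  \<comment> \<open>The eigenspace of \<open>h\<close> for the eigenvalue \<open>c\<close>; it is normal because \<open>G\<close> acts through an abelian group.\<close>
  define E where "E h c = {d \<in> D. h \<otimes> d \<otimes> inv h = d [^] c}" for h and c :: nat
  have EN: "E h c \<lhd> G" if h: "h \<in> carrier G" for h c
  proof (rule normal_invI)
    show "subgroup (E h c) G"
    proof (rule subgroupI)
      show "E h c \<subseteq> carrier G" using Dc unfolding E_def by blast
      have "\<one> \<in> E h c" using subgroup.one_closed[OF D] h unfolding E_def by simp
      then show "E h c \<noteq> {}" by blast
      fix a assume "a \<in> E h c"
      then have a: "a \<in> D" "h \<otimes> a \<otimes> inv h = a [^] c" unfolding E_def by blast+
      have "h \<otimes> inv a \<otimes> inv h = inv (h \<otimes> a \<otimes> inv h)" using h Dc[OF a(1)] by (simp add: word_simps)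
      then have "h \<otimes> inv a \<otimes> inv h = inv a [^] c" using a Dc by (simp add: nat_pow_inv)
      then show "inv a \<in> E h c" using subgroup.m_inv_closed[OF D a(1)] unfolding E_def by simp
      fix b assume "b \<in> E h c"
      then have b: "b \<in> D" "h \<otimes> b \<otimes> inv h = b [^] c" unfolding E_def by blast+
      have "h \<otimes> (a \<otimes> b) \<otimes> inv h = (h \<otimes> a \<otimes> inv h) \<otimes> (h \<otimes> b \<otimes> inv h)"
        using h Dc[OF a(1)] Dc[OF b(1)] by (simp add: word_simps)
      also have "\<dots> = (a \<otimes> b) [^] c"
        using a b Dc pow_mult_distrib[OF comm[OF a(1) b(1)], of c] by simp
      finally show "a \<otimes> b \<in> E h c" using subgroup.m_closed[OF D a(1) b(1)] unfolding E_def by simp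
    qed
    fix g d assume g: "g \<in> carrier G" and "d \<in> E h c"
    then have d: "d \<in> D" "h \<otimes> d \<otimes> inv h = d [^] c" unfolding E_def by blast+
    define a where "a = commutator G (inv g) h"
    have a: "a \<in> D" unfolding a_def D_def using g h by (intro commutator_in_derived) auto
    define e where "e = h \<otimes> d \<otimes> inv h"
    have e: "e \<in> D" unfolding e_def by (rule Dconj[OF h d(1)])
    have "h \<otimes> (g \<otimes> d \<otimes> inv g) \<otimes> inv h = g \<otimes> (a \<otimes> e \<otimes> inv a) \<otimes> inv g"
      using g h Dc[OF d(1)] by (simp add: a_def e_def commutator_def word_simps)
    also have "a \<otimes> e \<otimes> inv a = e" using comm[OF a e] Dc[OF a] Dc[OF e] by (simp add: m_assoc)
    also have "g \<otimes> e \<otimes> inv g = (g \<otimes> d \<otimes> inv g) [^] c"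
      using d g Dc by (simp add: e_def conj_pow)
    finally show "g \<otimes> d \<otimes> inv g \<in> E h c" using Dconj[OF g d(1)] unfolding E_def by simp
  qed
  have ED: "E h c \<subseteq> D" for h c unfolding E_def by blast
  \<comment> \<open>The elements of exponent \<open>p\<close> are those with \<open>d = d\<^sup>p\<^sup>+\<^sup>1\<close>.\<close>
  have E1: "E \<one> (Suc p) = {d \<in> D. d [^] p = \<one>}" unfolding E_def using Dc by (intro Collect_cong) auto
  then have "E \<one> (Suc p) = D" using minD[OF EN[OF one_closed] ED _ x(2)] x by blast
  then have exp: "d [^] p = \<one>" if "d \<in> D" for d using that E1 by blast
  have q_part: "h [^] (p - 1) \<in> C" if q: "prime q" and h: "h \<in> p_elements G q (carrier G)" for q h
  proof -
    have hc: "h \<in> carrier G" using h unfolding p_elements_def by blast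
    have "h [^] (p - 1) \<otimes> d \<otimes> inv (h [^] (p - 1)) = d" if d: "d \<in> D" for d
    proof (cases "q = p")
      case False
      have "d \<in> p_elements G p (derived G (carrier G))"
        unfolding p_elements_def using d exp[OF d] D_def by (auto intro: exI[of _ 1])
      then have "commutator G (h [^] (p - 1)) d \<in> scalar_residual G"
        using scalar_residualI[OF scalar_defectsI[OF p(1) q _ h]] False by blast
      then have "commutator G (h [^] (p - 1)) d = \<one>" using triv by simp
      then show ?thesis
        using hc Dc[OF d] commutator_mult_eq[of "h [^] (p - 1)" d] by simp
    next
      case True
      obtain k where k: "h [^] (p ^ k) = \<one>" using h True unfolding p_elements_def by blast
      have "[card D = card {d \<in> D. h \<otimes> d \<otimes> inv h = d}] (mod p)"
      proof (rule cyclic_p_group_fixed_points[OF p(1) hc k finD, where a = "\<lambda>g d. g \<otimes> d \<otimes> inv g"])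
        show "h \<otimes> d \<otimes> inv h \<in> D" if "d \<in> D" for d using Dconj[OF hc that] .
        show "\<one> \<otimes> d \<otimes> inv \<one> = d" if "d \<in> D" for d using Dc[OF that] by simp
        show "g \<otimes> h \<otimes> d \<otimes> inv (g \<otimes> h) = g \<otimes> (h \<otimes> d \<otimes> inv h) \<otimes> inv g"
          if "g \<in> carrier G" "h \<in> carrier G" "d \<in> D" for g h d
          using that Dc by (simp add: word_simps)
      qed
      moreover have E1: "{d \<in> D. h \<otimes> d \<otimes> inv h = d} = E h 1"
        unfolding E_def by (rule Collect_cong) (use Dc nat_pow_eone in auto)
      ultimately have "p dvd card (E h 1)" using p(2) by (metis cong_dvd_iff)
      then have "card (E h 1) \<noteq> 1" using p(1) by auto
      moreover have "\<one> \<in> E h 1" by (rule subgroup.one_closed[OF normal_imp_subgroup[OF EN[OF hc]]])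
      moreover from \<open>card (E h 1) \<noteq> 1\<close> have "E h 1 \<noteq> {\<one>}" by auto
      ultimately obtain y where "y \<in> E h 1" "y \<noteq> \<one>" by blast
      then have "E h 1 = D" using minD[OF EN[OF hc] ED] by blast
      then have "h \<otimes> d \<otimes> inv h = d" if "d \<in> D" for d using that E1 by blast
      then have "h \<in> C" using hc C_iff by blast
      then have "h [^] (p - 1) \<in> C" by (rule pow_mem[OF C])
      then show ?thesis using d C_iff by blast
    qed
    then show ?thesis using hc C_iff nat_pow_closed by blast
  qed
  have pow_C: "h [^] (p - 1) \<in> C" if h: "h \<in> carrier G" for h
  proof (rule mem_if_prime_power_parts_mem[OF fin C])
    show "h [^] (p - 1) \<in> carrier G" using h by simp
    fix q a m assume q: "prime q" and m: "order G = q ^ a * m"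
    have "(h [^] m) [^] (q ^ a) = \<one>"
      using h m pow_order_eq_1[OF h] by (simp add: nat_pow_pow mult.commute)
    then have "h [^] m \<in> p_elements G q (carrier G)" using h unfolding p_elements_def by auto
    then have "(h [^] m) [^] (p - 1) \<in> C" by (rule q_part[OF q])
    then show "(h [^] (p - 1)) [^] m \<in> C" using h by (simp add: nat_pow_pow mult.commute)
  qed
  have scalar: "\<exists>c::nat. \<forall>d\<in>D. h \<otimes> d \<otimes> inv h = d [^] c" if h: "h \<in> carrier G" for h
  proof -
    define \<sigma> where "\<sigma> d = h \<otimes> d \<otimes> inv h" for d
    have "\<sigma> \<in> hom V V"
      unfolding hom_def
    proof (intro CollectI conjI ballI Pi_I)
      show "\<sigma> a \<in> carrier V" if "a \<in> carrier V" for a using that Dconj[OF h] Vs by (simp add: \<sigma>_def)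
      show "\<sigma> (a \<otimes>\<^bsub>V\<^esub> b) = \<sigma> a \<otimes>\<^bsub>V\<^esub> \<sigma> b" if "a \<in> carrier V" "b \<in> carrier V" for a b
        using that h Dc Vs by (simp add: \<sigma>_def word_simps)
    qed
    moreover have iter: "(\<sigma> ^^ n) d = h [^] n \<otimes> d \<otimes> inv (h [^] n)" if "d \<in> D" for d n
    proof (induction n)
      case 0
      show ?case using Dc[OF that] by simp
    next
      case (Suc n)
      then show ?case using conj_pow_Suc[OF h Dc[OF that], of n] by (simp add: \<sigma>_def)
    qed
    moreover have "(\<sigma> ^^ (p - 1)) d = d" if "d \<in> carrier V" for d
      using iter[of d "p - 1"] pow_C[OF h] that Vs C_iff by simp
    moreover have "d [^]\<^bsub>V\<^esub> p = \<one>\<^bsub>V\<^esub>" if "d \<in> carrier V" for d using exp that Vs Vpow by simp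
    moreover have "x \<in> carrier V" "x \<noteq> \<one>\<^bsub>V\<^esub>" using x Vs by simp_all
    ultimately obtain w c where "w \<in> carrier V" "w \<noteq> \<one>\<^bsub>V\<^esub>" "\<sigma> w = w [^]\<^bsub>V\<^esub> (c::nat)"
      using V.exists_eigenvector[OF p(1)] by metis
    then have "w \<in> E h c" "w \<noteq> \<one>" using Vs Vpow unfolding E_def \<sigma>_def by simp_all
    then have "E h c = D" using minD[OF EN[OF h] ED] by blast
    then show ?thesis unfolding E_def by blast
  qed
  define W where "W = generate G {x}"
  have xc: "{x} \<subseteq> carrier G" using Dc[OF x(1)] by simp
  have W: "subgroup W G" unfolding W_def by (rule generate_is_subgroup[OF xc])
  have WD: "W \<subseteq> D" unfolding W_def by (rule generate_subgroup_incl[OF _ D]) (use x in simp)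
  have xW: "x \<in> W" unfolding W_def by (rule generate.incl) simp
  have "W \<lhd> G"
  proof (rule normal_invI[OF W])
    fix g a assume g: "g \<in> carrier G" and a: "a \<in> W"
    obtain c :: nat where c: "\<forall>d\<in>D. g \<otimes> d \<otimes> inv g = d [^] c" using scalar[OF g] by blast
    have "g \<otimes> a \<otimes> inv g = a [^] c" using c a WD by blast
    then show "g \<otimes> a \<otimes> inv g \<in> W" using pow_mem[OF W a] by simp
  qed
  then have "W = D" using minD[OF _ WD xW x(2)] by blast
  then have "card D = ord x" using generate_pow_card[of x] xc by (simp add: W_def)
  moreover have "ord x = p"
  proof -
    have "ord x dvd p" using x(3) xc pow_eq_id by simp
    moreover have "ord x \<noteq> 1" using x(2) xc ord_eq_1 by simp
    ultimately show ?thesis using p(1) prime_nat_iff by blast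
  qed
  ultimately show ?thesis using p(1) by (simp add: D_def)
qed

text \<open>If \<open>H\<close> contains \<open>G'\<close>, it is normal. Otherwise \<open>H \<inter> G'\<close> is normal, because its normalizer
  contains \<open>H\<close> and, by nilpotency of \<open>G'\<close>, elements outside \<open>H\<close>. In the quotient by \<open>H \<inter> G'\<close> the
  subgroup \<open>H\<close> complements \<open>G'\<close>, which is therefore minimal normal.\<close>
lemma maximal_subgroup_prime_index:
  assumes triv: "scalar_residual G = {\<one>}" and H: "maximal_subgroup H G"
  obtains p where "prime p" "order G = p * card H"
proof (cases "derived G (carrier G) \<subseteq> H")
  case True
  have HG: "subgroup H G" using H unfolding maximal_subgroup_def by blast
  have "H \<lhd> G"
  proof (rule normal_invI[OF HG])
    fix g h assume g: "g \<in> carrier G" and h: "h \<in> H"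
    have hc: "h \<in> carrier G" using subgroup.mem_carrier[OF HG h] .
    have "commutator G g h \<in> H" using commutator_in_derived[OF g hc] True by blast
    then show "g \<otimes> h \<otimes> inv g \<in> H"
      using subgroup.m_closed[OF HG _ h] commutator_mult_eq[OF g hc] by simp
  qed
  then show thesis using normal_maximal_prime_index[OF fin H] that by blast
next
  case False
  define D where "D = derived G (carrier G)"
  define H0 where "H0 = H \<inter> D"
  have HG: "subgroup H G" and Hmax: "\<And>K. \<lbrakk>subgroup K G; H \<subseteq> K\<rbrakk> \<Longrightarrow> K = H \<or> K = carrier G"
    using H unfolding maximal_subgroup_def by blast+
  have Hc: "h \<in> H \<Longrightarrow> h \<in> carrier G" for h using subgroup.mem_carrier[OF HG] .
  have DN: "D \<lhd> G" unfolding D_def by (rule derived_self_is_normal)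
  have D: "subgroup D G" by (rule normal_imp_subgroup[OF DN])
  have Dc: "d \<in> D \<Longrightarrow> d \<in> carrier G" for d using subgroup.mem_carrier[OF D] .
  have H0: "subgroup H0 G" unfolding H0_def by (rule subgroups_Inter_pair[OF HG D])
  have finH0: "finite H0" using fin subgroup.subset[OF H0] finite_subset by blast
  have H0D: "H0 \<subset> D" using False unfolding H0_def D_def by blast
  define N where "N = {g \<in> carrier G. \<forall>k\<in>H0. g \<otimes> k \<otimes> inv g \<in> H0}"
  have N: "subgroup N G" unfolding N_def by (rule subgroup_normalizer[OF finH0 H0])
  have HN: "H \<subseteq> N"
    using Hc subgroup_conj_mem[OF HG] normal_invE(2)[OF DN] unfolding N_def H0_def by blast
  obtain x where x: "x \<in> D" "x \<notin> H0" "\<And>h. h \<in> H0 \<Longrightarrow> x \<otimes> h \<otimes> inv x \<in> H0"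
    using nilpotent_in_normalizer_grows[OF nil[folded D_def] H0 H0D] by metis
  have "x \<in> N" "x \<notin> H" using x Dc unfolding N_def H0_def by blast+
  then have "N = carrier G" using Hmax[OF N HN] by blast
  then have H0N: "H0 \<lhd> G" using normal_invI[OF H0] unfolding N_def by blast
  interpret H0: normal H0 G by (rule H0N)
  interpret Q: nilpotent_derived "G Mod H0" by (rule nilpotent_derived_Mod[OF H0N])
  interpret \<pi>: group_hom G "G Mod H0" "\<lambda>x. H0 #> x" by (rule H0.mod_hom)
  have ker: "H0 #> a = \<one>\<^bsub>G Mod H0\<^esub> \<longleftrightarrow> a \<in> H0" if "a \<in> carrier G" for a
    using H0.in_mod_eq_one_iff[OF that] .
  have D': "derived (G Mod H0) (carrier (G Mod H0)) = (\<lambda>x. H0 #> x) ` D"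
    unfolding D_def by (rule H0.derived_Mod)
  have "prime (card ((\<lambda>x. H0 #> x) ` D))"
    unfolding D'[symmetric]
  proof (rule Q.minimal_derived_prime_order)
    show "scalar_residual (G Mod H0) = {\<one>\<^bsub>G Mod H0\<^esub>}"
      using H0.scalar_residual_Mod_trivial_iff[OF fin] triv H0.one_closed by simp
    show "derived (G Mod H0) (carrier (G Mod H0)) \<noteq> {\<one>\<^bsub>G Mod H0\<^esub>}"
      unfolding D' using x(1,2) ker[OF Dc[OF x(1)]] by blast
    fix Y assume Y: "Y \<lhd> G Mod H0" and YD: "Y \<subseteq> derived (G Mod H0) (carrier (G Mod H0))"
    have YS: "subgroup Y (G Mod H0)" by (rule normal_imp_subgroup[OF Y])
    define Y0 where "Y0 = {g \<in> carrier G. H0 #> g \<in> Y}"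
    have Y0D: "Y0 \<subseteq> D"
    proof
      fix y assume "y \<in> Y0"
      then have y: "y \<in> carrier G" "H0 #> y \<in> (\<lambda>x. H0 #> x) ` D" using YD unfolding Y0_def D' by blast+
      then obtain d where d: "d \<in> D" "H0 #> y = H0 #> d" by blast
      then have "y \<in> H0 #> d" using rcos_self[OF y(1) H0] by simp
      then obtain k where "k \<in> H0" "y = k \<otimes> d" unfolding r_coset_def by blast
      then show "y \<in> D" using H0D d(1) subgroup.m_closed[OF D] by blast
    qed
    have Y0N: "Y0 \<lhd> G"
      using H0.factgroup_subgroup_union_normal[OF Y] H0.factgroup_subgroup_union_char[OF YS] by (simp only: Y0_def)
    have YY0: "Y = (\<lambda>x. H0 #> x) ` Y0"
      using subgroup.subset[OF YS] unfolding Y0_def carrier_FactGroup by blast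
    show "Y = {\<one>\<^bsub>G Mod H0\<^esub>} \<or> Y = derived (G Mod H0) (carrier (G Mod H0))"
    proof (cases "Y0 \<subseteq> H")
      case True
      then have "Y0 \<subseteq> H0" using Y0D unfolding H0_def by blast
      then have "Y \<subseteq> {\<one>\<^bsub>G Mod H0\<^esub>}" unfolding YY0 using ker H0.mem_carrier by blast
      then show ?thesis using subgroup.one_closed[OF YS] by blast
    next
      case False
      define S where "S = Y0 <#> H"
      have S: "subgroup S G" unfolding S_def by (rule mult_norm_subgroup[OF Y0N HG])
      have SG: "S = carrier G"
        using set_mult_contains[OF normal_imp_subgroup[OF Y0N] HG] Hmax[OF S] False unfolding S_def by blast
      have "D \<subseteq> Y0"
      proof
        fix d assume d: "d \<in> D"
        then have "d \<in> Y0 <#> H" using SG Dc unfolding S_def by blast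
        then obtain y h where yh: "y \<in> Y0" "h \<in> H" "d = y \<otimes> h" unfolding set_mult_def by blast
        have "h = inv y \<otimes> d" using yh Y0D Dc Hc by (metis inv_mult_cancel(1) subsetD)
        then have "h \<in> D" using yh(1) Y0D d subgroup.m_closed[OF D subgroup.m_inv_closed[OF D]] by blast
        then have "h \<in> H0" using yh(2) unfolding H0_def by blast
        then have "h \<in> Y0" using ker[of h] Hc[OF yh(2)] subgroup.one_closed[OF YS] unfolding Y0_def by simp
        then show "d \<in> Y0" using yh(1,3) subgroup.m_closed[OF normal_imp_subgroup[OF Y0N]] by simp
      qed
      then have "Y0 = D" using Y0D by blast
      then show ?thesis using YY0 D' by simp
    qed
  qed
  then obtain p where p: "prime p" "card ((\<lambda>x. H0 #> x) ` D) = p" by blast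
  have "card D = p * card H0"
  proof -
    interpret DG: group "G\<lparr>carrier := D\<rparr>" by (rule subgroup_imp_group[OF D])
    have "card (rcosets\<^bsub>G\<lparr>carrier := D\<rparr>\<^esub> H0) * card H0 = order (G\<lparr>carrier := D\<rparr>)"
      by (rule DG.lagrange[OF subgroup_incl[OF H0 D]]) (use H0D in blast)
    moreover have "rcosets\<^bsub>G\<lparr>carrier := D\<rparr>\<^esub> H0 = (\<lambda>x. H0 #> x) ` D" unfolding RCOSETS_def by auto
    ultimately show ?thesis using p(2) by (simp add: order_def)
  qed
  moreover have "D <#> H = carrier G"
  proof -
    have S: "subgroup (D <#> H) G" by (rule mult_norm_subgroup[OF DN HG])
    show ?thesis using set_mult_contains[OF D HG] Hmax[OF S] False unfolding D_def by blast
  qed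
  then have "card (carrier G) * card H0 = card D * card H"
    using card_normal_set_mult[OF fin DN HG] by (simp add: H0_def Int_commute)
  moreover have "card H0 > 0" using H0.finite_imp_card_positive[OF fin] .
  ultimately have "order G = p * card H" by (simp add: order_def)
  then show thesis using that p(1) by blast
qed

end

section \<open>The w-supersoluble residual\<close>

lemma (in group) P_subnormal_chain:
  assumes "P_subnormal H G"
  shows "\<exists>(n::nat) K. K 0 = H \<and> K n = carrier G \<and> (\<forall>i\<le>n. subgroup (K i) G) \<and>
    (\<forall>i\<in>{1..n}. K (i - 1) \<subseteq> K i \<and> prime (card (rcosets\<^bsub>G\<lparr>carrier := K i\<rparr>\<^esub> (K (i - 1)))))"
proof (cases "H = carrier G")
  case True
  then show ?thesis using assms unfolding P_subnormal_def by (intro exI[of _ 0] exI[of _ "\<lambda>_. H"]) simp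
next
  case False
  then show ?thesis using assms unfolding P_subnormal_def by blast
qed

lemma (in group) P_subnormal_extend:
  assumes M: "subgroup M G" and H: "P_subnormal H (G\<lparr>carrier := M\<rparr>)" and idx: "prime (card (rcosets M))"
  shows "P_subnormal H G"
proof -
  have HM: "subgroup H (G\<lparr>carrier := M\<rparr>)" using H unfolding P_subnormal_def by blast
  obtain n :: nat and K where K: "K 0 = H" "K n = M" "\<And>i. i \<le> n \<Longrightarrow> subgroup (K i) (G\<lparr>carrier := M\<rparr>)"
    "\<And>i. i \<in> {1..n} \<Longrightarrow> K (i - 1) \<subseteq> K i \<and> prime (card (rcosets\<^bsub>G\<lparr>carrier := K i\<rparr>\<^esub> (K (i - 1))))"
  proof -
    have "\<exists>(n::nat) K. K 0 = H \<and> K n = M \<and> (\<forall>i\<le>n. subgroup (K i) (G\<lparr>carrier := M\<rparr>)) \<and>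
      (\<forall>i\<in>{1..n}. K (i - 1) \<subseteq> K i \<and> prime (card (rcosets\<^bsub>G\<lparr>carrier := K i\<rparr>\<^esub> (K (i - 1)))))"
      using group.P_subnormal_chain[OF subgroup_imp_group[OF M] H] by simp
    then show thesis using that by blast
  qed
  define K' where "K' = K(Suc n := carrier G)"
  have "K' 0 = H" "K' (Suc n) = carrier G" using K(1) by (simp_all add: K'_def)
  moreover have "subgroup (K' i) G" if "i \<le> Suc n" for i
    using that incl_subgroup[OF M K(3)[of i]] subgroup_self by (cases "i = Suc n") (simp_all add: K'_def)
  moreover have "K' (i - 1) \<subseteq> K' i \<and> prime (card (rcosets\<^bsub>G\<lparr>carrier := K' i\<rparr>\<^esub> (K' (i - 1))))"
    if "i \<in> {1..Suc n}" for i
    using that K(2) K(4)[of i] idx subgroup.subset[OF M] by (cases "i = Suc n") (auto simp: K'_def)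
  ultimately show ?thesis
    unfolding P_subnormal_def using incl_subgroup[OF M HM] by blast
qed

context nilpotent_derived
begin

lemma scalar_residual_restrict_trivial:
  assumes "scalar_residual G = {\<one>}" "subgroup H G"
  shows "scalar_residual (G\<lparr>carrier := H\<rparr>) = {\<one>\<^bsub>G\<lparr>carrier := H\<rparr>\<^esub>}"
proof -
  interpret H: group "G\<lparr>carrier := H\<rparr>" by (rule subgroup_imp_group[OF assms(2)])
  have "\<one> \<in> scalar_residual (G\<lparr>carrier := H\<rparr>)"
    using subgroup.one_closed[OF normal_imp_subgroup[OF H.scalar_residual_normal]] by simp
  then show ?thesis using scalar_residual_subgroup[OF assms(2)] assms(1) by auto
qed

end

lemma (in group) maximal_subgroup_above:
  assumes fin: "finite (carrier G)" and H: "subgroup H G" "H \<noteq> carrier G"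
  obtains M where "maximal_subgroup M G" "H \<subseteq> M"
proof -
  define \<S> where "\<S> = {K. subgroup K G \<and> H \<subseteq> K \<and> K \<noteq> carrier G}"
  have "\<S> \<subseteq> Pow (carrier G)" using subgroup.subset unfolding \<S>_def by blast
  then have "finite \<S>" using fin by (simp add: finite_subset)
  moreover have "H \<in> \<S>" using H unfolding \<S>_def by simp
  ultimately obtain M where M: "M \<in> \<S>" "H \<subseteq> M" "\<And>K. \<lbrakk>K \<in> \<S>; M \<subseteq> K\<rbrakk> \<Longrightarrow> K = M"
    using finite_has_maximal2[of \<S> H] by metis
  have "maximal_subgroup M G"
    unfolding maximal_subgroup_def
  proof (intro conjI allI impI)
    show "subgroup M G" "M \<noteq> carrier G" using M(1) unfolding \<S>_def by blast+
    fix K assume K: "subgroup K G" "M \<subseteq> K"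
    show "K = M \<or> K = carrier G"
    proof (cases "K = carrier G")
      case False
      then have "K \<in> \<S>" using K M(2) unfolding \<S>_def by blast
      then show ?thesis using M(3) K(2) by blast
    qed simp
  qed
  then show thesis using that M(2) by blast
qed

lemma P_subnormal_if_scalar_residual_trivial:
  assumes "nilpotent_derived G" "scalar_residual G = {\<one>\<^bsub>G\<^esub>}" "subgroup H G"
  shows "P_subnormal H G"
  using assms
proof (induction "order G" arbitrary: G rule: less_induct)
  case less
  interpret nilpotent_derived G by (rule less.prems(1))
  show ?case
  proof (cases "H = carrier G")
    case True
    then show ?thesis using less.prems(3) unfolding P_subnormal_def by blast
  next
    case False
    obtain M where M: "maximal_subgroup M G" "H \<subseteq> M" using maximal_subgroup_above[OF fin less.prems(3) False] .
    have MG: "subgroup M G" using M(1) unfolding maximal_subgroup_def by blast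
    obtain p where p: "prime p" "order G = p * card M"
      using maximal_subgroup_prime_index[OF less.prems(2) M(1)] .
    have pos: "card M > 0" using subgroup.finite_imp_card_positive[OF MG fin] .
    have "P_subnormal H (G\<lparr>carrier := M\<rparr>)"
    proof (rule less.hyps)
      show "order (G\<lparr>carrier := M\<rparr>) < order G" using p pos prime_gt_1_nat[OF p(1)] by (simp add: order_def)
      show "nilpotent_derived (G\<lparr>carrier := M\<rparr>)" by (rule nilpotent_derived_restrict[OF MG])
      show "scalar_residual (G\<lparr>carrier := M\<rparr>) = {\<one>\<^bsub>G\<lparr>carrier := M\<rparr>\<^esub>}"
        by (rule scalar_residual_restrict_trivial[OF less.prems(2) MG])
      show "subgroup H (G\<lparr>carrier := M\<rparr>)" by (rule subgroup_incl[OF less.prems(3) MG M(2)])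
    qed
    moreover have "card (rcosets\<^bsub>G\<^esub> M) = p" using lagrange[OF MG] p(2) pos by simp
    ultimately show ?thesis using P_subnormal_extend[OF MG] p(1) by simp
  qed
qed

context nilpotent_derived
begin

text \<open>Along a chain from \<open>Q\<close> to \<open>G\<close> with prime indices, the intersections with the \<open>p\<close>-part of
  \<open>G'\<close> grow by a factor \<open>1\<close> or \<open>p\<close>, so \<open>x\<^sup>p\<^sup>-\<^sup>1\<close> acts trivially on the factors. A \<open>q\<close>-element acting
  trivially on the factors of a series of a \<open>p\<close>-group acts trivially.\<close>
lemma P_subnormal_imp_scalar:
  assumes p: "prime p" and q: "prime q" and pq: "p \<noteq> q"
    and Q: "P_subnormal Q G" "card Q = q ^ e" and x: "x \<in> Q"
    and t: "t \<in> p_elements G p (derived G (carrier G))"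
  shows "commutator G (x [^] (p - 1 :: nat)) t = \<one>"
proof -
  define D where "D = derived G (carrier G)"
  define T where "T = p_elements G p D"
  define y where "y = x [^] (p - 1)"
  have DN: "D \<lhd> G" unfolding D_def by (rule derived_self_is_normal)
  have T: "subgroup T G" unfolding T_def D_def by (rule subgroup_p_elements)
  have Tc: "t \<in> T \<Longrightarrow> t \<in> carrier G" for t using subgroup.mem_carrier[OF T] .
  have TD: "T \<subseteq> D" unfolding T_def p_elements_def by blast
  have Tn: "a \<otimes> t \<otimes> inv a \<in> T" if "a \<in> carrier G" "t \<in> T" for a t
    using conj_mem_p_elements[OF DN that(1)] that(2) unfolding T_def .
  have QG: "subgroup Q G" using Q(1) unfolding P_subnormal_def by blast
  have xc: "x \<in> carrier G" using subgroup.mem_carrier[OF QG x] .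
  have yc: "y \<in> carrier G" using xc by (simp add: y_def)
  have "x \<in> p_elements G q Q" using p_elements_of_card[OF fin QG Q(2)] x by simp
  then obtain j where "x [^] (q ^ j) = \<one>" unfolding p_elements_def by blast
  then have yq: "y [^] (q ^ j) = \<one>"
    using xc unfolding y_def by (metis mult.commute nat_pow_one nat_pow_pow)
  obtain n :: nat and K where K: "K 0 = Q" "K n = carrier G" "\<And>i. i \<le> n \<Longrightarrow> subgroup (K i) G"
    "\<And>i. i \<in> {1..n} \<Longrightarrow> K (i - 1) \<subseteq> K i \<and> prime (card (rcosets\<^bsub>G\<lparr>carrier := K i\<rparr>\<^esub> (K (i - 1))))"
    using P_subnormal_chain[OF Q(1)] by metis
  have xK: "x \<in> K i" if "i \<le> n" for i
    using that
  proof (induction i)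
    case 0
    show ?case using x K(1) by simp
  next
    case (Suc i)
    then show ?case using K(4)[of "Suc i"] by auto
  qed
  have "\<forall>t\<in>K i \<inter> T. commutator G y t = \<one>" if "i \<le> n" for i
    using that
  proof (induction i)
    case 0
    show ?case
    proof
      fix t assume t: "t \<in> K 0 \<inter> T"
      then have "t \<in> p_elements G q Q" using p_elements_of_card[OF fin QG Q(2)] K(1) by simp
      then obtain a where a: "t [^] (q ^ a) = \<one>" unfolding p_elements_def by blast
      obtain b where b: "t [^] (p ^ b) = \<one>" using t unfolding T_def p_elements_def by blast
      have "coprime p q" using primes_coprime[OF p q pq] .
      then have "coprime (q ^ a) (p ^ b)" by (simp add: coprime_commute)
      then have "t = \<one>" using pow_coprime_eq_one[OF Tc a b] t by blast
      then show "commutator G y t = \<one>" using commutator_one_iff[of y \<one>] yc by simp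
    qed
  next
    case (Suc i)
    define L where "L = K (Suc i)"
    define A where "A = K i \<inter> T"
    define B where "B = L \<inter> T"
    have IH: "commutator G y t = \<one>" if "t \<in> A" for t using Suc that unfolding A_def by simp
    have Ki: "subgroup (K i) G" using K(3)[of i] Suc.prems by simp
    have L: "subgroup L G" unfolding L_def using K(3)[of "Suc i"] Suc.prems by simp
    have KL: "K i \<subseteq> L" and pr: "prime (card (rcosets\<^bsub>G\<lparr>carrier := L\<rparr>\<^esub> (K i)))"
      unfolding L_def using K(4)[of "Suc i"] Suc.prems by simp_all
    have A: "subgroup A G" unfolding A_def by (rule subgroups_Inter_pair[OF Ki T])
    have B: "subgroup B G" unfolding B_def by (rule subgroups_Inter_pair[OF L T])
    have AB: "A \<subseteq> B" using KL unfolding A_def B_def by blast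
    have BT: "B \<subseteq> T" unfolding B_def by blast
    interpret L: group "G\<lparr>carrier := L\<rparr>" by (rule subgroup_imp_group[OF L])
    define r where "r = card (rcosets\<^bsub>G\<lparr>carrier := L\<rparr>\<^esub> (K i))"
    have cL: "r * card (K i) = card L"
      using L.lagrange[OF subgroup_incl[OF Ki L KL]] by (simp add: order_def r_def)
    have KiB: "K i \<inter> B = A" using KL unfolding A_def B_def by blast
    have BN: "B \<lhd> G\<lparr>carrier := L\<rparr>"
    proof (rule L.normal_invI)
      show "subgroup B (G\<lparr>carrier := L\<rparr>)" by (rule subgroup_incl[OF B L]) (simp add: B_def)
      show "a \<otimes>\<^bsub>G\<lparr>carrier := L\<rparr>\<^esub> b \<otimes>\<^bsub>G\<lparr>carrier := L\<rparr>\<^esub> inv\<^bsub>G\<lparr>carrier := L\<rparr>\<^esub> a \<in> B"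
        if ab: "a \<in> carrier (G\<lparr>carrier := L\<rparr>)" "b \<in> B" for a b
      proof -
        have "a \<in> L" "b \<in> L" "b \<in> T" using ab unfolding B_def by simp_all
        then show ?thesis
          using subgroup_conj_mem[OF L] Tn[OF subgroup.mem_carrier[OF L]] m_inv_consistent[OF L] unfolding B_def by simp
      qed
    qed
    \<comment> \<open>The subgroup \<open>B (K i)\<close> lies between \<open>K i\<close> and \<open>L\<close>, so \<open>\<bar>B : A\<bar>\<close> divides the prime \<open>\<bar>L : K i\<bar>\<close>.\<close>
    define S where "S = B <#> K i"
    have SL: "subgroup S (G\<lparr>carrier := L\<rparr>)"
      unfolding S_def using L.mult_norm_subgroup[OF BN subgroup_incl[OF Ki L KL]] by simp
    have S: "subgroup S G" by (rule incl_subgroup[OF L SL])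
    have "S \<subseteq> L" using subgroup.subset[OF SL] by simp
    have KiS: "K i \<subseteq> S" unfolding S_def by (rule set_mult_contains(2)[OF B Ki])
    have cS: "card S * card A = card B * card (K i)"
      using L.card_normal_set_mult[OF _ BN subgroup_incl[OF Ki L KL]] KiB finite_subset[OF subgroup.subset[OF L] fin]
      unfolding S_def by (simp add: Int_commute)
    have posK: "card (K i) > 0" using subgroup.finite_imp_card_positive[OF Ki fin] .
    have posA: "card A > 0" using subgroup.finite_imp_card_positive[OF A fin] .
    have finB: "finite B" using fin subgroup.subset[OF B] finite_subset by blast
    have finA: "finite A" using finB AB finite_subset by blast
    obtain m where m: "card S = card (K i) * m" using card_subgroup_dvd[OF fin Ki S KiS] by blast
    have "card S dvd card L" by (rule card_subgroup_dvd[OF fin S L \<open>S \<subseteq> L\<close>])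
    then have "m * card (K i) dvd r * card (K i)" using m cL by (simp add: mult.commute)
    then have "m dvd r" using posK by simp
    then have mr: "m = 1 \<or> m = r" using pr prime_nat_iff unfolding r_def by blast
    have cB: "card B = m * card A" using cS m posK by (simp add: mult.commute mult.left_commute)
    show ?case
      unfolding L_def[symmetric] B_def[symmetric]
    proof (cases "A = B")
      case True
      then show "\<forall>t\<in>B. commutator G y t = \<one>" using IH by blast
    next
      case False
      then have "A \<subset> B" using AB by blast
      then have "card A < card B" using finB psubset_card_mono by blast
      then have "m = r" using mr cB by auto
      obtain k where k: "card T = p ^ k" using card_p_elements[OF p] unfolding T_def D_def by blast
      have "m dvd p ^ k"
        using card_subgroup_dvd[OF fin B T BT] cB k by (metis dvd_mult_left)
      then have "m = p"
        using \<open>m = r\<close> pr p prime_dvd_power primes_dvd_imp_eq unfolding r_def by blast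
      then have cBp: "card B = p * card A" using cB by simp
      have AnB: "b \<otimes> a \<otimes> inv b \<in> A" if "b \<in> B" "a \<in> A" for a b
      proof -
        define N where "N = {g \<in> carrier G. \<forall>a\<in>A. g \<otimes> a \<otimes> inv g \<in> A} \<inter> B"
        have N: "subgroup N G"
          unfolding N_def by (rule subgroups_Inter_pair[OF subgroup_normalizer[OF finA A] B])
        have AN: "A \<subseteq> N"
          using AB subgroup_conj_mem[OF A] subgroup.mem_carrier[OF A] unfolding N_def by blast
        have "nilpotent_in G B"
          by (rule nilpotent_in_subset[OF nil B]) (use BT TD D_def in blast)
        then obtain b0 where b0: "b0 \<in> B" "b0 \<notin> A" "\<And>h. h \<in> A \<Longrightarrow> b0 \<otimes> h \<otimes> inv b0 \<in> A"
          using nilpotent_in_normalizer_grows[OF _ A \<open>A \<subset> B\<close>] by metis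
        then have "b0 \<in> N" using subgroup.mem_carrier[OF B] unfolding N_def by blast
        then have "A \<subset> N" using AN b0(2) by blast
        moreover have "finite N" using finB unfolding N_def by blast
        ultimately have lt: "card A < card N" using psubset_card_mono by blast
        obtain a where a: "card N = card A * a" using card_subgroup_dvd[OF fin A N AN] by blast
        have "card N dvd card B" by (rule card_subgroup_dvd[OF fin N B]) (simp add: N_def)
        then have "card A * a dvd card A * p" using a cBp by (simp add: mult.commute)
        then have "a dvd p" using posA by simp
        moreover have "a \<noteq> 1" using lt a by auto
        ultimately have "a = p" using p prime_nat_iff by blast
        then have "card N = card B" using a cBp by (simp add: mult.commute)
        then have "N = B" using card_subset_eq[OF finB, of N] unfolding N_def by blast
        then show ?thesis using that unfolding N_def by blast
      qed
      show "\<forall>t\<in>B. commutator G y t = \<one>"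
      proof
        fix t assume t: "t \<in> B"
        have tc: "t \<in> carrier G" using subgroup.mem_carrier[OF B t] .
        have xi: "x \<in> K i" "x \<in> L" using xK[of i] xK[of "Suc i"] Suc.prems unfolding L_def by simp_all
        have cA: "commutator G y t \<in> A"
          unfolding y_def
        proof (rule pow_pred_prime_centralizes_factor[OF fin p B A AB cBp AnB xc _ _ t])
          show "x \<otimes> b \<otimes> inv x \<in> B" if "b \<in> B" for b
            using that subgroup_conj_mem[OF L xi(2)] Tn[OF xc] unfolding B_def by blast
          show "x \<otimes> a \<otimes> inv x \<in> A" if "a \<in> A" for a
            using that subgroup_conj_mem[OF Ki xi(1)] Tn[OF xc] unfolding A_def by blast
        qed
        \<comment> \<open>As \<open>y\<close> commutes with \<open>c = [y, t]\<close>, one has \<open>[y\<^sup>n, t] = c\<^sup>n\<close>; so \<open>c\<close> is both a \<open>q\<close>- and a \<open>p\<close>-element.\<close>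
        define c where "c = commutator G y t"
        have cc: "c \<in> carrier G" unfolding c_def using yc tc by simp
        have "commutator G y c = \<one>" using IH cA unfolding c_def by blast
        then have "c \<otimes> y = y \<otimes> c" using commutator_one_iff[OF yc cc] by simp
        then have "commutator G (y [^] (q ^ j)) t = c [^] (q ^ j)"
          using commutator_pow_left[OF yc tc] unfolding c_def by simp
        moreover have "commutator G \<one> t = \<one>" using commutator_one_iff[of \<one> t] tc by simp
        ultimately have cq: "c [^] (q ^ j) = \<one>" using yq by simp
        have "c \<in> T" using cA AB BT unfolding c_def by blast
        then obtain b where b: "c [^] (p ^ b) = \<one>" unfolding T_def p_elements_def by blast
        have "coprime (q ^ j) (p ^ b)" using primes_coprime[OF p q pq] by (simp add: coprime_commute)
        then show "commutator G y t = \<one>" using pow_coprime_eq_one[OF cc cq b] unfolding c_def by blast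
      qed
    qed
  qed
  from this[of n] have "commutator G y t = \<one>" using K(2) t Tc unfolding T_def D_def by blast
  then show ?thesis by (simp add: y_def)
qed

text \<open>A \<open>q\<close>-element differs from an element of a Sylow \<open>q\<close>-subgroup by an element of \<open>G'\<close>, and
  \<open>p'_element_centralizes_factor\<close> reduces the claim to elements of Sylow subgroups.\<close>
lemma w_supersoluble_imp_scalar_residual_trivial:
  assumes w: "w_supersoluble G"
  shows "scalar_residual G = {\<one>}"
proof -
  have "scalar_defects G \<subseteq> {\<one>}"
  proof
    fix s assume "s \<in> scalar_defects G"
    then obtain p q x t where s: "s = commutator G (x [^] (p - 1 :: nat)) t" and p: "prime p" and q: "prime q"
      and pq: "p \<noteq> q" and x: "x \<in> p_elements G q (carrier G)" and t: "t \<in> p_elements G p (derived G (carrier G))"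
      unfolding scalar_defects_def by blast
    obtain m where "order G = q ^ multiplicity q (order G) * m" using multiplicity_dvd by blast
    then obtain Q where Q: "subgroup Q G" "card Q = q ^ multiplicity q (order G)"
      using sylow_thm[OF q is_group _ fin] by blast
    then have "sylow_subgroup Q G" using q unfolding sylow_subgroup_def by blast
    then have QP: "P_subnormal Q G" using w unfolding w_supersoluble_def by blast
    obtain c where c: "c \<in> Q" "inv c \<otimes> x \<in> derived G (carrier G)" using sylow_mult_derived[OF fin q Q x] .
    have cc: "c \<in> carrier G" using subgroup.mem_carrier[OF Q(1) c(1)] .
    have xc: "x \<in> carrier G" using x unfolding p_elements_def by blast
    have T: "subgroup (p_elements G p (derived G (carrier G))) G" by (rule subgroup_p_elements)
    have "commutator G (x [^] (p - 1)) t \<in> {\<one>}"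
    proof (rule p'_element_centralizes_factor[OF p triv_subgroup, of "c [^] (p - 1)"])
      show "{\<one>} \<subseteq> p_elements G p (derived G (carrier G))" using subgroup.one_closed[OF T] by simp
      show "a \<otimes> k \<otimes> inv a \<in> {\<one>}" if "a \<in> p_elements G p (derived G (carrier G))" "k \<in> {\<one>}" for a k
        using that subgroup.mem_carrier[OF T] by simp
      show "c [^] (p - 1) \<in> carrier G" using cc by simp
      show "commutator G (c [^] (p - 1)) a \<in> {\<one>}" if "a \<in> p_elements G p (derived G (carrier G))" for a
        using P_subnormal_imp_scalar[OF p q pq QP Q(2) c(1) that] by simp
      have "x [^] (p - 1) \<in> p_elements G q (carrier G)"
      proof -
        obtain j where "x [^] (q ^ j) = \<one>" using x unfolding p_elements_def by blast
        then have "(x [^] (p - 1)) [^] (q ^ j) = \<one>"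
          using xc by (metis mult.commute nat_pow_one nat_pow_pow)
        then show ?thesis using xc unfolding p_elements_def by auto
      qed
      then show "x [^] (p - 1) \<in> p'_elements G p (carrier G)"
        using p'_elements_if_p_elements[OF p q pq] by blast
      show "inv (c [^] (p - 1)) \<otimes> x [^] (p - 1) \<in> derived G (carrier G)"
        by (rule pow_mod_normal[OF derived_self_is_normal cc xc c(2)])
    qed (rule t)
    then show "s \<in> {\<one>}" using s by simp
  qed
  then have "scalar_residual G \<subseteq> {\<one>}"
    unfolding scalar_residual_def by (rule generate_subgroup_incl[OF _ triv_subgroup])
  then show ?thesis using subgroup.one_closed[OF normal_imp_subgroup[OF scalar_residual_normal]] by blast
qed

lemma w_supersoluble_iff: "w_supersoluble G \<longleftrightarrow> scalar_residual G = {\<one>}"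
proof
  assume triv: "scalar_residual G = {\<one>}"
  show "w_supersoluble G"
    unfolding w_supersoluble_def
  proof (intro conjI allI impI is_group fin)
    fix P assume "sylow_subgroup P G"
    then have "subgroup P G" unfolding sylow_subgroup_def by blast
    then show "P_subnormal P G"
      using P_subnormal_if_scalar_residual_trivial[OF nilpotent_derived_axioms triv] by blast
  qed
qed (rule w_supersoluble_imp_scalar_residual_trivial)

text \<open>A quotient by \<open>N\<close> is \<open>w\<close>-supersoluble if and only if \<open>N\<close> contains all defects of \<open>G\<close>; in
  particular a least such \<open>N\<close> exists.\<close>
theorem wU_residual_eq: "wU_residual G = scalar_residual G"
proof -
  have Mod: "w_supersoluble (G Mod N) \<longleftrightarrow> scalar_residual G \<subseteq> N" if "N \<lhd> G" for N
    using nilpotent_derived.w_supersoluble_iff[OF nilpotent_derived_Mod[OF that]]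
      normal.scalar_residual_Mod_trivial_iff[OF that fin] by simp
  show ?thesis
    unfolding wU_residual_def
  proof (rule Least_equality)
    show "scalar_residual G \<lhd> G \<and> w_supersoluble (G Mod scalar_residual G)"
      using Mod[OF scalar_residual_normal] scalar_residual_normal by simp
    show "scalar_residual G \<le> N" if "N \<lhd> G \<and> w_supersoluble (G Mod N)" for N
      using Mod that by blast
  qed
qed

end

section \<open>Normal products\<close>

context group
begin

lemma generate_conj_closed:
  assumes X: "X \<subseteq> carrier G" and g: "g \<in> carrier G"
    and conj: "\<And>x. x \<in> X \<Longrightarrow> g \<otimes> x \<otimes> inv g \<in> generate G X" and k: "k \<in> generate G X"
  shows "g \<otimes> k \<otimes> inv g \<in> generate G X"
proof -
  have S: "subgroup (generate G X) G" by (rule generate_is_subgroup[OF X])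
  show ?thesis
    using k
  proof (induction k rule: generate.induct)
    case one
    then show ?case using g subgroup.one_closed[OF S] by simp
  next
    case (incl h)
    then show ?case by (rule conj)
  next
    case (inv h)
    have "g \<otimes> inv h \<otimes> inv g = inv (g \<otimes> h \<otimes> inv g)" using g X inv by (auto simp: word_simps)
    then show ?case using subgroup.m_inv_closed[OF S conj[OF inv]] by simp
  next
    case (eng h k)
    have "h \<in> carrier G" "k \<in> carrier G" using eng subgroup.mem_carrier[OF S] by simp_all
    then have "g \<otimes> (h \<otimes> k) \<otimes> inv g = (g \<otimes> h \<otimes> inv g) \<otimes> (g \<otimes> k \<otimes> inv g)"
      using g by (simp add: word_simps)
    then show ?case using subgroup.m_closed[OF S eng(3,4)] by simp
  qed
qed

lemma pow_mult_mod_derived: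
  assumes "a \<in> carrier G" "b \<in> carrier G"
  shows "inv (a [^] (n::nat) \<otimes> b [^] n) \<otimes> (a \<otimes> b) [^] n \<in> derived G (carrier G)"
proof -
  define D where "D = derived G (carrier G)"
  interpret D: normal D G unfolding D_def by (rule derived_self_is_normal)
  interpret Q: comm_group "G Mod D" unfolding D_def by (rule derived_quot_is_comm_group)
  interpret \<pi>: group_hom G "G Mod D" "\<lambda>x. D #> x" by (rule D.mod_hom)
  have c: "D #> a \<in> carrier (G Mod D)" "D #> b \<in> carrier (G Mod D)" using assms \<pi>.hom_closed by (simp_all only:)
  have "D #> ((a \<otimes> b) [^] n) = ((D #> a) \<otimes>\<^bsub>G Mod D\<^esub> (D #> b)) [^]\<^bsub>G Mod D\<^esub> n"
    using assms by (simp only: \<pi>.hom_nat_pow \<pi>.hom_mult m_closed)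
  also have "\<dots> = (D #> a) [^]\<^bsub>G Mod D\<^esub> n \<otimes>\<^bsub>G Mod D\<^esub> (D #> b) [^]\<^bsub>G Mod D\<^esub> n"
    by (rule Q.nat_pow_distrib[OF c])
  also have "\<dots> = D #> (a [^] n \<otimes> b [^] n)"
    using assms by (simp only: \<pi>.hom_nat_pow \<pi>.hom_mult nat_pow_closed)
  finally have "D #> (inv (a [^] n \<otimes> b [^] n) \<otimes> (a \<otimes> b) [^] n) =
      inv\<^bsub>G Mod D\<^esub> (D #> (a [^] n \<otimes> b [^] n)) \<otimes>\<^bsub>G Mod D\<^esub> (D #> (a [^] n \<otimes> b [^] n))"
    using assms by (simp only: \<pi>.hom_inv \<pi>.hom_mult nat_pow_closed m_closed inv_closed)
  also have "\<dots> = \<one>\<^bsub>G Mod D\<^esub>"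
    using assms \<pi>.hom_closed[of "a [^] n \<otimes> b [^] n"] by (simp only: Q.l_inv nat_pow_closed m_closed)
  finally show ?thesis
    using D.in_mod_eq_one_iff[of "inv (a [^] n \<otimes> b [^] n) \<otimes> (a \<otimes> b) [^] n"] assms
    by (simp add: D_def)
qed

lemma pow_p_elements:
  assumes "x \<in> p_elements G q S" "subgroup S G"
  shows "x [^] (n::nat) \<in> p_elements G q S"
proof -
  obtain k where k: "x \<in> S" "x [^] (q ^ k) = \<one>" using assms(1) unfolding p_elements_def by blast
  have "(x [^] n) [^] (q ^ k) = (x [^] (q ^ k)) [^] n"
    using subgroup.mem_carrier[OF assms(2) k(1)] by (simp add: nat_pow_pow mult.commute)
  then show ?thesis using k pow_mem[OF assms(2) k(1)] unfolding p_elements_def by auto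
qed

end

context nilpotent_derived
begin

abbreviation "p_part p \<equiv> p_elements G p (derived G (carrier G))"

lemma p_part_normal: "p_part p \<lhd> G"
  using normal_invI[OF subgroup_p_elements conj_mem_p_elements[OF derived_self_is_normal]] .

text \<open>The subgroup \<open>[y, T]\<close> for the \<open>p\<close>-part \<open>T\<close> of \<open>G'\<close>.\<close>
abbreviation "comm_span p y \<equiv> generate G (commutator G y ` p_part p)"

lemma comm_span:
  assumes y: "y \<in> carrier G"
  shows "subgroup (comm_span p y) G" "comm_span p y \<subseteq> p_part p"
    and "t \<in> p_part p \<Longrightarrow> commutator G y t \<in> comm_span p y"
    and "\<lbrakk>t \<in> p_part p; k \<in> comm_span p y\<rbrakk> \<Longrightarrow> t \<otimes> k \<otimes> inv t \<in> comm_span p y"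
    and "k \<in> comm_span p y \<Longrightarrow> y \<otimes> k \<otimes> inv y \<in> comm_span p y"
proof -
  define T where "T = p_part p"
  have TN: "T \<lhd> G" unfolding T_def by (rule p_part_normal)
  have T: "subgroup T G" by (rule normal_imp_subgroup[OF TN])
  have Tc: "t \<in> T \<Longrightarrow> t \<in> carrier G" for t using subgroup.mem_carrier[OF T] .
  define X where "X = commutator G y ` T"
  have Xc: "X \<subseteq> carrier G" unfolding X_def using y Tc by auto
  have inc: "commutator G y t \<in> generate G X" if "t \<in> T" for t
    unfolding X_def using that by (intro generate.incl) simp
  have S: "subgroup (generate G X) G" by (rule generate_is_subgroup[OF Xc])
  have XT: "X \<subseteq> T"
  proof
    fix x assume "x \<in> X"
    then obtain t where t: "t \<in> T" "x = commutator G y t" unfolding X_def by blast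
    have "(y \<otimes> t \<otimes> inv y) \<otimes> inv t \<in> T"
      using subgroup.m_closed[OF T normal_invE(2)[OF TN y t(1)] subgroup.m_inv_closed[OF T t(1)]] .
    then show "x \<in> T" unfolding t(2) by (simp add: commutator_def)
  qed
  show "subgroup (comm_span p y) G" using S unfolding X_def T_def .
  show "comm_span p y \<subseteq> p_part p" using generate_subgroup_incl[OF XT T] unfolding X_def T_def .
  show "commutator G y t \<in> comm_span p y" if "t \<in> p_part p" using inc that unfolding X_def T_def .
  show "t \<otimes> k \<otimes> inv t \<in> comm_span p y" if t: "t \<in> p_part p" and k: "k \<in> comm_span p y"
    unfolding X_def[unfolded T_def, symmetric]
  proof (rule generate_conj_closed[OF Xc])
    have tT: "t \<in> T" using t by (simp add: T_def)
    show tc: "t \<in> carrier G" using Tc[OF tT] .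
    fix x assume "x \<in> X"
    then obtain s where s: "s \<in> T" "x = commutator G y s" unfolding X_def by blast
    have "t \<otimes> x \<otimes> inv t = inv (commutator G y t) \<otimes> commutator G y (t \<otimes> s)"
      unfolding s(2) using y tc Tc[OF s(1)] by (simp add: commutator_def word_simps)
    then show "t \<otimes> x \<otimes> inv t \<in> generate G X"
      using subgroup.m_closed[OF S subgroup.m_inv_closed[OF S inc[OF tT]] inc[OF subgroup.m_closed[OF T tT s(1)]]]
      by simp
  qed (use k in \<open>simp add: X_def T_def\<close>)
  show "y \<otimes> k \<otimes> inv y \<in> comm_span p y" if k: "k \<in> comm_span p y"
    unfolding X_def[unfolded T_def, symmetric]
  proof (rule generate_conj_closed[OF Xc y])
    fix x assume "x \<in> X"
    then obtain s where s: "s \<in> T" "x = commutator G y s" unfolding X_def by blast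
    have "y \<otimes> x \<otimes> inv y = commutator G y (y \<otimes> s \<otimes> inv y)"
      unfolding s(2) using y Tc[OF s(1)] by (simp add: commutator_def word_simps)
    then show "y \<otimes> x \<otimes> inv y \<in> generate G X"
      using inc[OF normal_invE(2)[OF TN y s(1)]] by simp
  qed (use k in \<open>simp add: X_def T_def\<close>)
qed

text \<open>Let \<open>\<alpha> = a\<^sup>p\<^sup>-\<^sup>1\<close>, let \<open>T\<close> be the \<open>p\<close>-part of \<open>G'\<close> and \<open>C\<close> the centralizer of \<open>\<alpha>\<close> in \<open>T\<close>. By
  coprime action \<open>T = [\<alpha>, T] C\<close>, so every commutator of \<open>\<alpha>\<close> with an element of \<open>T\<close> is conjugate to
  one with an element of \<open>[\<alpha>, T] \<subseteq> A\<close>. One round puts \<open>[\<alpha>, T]\<close> into \<open>A'\<close>, a second one into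
  the residual of \<open>A\<close>.\<close>
lemma normal_subgroup_contribution:
  assumes A: "A \<lhd> G" and p: "prime p" "prime q" "p \<noteq> q" and a: "a \<in> p_elements G q A" and t: "t \<in> p_part p"
  shows "commutator G (a [^] (p - 1 :: nat)) t \<in> scalar_residual (G\<lparr>carrier := A\<rparr>)"
proof -
  define T where "T = p_part p"
  define y where "y = a [^] (p - 1)"
  define K where "K = comm_span p y"
  have AG: "subgroup A G" by (rule normal_imp_subgroup[OF A])
  have Ac: "x \<in> A \<Longrightarrow> x \<in> carrier G" for x using subgroup.mem_carrier[OF AG] .
  have TN: "T \<lhd> G" unfolding T_def by (rule p_part_normal)
  have Tc: "t \<in> T \<Longrightarrow> t \<in> carrier G" for t using subgroup.mem_carrier[OF normal_imp_subgroup[OF TN]] .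
  have yA: "y \<in> p_elements G q A" unfolding y_def by (rule pow_p_elements[OF a AG])
  then obtain j where y: "y \<in> A" "y [^] (q ^ j) = \<one>" unfolding p_elements_def by blast
  note yc = Ac[OF y(1)]
  note K = comm_span[OF yc, where p = p, folded K_def]
  have Kc: "k \<in> K \<Longrightarrow> k \<in> carrier G" for k using subgroup.mem_carrier[OF K(1)] .
  have KA: "K \<subseteq> A"
    unfolding K_def
  proof (rule generate_subgroup_incl[OF _ AG])
    show "commutator G y ` p_part p \<subseteq> A"
    proof
      fix x assume "x \<in> commutator G y ` p_part p"
      then obtain s where s: "s \<in> T" "x = commutator G y s" unfolding T_def by blast
      have "y \<otimes> (s \<otimes> inv y \<otimes> inv s) \<in> A"
        using subgroup.m_closed[OF AG y(1) normal_invE(2)[OF A Tc[OF s(1)] subgroup.m_inv_closed[OF AG y(1)]]] .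
      then show "x \<in> A" unfolding s(2) using yc Tc[OF s(1)] by (simp add: commutator_def m_assoc)
    qed
  qed
  obtain e where e: "card K = p ^ e"
    using card_p_group[OF fin p(1) K(1)] K(2) unfolding p_elements_def by blast
  have qK: "\<not> q dvd card K"
    using e p prime_dvd_power primes_dvd_imp_eq by metis
  have reduce: "\<exists>w k. w \<in> carrier G \<and> k \<in> K \<and> commutator G y s = w \<otimes> commutator G y k \<otimes> inv w" if s: "s \<in> T" for s
  proof -
    have sc: "s \<in> carrier G" using Tc[OF s] .
    have "inv s \<in> p_part p" using subgroup.m_inv_closed[OF normal_imp_subgroup[OF TN] s] by (simp add: T_def)
    then have "inv s \<otimes> commutator G y s \<otimes> inv (inv s) \<in> K" using K(3)[of s] K(4) s by (simp add: T_def)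
    then have "inv s \<otimes> (y \<otimes> s \<otimes> inv y) \<in> K" using sc yc by (simp add: commutator_def word_simps)
    then obtain k where k: "k \<in> K" "commutator G y (s \<otimes> k) \<in> {\<one>}"
      using coprime_action_fixed_coset[OF fin p(2) yc y(2) one_is_normal K(1) _ _ qK K(5) sc]
        subgroup.one_closed[OF K(1)] by auto
    define w where "w = s \<otimes> k"
    have wc: "w \<in> carrier G" using sc Kc[OF k(1)] by (simp add: w_def)
    have yw: "y \<otimes> w = w \<otimes> y" using k(2) commutator_one_iff[OF yc wc] by (simp add: w_def)
    have "s = w \<otimes> inv k" using sc Kc[OF k(1)] by (simp add: w_def m_assoc)
    then have "commutator G y s = (y \<otimes> w) \<otimes> inv k \<otimes> inv y \<otimes> k \<otimes> inv w"
      using yc wc Kc[OF k(1)] by (simp add: commutator_def word_simps)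
    also have "\<dots> = w \<otimes> commutator G y (inv k) \<otimes> inv w"
      unfolding yw using yc wc Kc[OF k(1)] by (simp add: commutator_def word_simps)
    finally show ?thesis using wc subgroup.m_inv_closed[OF K(1) k(1)] by blast
  qed
  have dN: "derived G A \<lhd> G" by (rule derived_is_normal[OF A])
  have KdA: "K \<subseteq> derived G A"
    unfolding K_def
  proof (rule generate_subgroup_incl[OF _ normal_imp_subgroup[OF dN]])
    show "commutator G y ` p_part p \<subseteq> derived G A"
    proof
      fix x assume "x \<in> commutator G y ` p_part p"
      then obtain s where s: "s \<in> T" "x = commutator G y s" unfolding T_def by blast
      obtain w k where w: "w \<in> carrier G" "k \<in> K" "commutator G y s = w \<otimes> commutator G y k \<otimes> inv w"
        using reduce[OF s(1)] by blast
      have "commutator G y k \<in> derived G A" using commutator_in_derived y(1) w(2) KA by blast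
      then show "x \<in> derived G A" unfolding s(2) w(3) by (rule normal_invE(2)[OF dN w(1)])
    qed
  qed
  obtain w k where w: "w \<in> carrier G" "k \<in> K" "commutator G y t = w \<otimes> commutator G y k \<otimes> inv w"
    using reduce[of t] t unfolding T_def by blast
  have "k \<in> p_elements G p (derived G A)" using w(2) KdA K(2) unfolding p_elements_def by blast
  then have "commutator G y k \<in> scalar_residual (G\<lparr>carrier := A\<rparr>)"
    unfolding y_def by (rule scalar_residual_restrictI[OF AG p a])
  then have "commutator G y t \<in> scalar_residual (G\<lparr>carrier := A\<rparr>)"
    unfolding w(3) by (rule normal_invE(2)[OF scalar_residual_normal_subgroup[OF A] w(1)])
  then show ?thesis by (simp add: y_def)
qed

text \<open>Modulo \<open>A\<close> the commutators of \<open>A B\<close> are those of \<open>B\<close>, so \<open>t \<in> A d\<close> with \<open>d \<in> B'\<close>. The part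
  of \<open>d\<close> of order prime to \<open>p\<close> commutes with \<open>p\<close>-elements of \<open>G'\<close>, and dropping it only changes the
  factor in \<open>A\<close>.\<close>
lemma p_part_of_product:
  assumes A: "A \<lhd> G" and B: "subgroup B G" and AB: "carrier G = A <#> B" and p: "prime p" and t: "t \<in> p_part p"
  obtains u s where "u \<in> p_elements G p (derived G B)" "s \<in> p_part p \<inter> A" "t = u \<otimes> s"
proof -
  interpret A: normal A G by (rule A)
  interpret \<pi>: group_hom G "G Mod A" "\<lambda>x. A #> x" by (rule A.mod_hom)
  have Bc: "b \<in> B \<Longrightarrow> b \<in> carrier G" for b using subgroup.mem_carrier[OF B] .
  have dB: "subgroup (derived G B) G" by (rule derived_is_subgroup[OF subgroup.subset[OF B]])
  have dBc: "d \<in> derived G B \<Longrightarrow> d \<in> carrier G" for d using subgroup.mem_carrier[OF dB] .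
  have dBD: "derived G B \<subseteq> derived G (carrier G)" by (rule mono_derived[OF subgroup.subset[OF B]])
  define S where "S = A <#> derived G B"
  have S: "subgroup S G" unfolding S_def by (rule mult_norm_subgroup[OF A dB])
  have "derived G (carrier G) \<subseteq> S"
    unfolding derived_def
  proof (rule generate_subgroup_incl[OF _ S])
    show "derived_set G (carrier G) \<subseteq> S"
    proof
      fix z assume "z \<in> derived_set G (carrier G)"
      then obtain x y where xy: "x \<in> carrier G" "y \<in> carrier G" "z = commutator G x y"
        unfolding commutator_def by blast
      obtain a b where ab: "a \<in> A" "b \<in> B" "x = a \<otimes> b" using xy(1) AB unfolding set_mult_def by auto
      obtain a' b' where ab': "a' \<in> A" "b' \<in> B" "y = a' \<otimes> b'" using xy(2) AB unfolding set_mult_def by auto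
      have \<pi>A: "A #> c = \<one>\<^bsub>G Mod A\<^esub>" if "c \<in> A" for c
        using A.in_mod_eq_one_iff[OF A.mem_carrier[OF that]] that by simp
      have "A #> x = A #> b" "A #> y = A #> b'"
        using ab ab' \<pi>A[OF ab(1)] \<pi>A[OF ab'(1)] Bc A.mem_carrier \<pi>.hom_closed
        by (simp_all only: \<pi>.hom_mult \<pi>.H.l_one)
      then have "A #> z = A #> commutator G b b'"
        unfolding xy(3) using xy Bc ab(2) ab'(2) by (simp only: \<pi>.hom_commutator)
      moreover have "z \<in> A #> z" using rcos_self[OF _ A.subgroup_axioms] xy by simp
      ultimately obtain c where c: "c \<in> A" "z = c \<otimes> commutator G b b'" unfolding r_coset_def by blast
      then show "z \<in> S"
        using commutator_in_derived[OF ab(2) ab'(2)] unfolding S_def set_mult_def by blast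
    qed
  qed
  then have "t \<in> S" using t unfolding p_elements_def by blast
  then obtain a d where ad: "a \<in> A" "d \<in> derived G B" "t = a \<otimes> d" unfolding S_def set_mult_def by blast
  obtain u v where uv: "u \<in> p_elements G p (derived G B)" "v \<in> p'_elements G p (derived G B)" "d = u \<otimes> v"
    using p_elements_mult_p'_elements[OF fin p dB ad(2)] .
  have uT: "u \<in> p_part p" using uv(1) dBD unfolding p_elements_def by blast
  have vV: "v \<in> p'_elements G p (derived G (carrier G))" using uv(2) dBD unfolding p'_elements_def by blast
  have c: "u \<in> carrier G" "v \<in> carrier G" using uv(1,2) dBc unfolding p_elements_def p'_elements_def by blast+
  define s where "s = inv u \<otimes> t"
  have T: "subgroup (p_part p) G" by (rule subgroup_p_elements)
  have sT: "s \<in> p_part p" unfolding s_def by (rule subgroup.m_closed[OF T subgroup.m_inv_closed[OF T uT] t])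
  have sc: "s \<in> carrier G" using subgroup.mem_carrier[OF T sT] .
  have "s \<otimes> inv v = inv u \<otimes> a \<otimes> u"
    unfolding s_def ad(3) uv(3) using c A.mem_carrier[OF ad(1)] by (simp add: word_simps)
  then have svA: "s \<otimes> inv v \<in> A" using A.inv_op_closed1[OF c(1) ad(1)] by simp
  obtain n where n: "v [^] n = \<one>" "coprime n p" using uv(2) unfolding p'_elements_def by blast
  have "s \<otimes> inv v = inv v \<otimes> s"
  proof -
    have "inv v \<in> p'_elements G p (derived G (carrier G))"
      using subgroup.m_inv_closed[OF subgroup_p'_elements vV] .
    then show ?thesis by (rule p_p'_commute[OF sT])
  qed
  then have "(s \<otimes> inv v) [^] n = s [^] n \<otimes> inv v [^] n" using pow_mult_distrib sc c by simp
  also have "\<dots> = s [^] n" using n(1) sc c by (simp add: nat_pow_inv)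
  finally have "s [^] n \<in> A" using pow_mem[OF A.subgroup_axioms svA, of n] by simp
  moreover obtain k where "s [^] (p ^ k) = \<one>" using sT unfolding p_elements_def by blast
  then have "s [^] (p ^ k) \<in> A" using A.one_closed by simp
  moreover have "coprime n (p ^ k)" using n(2) by simp
  ultimately have "s \<in> A" by (rule pow_coprime_mem[OF A.subgroup_axioms sc])
  moreover have "t = u \<otimes> s" using c(1) subgroup.mem_carrier[OF T t] by (simp add: s_def)
  ultimately show thesis using that uv(1) sT by blast
qed

text \<open>Let \<open>P\<close> be a Sylow \<open>p\<close>-subgroup of \<open>A\<close>, let \<open>M\<close> be maximal in \<open>P\<close>, and let \<open>W\<close> be the part of
  \<open>G' \<inter> A\<close> of order prime to \<open>p\<close>. Then \<open>P W\<close> is normal in \<open>G\<close>, and as \<open>Q M\<close> is a subgroup, \<open>Q\<close>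
  normalizes \<open>M W\<close>. So \<open>y = c\<^sup>p\<^sup>-\<^sup>1\<close> acts trivially on the group \<open>P W / M W\<close> of order \<open>p\<close>. By coprime
  action the elements of \<open>P\<close> centralized by \<open>y\<close> modulo \<open>W\<close> cover \<open>P W / M W\<close>. They form a subgroup
  contained in no maximal subgroup \<open>M\<close>, hence they are all of \<open>P\<close>; and \<open>P\<close> contains the
  \<open>p\<close>-part of \<open>G' \<inter> A\<close>, which meets \<open>W\<close> trivially.\<close>
lemma permuting_sylow_centralizes:
  assumes A: "A \<lhd> G" and p: "prime p" "prime q" "p \<noteq> q"
    and Q: "subgroup Q G" "card Q = q ^ e" "c \<in> Q"
    and perm: "\<And>P M. \<lbrakk>sylow_subgroup P (G\<lparr>carrier := A\<rparr>); maximal_subgroup M (G\<lparr>carrier := P\<rparr>)\<rbrakk>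
      \<Longrightarrow> permutes_with G Q M"
    and t: "t \<in> p_part p" "t \<in> A"
  shows "commutator G (c [^] (p - 1 :: nat)) t = \<one>"
proof -
  define D where "D = derived G (carrier G)"
  define T where "T = p_part p"
  define y where "y = c [^] (p - 1)"
  have AG: "subgroup A G" by (rule normal_imp_subgroup[OF A])
  have DN: "D \<lhd> G" unfolding D_def by (rule derived_self_is_normal)
  have D: "subgroup D G" by (rule normal_imp_subgroup[OF DN])
  have TN: "T \<lhd> G" unfolding T_def by (rule p_part_normal)
  have T: "subgroup T G" by (rule normal_imp_subgroup[OF TN])
  have Qc: "x \<in> Q \<Longrightarrow> x \<in> carrier G" for x using subgroup.mem_carrier[OF Q(1)] .
  have cc: "c \<in> carrier G" by (rule Qc[OF Q(3)])
  have yc: "y \<in> carrier G" using cc by (simp add: y_def)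
  obtain j where yj: "y [^] (q ^ j) = \<one>"
    using pow_mem[OF Q(1,3), of "p - 1"] p_elements_of_card[OF fin Q(1,2)] unfolding y_def p_elements_def by blast
  have cpq: "coprime (q ^ a) (p ^ b)" for a b
    using primes_coprime[OF p] by (simp add: coprime_commute)
  define W where "W = p'_elements G p D \<inter> A"
  have WN: "W \<lhd> G"
  proof (rule normal_invI)
    show "subgroup W G" unfolding W_def D_def by (rule subgroups_Inter_pair[OF subgroup_p'_elements AG])
    show "g \<otimes> w \<otimes> inv g \<in> W" if "g \<in> carrier G" "w \<in> W" for g w
      using that conj_mem_p'_elements[OF DN that(1)] normal_invE(2)[OF A that(1)] unfolding W_def by blast
  qed
  interpret W: normal W G by (rule WN)
  obtain r where r: "order (G\<lparr>carrier := A\<rparr>) = p ^ multiplicity p (order (G\<lparr>carrier := A\<rparr>)) * r"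
    using multiplicity_dvd by blast
  have finA: "finite A" using fin subgroup.subset[OF AG] finite_subset by blast
  have oA: "order (G\<lparr>carrier := A\<rparr>) = card A" by (simp add: order_def)
  obtain P where P: "subgroup P (G\<lparr>carrier := A\<rparr>)" "card P = p ^ multiplicity p (order (G\<lparr>carrier := A\<rparr>))"
    using sylow_thm[OF p(1) subgroup_imp_group[OF AG] r] finA by auto
  have syl: "sylow_subgroup P (G\<lparr>carrier := A\<rparr>)" using P p(1) unfolding sylow_subgroup_def by blast
  have PG: "subgroup P G" by (rule incl_subgroup[OF AG P(1)])
  have PA: "P \<subseteq> A" using subgroup.subset[OF P(1)] by simp
  have Pc: "x \<in> P \<Longrightarrow> x \<in> carrier G" for x using subgroup.mem_carrier[OF PG] .
  have Ppel: "\<exists>k. x [^] (p ^ k) = \<one>" if "x \<in> P" for x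
    using that p_elements_of_card[OF fin PG P(2)] unfolding p_elements_def by blast
  have finP: "finite P" using finA PA finite_subset by blast
  have TAP: "T \<inter> A \<subseteq> P"
  proof -
    have TA: "subgroup (T \<inter> A) G" by (rule subgroups_Inter_pair[OF T AG])
    have TAN: "T \<inter> A \<lhd> G" by (rule normal_subgroup_intersect[OF TN A])
    define S where "S = (T \<inter> A) <#> P"
    have S: "subgroup S G" unfolding S_def by (rule mult_norm_subgroup[OF TAN PG])
    have SA: "S \<subseteq> A" using PA subgroup.m_closed[OF AG] unfolding S_def set_mult_def by blast
    have PS: "P \<subseteq> S" and TS: "T \<inter> A \<subseteq> S" unfolding S_def using set_mult_contains[OF TA PG] by simp_all
    obtain i where i: "card (T \<inter> A) = p ^ i"
      using card_p_group[OF fin p(1) TA] unfolding T_def p_elements_def by blast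
    have "card S * card ((T \<inter> A) \<inter> P) = p ^ (i + multiplicity p (order (G\<lparr>carrier := A\<rparr>)))"
      using card_normal_set_mult[OF fin TAN PG] i P(2) unfolding S_def by (simp add: power_add)
    then have "card S dvd p ^ (i + multiplicity p (order (G\<lparr>carrier := A\<rparr>)))" by (metis dvd_triv_left)
    then obtain l where l: "card S = p ^ l" using divides_primepow_nat[OF p(1)] by blast
    have "p ^ l dvd card A" using card_subgroup_dvd[OF fin S AG SA] l by simp
    moreover have "card A \<noteq> 0" using subgroup.finite_imp_card_positive[OF AG fin] by simp
    ultimately have "l \<le> multiplicity p (card A)" using not_prime_unit p(1) by (intro multiplicity_geI) auto
    then have "card S \<le> card P" using l P(2) oA prime_gt_0_nat[OF p(1)] by (simp add: power_increasing)
    moreover have "finite S" using finA SA finite_subset by blast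
    ultimately have "P = S" using PS card_seteq by blast
    then show ?thesis using TS by blast
  qed
  have WP: "W \<inter> P = {\<one>}"
  proof -
    have "x = \<one>" if x: "x \<in> W" "x \<in> P" for x
    proof -
      obtain m where m: "x [^] m = \<one>" "coprime m p" using x(1) unfolding W_def p'_elements_def by blast
      obtain k where "x [^] (p ^ k) = \<one>" using Ppel[OF x(2)] by blast
      then show ?thesis using pow_coprime_eq_one[OF Pc[OF x(2)] m(1)] m(2) by simp
    qed
    then show ?thesis using W.one_closed subgroup.one_closed[OF PG] by blast
  qed
  define N where "N = W <#> P"
  have N: "subgroup N G" unfolding N_def by (rule mult_norm_subgroup[OF WN PG])
  have PinN: "P \<subseteq> N" unfolding N_def by (rule set_mult_contains(2)[OF W.subgroup_axioms PG])
  have NN: "N \<lhd> G"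
  proof (rule normal_invI[OF N])
    fix g x assume g: "g \<in> carrier G" and "x \<in> N"
    then obtain w s where ws: "w \<in> W" "s \<in> P" "x = w \<otimes> s" unfolding N_def set_mult_def by blast
    have sc: "s \<in> carrier G" using Pc[OF ws(2)] .
    have DA: "subgroup (D \<inter> A) G" by (rule subgroups_Inter_pair[OF D AG])
    have "(g \<otimes> s \<otimes> inv g) \<otimes> inv s \<in> A"
      using subgroup.m_closed[OF AG normal_invE(2)[OF A g] subgroup.m_inv_closed[OF AG]] ws(2) PA by blast
    then have "commutator G g s \<in> D \<inter> A"
      using commutator_in_derived[OF g sc] by (simp add: D_def commutator_def)
    then obtain u v where uv: "u \<in> p_elements G p (D \<inter> A)" "v \<in> p'_elements G p (D \<inter> A)" "commutator G g s = u \<otimes> v"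
      using p_elements_mult_p'_elements[OF fin p(1) DA] by blast
    have uP: "u \<in> P" using uv(1) TAP unfolding T_def D_def p_elements_def by blast
    have vW: "v \<in> W" using uv(2) unfolding W_def p'_elements_def by blast
    have "u \<otimes> v \<otimes> inv u \<in> W" using W.inv_op_closed2[OF Pc[OF uP] vW] .
    moreover have "g \<otimes> w \<otimes> inv g \<in> W" using W.inv_op_closed2[OF g ws(1)] .
    ultimately have 1: "(g \<otimes> w \<otimes> inv g) \<otimes> (u \<otimes> v \<otimes> inv u) \<in> W" by (rule W.m_closed[rotated])
    have 2: "u \<otimes> s \<in> P" by (rule subgroup.m_closed[OF PG uP ws(2)])
    have "g \<otimes> x \<otimes> inv g = (g \<otimes> w \<otimes> inv g) \<otimes> (g \<otimes> s \<otimes> inv g)"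
      unfolding ws(3) using g sc W.mem_carrier[OF ws(1)] by (simp add: word_simps)
    also have "g \<otimes> s \<otimes> inv g = u \<otimes> v \<otimes> s" using commutator_mult_eq[OF g sc] uv(3) by simp
    also have "(g \<otimes> w \<otimes> inv g) \<otimes> (u \<otimes> v \<otimes> s) = (g \<otimes> w \<otimes> inv g) \<otimes> (u \<otimes> v \<otimes> inv u) \<otimes> (u \<otimes> s)"
      using g sc W.mem_carrier[OF ws(1)] Pc[OF uP] W.mem_carrier[OF vW] by (simp add: word_simps)
    finally show "g \<otimes> x \<otimes> inv g \<in> N" using 1 2 unfolding N_def set_mult_def by blast
  qed
  define C where "C = {v \<in> P. commutator G y v \<in> W}"
  have CP: "C = P"
  proof (rule ccontr)
    assume ne: "C \<noteq> P"
    interpret PP: group "G\<lparr>carrier := P\<rparr>" by (rule subgroup_imp_group[OF PG])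
    have C: "subgroup C G"
    proof (rule subgroupI)
      show "C \<subseteq> carrier G" using Pc unfolding C_def by blast
      have "commutator G y \<one> = \<one>" using commutator_one_iff[OF yc one_closed] yc by simp
      then have "\<one> \<in> C" using subgroup.one_closed[OF PG] W.one_closed unfolding C_def by simp
      then show "C \<noteq> {}" by blast
      fix a assume "a \<in> C"
      then have a: "a \<in> P" "commutator G y a \<in> W" unfolding C_def by blast+
      have "commutator G y (inv a) = inv a \<otimes> inv (commutator G y a) \<otimes> inv (inv a)"
        using yc Pc[OF a(1)] by (simp add: commutator_def word_simps)
      also have "\<dots> \<in> W" using W.inv_op_closed2[of "inv a" "inv (commutator G y a)"] a Pc W.m_inv_closed by simp
      finally show "inv a \<in> C" using subgroup.m_inv_closed[OF PG a(1)] unfolding C_def by simp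
      fix b assume "b \<in> C"
      then have b: "b \<in> P" "commutator G y b \<in> W" unfolding C_def by blast+
      have "commutator G y (a \<otimes> b) = commutator G y a \<otimes> (a \<otimes> commutator G y b \<otimes> inv a)"
        using yc Pc[OF a(1)] Pc[OF b(1)] by (simp add: commutator_def word_simps)
      also have "\<dots> \<in> W" using W.m_closed[OF a(2) W.inv_op_closed2[OF Pc[OF a(1)] b(2)]] .
      finally show "a \<otimes> b \<in> C" using subgroup.m_closed[OF PG a(1) b(1)] unfolding C_def by simp
    qed
    have "subgroup C (G\<lparr>carrier := P\<rparr>)" by (rule subgroup_incl[OF C PG]) (simp add: C_def)
    then obtain M where M: "maximal_subgroup M (G\<lparr>carrier := P\<rparr>)" "C \<subseteq> M"
      using PP.maximal_subgroup_above[of C] ne finP by auto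
    have oP: "order (G\<lparr>carrier := P\<rparr>) = p ^ multiplicity p (order (G\<lparr>carrier := A\<rparr>))"
      using P(2) by (simp add: order_def)
    have MPN: "M \<lhd> G\<lparr>carrier := P\<rparr>" by (rule PP.p_group_maximal_subgroup(1)[OF p(1) oP M(1)])
    have cP: "card P = p * card M"
      using PP.p_group_maximal_subgroup(2)[OF p(1) oP M(1)] by (simp add: order_def)
    have MP: "subgroup M (G\<lparr>carrier := P\<rparr>)" "M \<noteq> P" using M(1) unfolding maximal_subgroup_def by auto
    have MG: "subgroup M G" by (rule incl_subgroup[OF PG MP(1)])
    have MsP: "M \<subseteq> P" using subgroup.subset[OF MP(1)] by simp
    have Mc: "x \<in> M \<Longrightarrow> x \<in> carrier G" for x using subgroup.mem_carrier[OF MG] .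
    have Mn: "s \<otimes> m \<otimes> inv s \<in> M" if "s \<in> P" "m \<in> M" for s m
      using PP.normal_invE(2)[OF MPN, of s m] that m_inv_consistent[OF PG] by simp
    have QM: "Q <#> M = M <#> Q" using perm[OF syl M(1)] unfolding permutes_with_def .
    define K where "K = W <#> M"
    have K: "subgroup K G" unfolding K_def by (rule mult_norm_subgroup[OF WN MG])
    have WK: "W \<subseteq> K" and MK: "M \<subseteq> K"
      unfolding K_def using set_mult_contains[OF W.subgroup_axioms MG] by simp_all
    have KN: "K \<subseteq> N" using MsP unfolding K_def N_def by (rule mono_set_mult[OF subset_refl])
    have Kc: "x \<in> K \<Longrightarrow> x \<in> carrier G" for x using subgroup.mem_carrier[OF K] .
    have conjK: "g \<otimes> k \<otimes> inv g \<in> K" if g: "g \<in> carrier G" "\<And>m. m \<in> M \<Longrightarrow> g \<otimes> m \<otimes> inv g \<in> K" and k: "k \<in> K" for g k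
    proof -
      obtain w m where wm: "w \<in> W" "m \<in> M" "k = w \<otimes> m" using k unfolding K_def set_mult_def by blast
      have "g \<otimes> k \<otimes> inv g = (g \<otimes> w \<otimes> inv g) \<otimes> (g \<otimes> m \<otimes> inv g)"
        unfolding wm(3) using g(1) W.mem_carrier[OF wm(1)] Mc[OF wm(2)] by (simp add: word_simps)
      moreover have "g \<otimes> w \<otimes> inv g \<in> K" using W.inv_op_closed2[OF g(1) wm(1)] WK by blast
      ultimately show ?thesis using subgroup.m_closed[OF K _ g(2)[OF wm(2)]] by simp
    qed
    have conjN: "g \<otimes> k \<otimes> inv g \<in> K" if g: "g \<in> N" and k: "k \<in> K" for g k
    proof -
      obtain w s where ws: "w \<in> W" "s \<in> P" "g = w \<otimes> s" using g unfolding N_def set_mult_def by blast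
      have "s \<otimes> k \<otimes> inv s \<in> K" using conjK[OF Pc[OF ws(2)] _ k] Mn[OF ws(2)] MK by blast
      then have "w \<otimes> (s \<otimes> k \<otimes> inv s) \<otimes> inv w \<in> K"
        using subgroup_conj_mem[OF K] ws(1) WK by blast
      then show ?thesis
        unfolding ws(3) using W.mem_carrier[OF ws(1)] Pc[OF ws(2)] Kc[OF k] by (simp add: word_simps)
    qed
    \<comment> \<open>Writing \<open>c m = m' d\<close> by permutability, the \<open>q\<close>-element \<open>d c\<^sup>-\<^sup>1\<close> lies in \<open>P W\<close>, hence in \<open>W\<close>.\<close>
    have cM: "c \<otimes> m \<otimes> inv c \<in> K" if m: "m \<in> M" for m
    proof -
      have "c \<otimes> m \<in> M <#> Q" using QM Q(3) m unfolding set_mult_def by blast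
      then obtain m' d where md: "m' \<in> M" "d \<in> Q" "c \<otimes> m = m' \<otimes> d" unfolding set_mult_def by blast
      define z where "z = d \<otimes> inv c"
      have zQ: "z \<in> Q" unfolding z_def by (rule subgroup.m_closed[OF Q(1) md(2) subgroup.m_inv_closed[OF Q(1,3)]])
      have zc: "z \<in> carrier G" by (rule Qc[OF zQ])
      have eq: "c \<otimes> m \<otimes> inv c = m' \<otimes> z"
        unfolding z_def md(3) using Mc[OF md(1)] Qc[OF md(2)] cc by (simp add: m_assoc)
      have "c \<otimes> m \<otimes> inv c \<in> N" using normal_invE(2)[OF NN cc] m MsP PinN by blast
      then have "inv m' \<otimes> (m' \<otimes> z) \<in> N"
        unfolding eq using subgroup.m_closed[OF N subgroup.m_inv_closed[OF N]] md(1) MsP PinN by blast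
      then have "z \<in> N" using Mc[OF md(1)] zc by simp
      then obtain w s where ws: "w \<in> W" "s \<in> P" "z = w \<otimes> s" unfolding N_def set_mult_def by blast
      have "inv s \<otimes> z \<in> W"
        using W.inv_op_closed1[OF Pc[OF ws(2)] ws(1)] W.mem_carrier[OF ws(1)] Pc[OF ws(2)] unfolding ws(3) by (simp add: m_assoc)
      then have pw: "inv (s [^] n) \<otimes> z [^] n \<in> W" for n :: nat
        by (rule pow_mod_normal[OF WN Pc[OF ws(2)] zc])
      obtain k where "s [^] (p ^ k) = \<one>" using Ppel[OF ws(2)] by blast
      then have "z [^] (p ^ k) \<in> W" using pw[of "p ^ k"] zc by simp
      moreover obtain i where "z [^] (q ^ i) = \<one>"
        using zQ p_elements_of_card[OF fin Q(1,2)] unfolding p_elements_def by blast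
      then have "z [^] (q ^ i) \<in> W" using W.one_closed by simp
      ultimately have "z \<in> W" using pow_coprime_mem[OF W.subgroup_axioms zc] cpq by blast
      then show ?thesis unfolding eq using subgroup.m_closed[OF K] md(1) MK WK by blast
    qed
    have cN: "card N = card W * card P"
      using card_normal_set_mult[OF fin WN PG] WP unfolding N_def by simp
    have WM: "W \<inter> M = {\<one>}" using WP MsP W.one_closed subgroup.one_closed[OF MG] by blast
    have cK: "card K = card W * card M"
      using card_normal_set_mult[OF fin WN MG] WM unfolding K_def by simp
    have idx: "card N = p * card K" using cN cK cP by simp
    have comK: "commutator G y n \<in> K" if "n \<in> N" for n
      unfolding y_def
    proof (rule pow_pred_prime_centralizes_factor[OF fin p(1) N K KN idx conjN cc _ _ that])
      show "c \<otimes> a \<otimes> inv c \<in> N" if "a \<in> N" for a using normal_invE(2)[OF NN cc that] .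
      show "c \<otimes> k \<otimes> inv c \<in> K" if "k \<in> K" for k using conjK[OF cc cM that] .
    qed
    have yK: "y \<otimes> k \<otimes> inv y \<in> K" if k: "k \<in> K" for k
      using subgroup.m_closed[OF K comK k] commutator_mult_eq[OF yc Kc[OF k]] k KN by auto
    have qM: "\<not> q dvd card M"
    proof -
      have "card M dvd p ^ multiplicity p (order (G\<lparr>carrier := A\<rparr>))" using cP P(2) by (metis dvd_triv_right)
      then obtain i where "card M = p ^ i" using divides_primepow_nat[OF p(1)] by blast
      then show ?thesis using p prime_dvd_power primes_dvd_imp_eq by metis
    qed
    have "P \<subseteq> M"
    proof
      fix s assume s: "s \<in> P"
      have sc: "s \<in> carrier G" by (rule Pc[OF s])
      have "inv s \<otimes> commutator G y s \<otimes> inv (inv s) \<in> K"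
        using conjN[OF _ comK] subgroup.m_inv_closed[OF N] s PinN by blast
      then have "inv s \<otimes> (y \<otimes> s \<otimes> inv y) \<in> K" using sc yc by (simp add: commutator_def word_simps)
      then obtain k where k: "k \<in> K" "commutator G y (s \<otimes> k) \<in> W"
        using coprime_action_fixed_coset[OF fin p(2) yc yj WN K WK cK qM yK sc] by blast
      obtain w m where wm: "w \<in> W" "m \<in> M" "k = w \<otimes> m" using k(1) unfolding K_def set_mult_def by blast
      define v where "v = s \<otimes> m"
      define w' where "w' = s \<otimes> w \<otimes> inv s"
      have w': "w' \<in> W" unfolding w'_def by (rule W.inv_op_closed2[OF sc wm(1)])
      have vP: "v \<in> P" unfolding v_def using subgroup.m_closed[OF PG s] wm(2) MsP by blast
      note c = W.mem_carrier[OF w'] Pc[OF vP]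
      have "s \<otimes> k = w' \<otimes> v"
        unfolding w'_def v_def wm(3) using sc W.mem_carrier[OF wm(1)] Mc[OF wm(2)] by (simp add: word_simps)
      then have in_W: "commutator G y (w' \<otimes> v) \<in> W" using k(2) by simp
      have "commutator G y v = inv (y \<otimes> w' \<otimes> inv y) \<otimes> commutator G y (w' \<otimes> v) \<otimes> w'"
        using yc c by (simp add: commutator_def word_simps)
      also have "\<dots> \<in> W"
        using W.m_closed[OF W.m_closed[OF W.m_inv_closed[OF W.inv_op_closed2[OF yc w']] in_W] w'] .
      finally have "v \<in> M" using vP M(2) unfolding C_def by blast
      then have "v \<otimes> inv m \<in> M" using subgroup.m_closed[OF MG _ subgroup.m_inv_closed[OF MG wm(2)]] by blast
      then show "s \<in> M" unfolding v_def using sc Mc[OF wm(2)] by (simp add: m_assoc)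
    qed
    then show False using MsP MP(2) by blast
  qed
  have "t \<in> C" using t TAP CP unfolding T_def by blast
  then have "commutator G y t \<in> W" unfolding C_def by blast
  moreover have "commutator G y t \<in> T"
    using subgroup.m_closed[OF T normal_invE(2)[OF TN yc] subgroup.m_inv_closed[OF T], of t t] t(1)
    unfolding T_def commutator_def by blast
  ultimately have "commutator G y t = \<one>"
    using p_p'_inter unfolding W_def T_def D_def by blast
  then show ?thesis by (simp add: y_def)
qed

text \<open>Write \<open>x = a b\<close> and raise to a power \<open>n\<close> that fixes \<open>x\<close> and sends all of \<open>G\<close> into
  \<open>q\<close>-elements; modulo \<open>G'\<close> this is \<open>a\<^sup>n b\<^sup>n\<close>, and \<open>b\<^sup>n\<close> can be moved into \<open>Q\<close> modulo \<open>B'\<close>.\<close>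
lemma product_q_element:
  assumes A: "A \<lhd> G" and B: "subgroup B G" and AB: "carrier G = A <#> B" and q: "prime q"
    and Q: "subgroup Q (G\<lparr>carrier := B\<rparr>)" "card Q = q ^ multiplicity q (order (G\<lparr>carrier := B\<rparr>))"
    and x: "x \<in> p_elements G q (carrier G)"
  obtains a c where "a \<in> p_elements G q A" "c \<in> Q" "inv (a \<otimes> c) \<otimes> x \<in> derived G (carrier G)"
proof -
  define D where "D = derived G (carrier G)"
  have D: "subgroup D G" unfolding D_def by (rule derived_is_subgroup[OF subset_refl])
  have AG: "subgroup A G" by (rule normal_imp_subgroup[OF A])
  interpret BB: group "G\<lparr>carrier := B\<rparr>" by (rule subgroup_imp_group[OF B])
  obtain j where j: "x \<in> carrier G" "x [^] (q ^ j) = \<one>" using x unfolding p_elements_def by blast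
  obtain a b where ab: "a \<in> A" "b \<in> B" "x = a \<otimes> b" using j(1) AB unfolding set_mult_def by auto
  have ac: "a \<in> carrier G" and bc: "b \<in> carrier G"
    using subgroup.mem_carrier[OF AG ab(1)] subgroup.mem_carrier[OF B ab(2)] by simp_all
  have pos: "order G > 0" using fin order_gt_0_iff_finite by blast
  obtain k m where km: "order G = q ^ k * m" "coprime m q" using nat_factor_coprime[OF pos q] .
  have "coprime (q ^ j) m" using km(2) by (simp add: coprime_commute)
  then obtain n where n: "[n = 1] (mod (q ^ j))" "[n = 0] (mod m)" using binary_chinese_remainder_nat by blast
  have "x [^] n = x"
  proof -
    have "ord x dvd q ^ j" using j pow_eq_id by blast
    then have "[n = 1] (mod ord x)" using n(1) cong_dvd_modulus_nat by blast
    then have "int (ord x) dvd int 1 - int n" by (metis cong_iff_dvd_diff cong_int_iff cong_sym)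
    then have "x [^] n = x [^] (1::nat)"
      using int_pow_eq[OF j(1), of "int n" "int 1"] by (simp only: int_pow_int)
    then show ?thesis using j(1) by simp
  qed
  obtain l where l: "n = m * l" using n(2) by (auto simp: cong_0_iff)
  have q_el: "(g [^] n) [^] (q ^ k) = \<one>" if "g \<in> carrier G" for g
  proof -
    have "(g [^] n) [^] (q ^ k) = (g [^] order G) [^] l"
      using that unfolding l km(1) by (simp add: nat_pow_pow mult_ac)
    then show ?thesis using pow_order_eq_1[OF that] by simp
  qed
  define a' where "a' = a [^] n"
  define b' where "b' = b [^] n"
  have a': "a' \<in> p_elements G q A" unfolding a'_def p_elements_def using q_el[OF ac] pow_mem[OF AG ab(1)] by blast
  have b': "b' \<in> p_elements G q B" unfolding b'_def p_elements_def using q_el[OF bc] pow_mem[OF B ab(2)] by blast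
  have c': "a' \<in> carrier G" "b' \<in> carrier G" using ac bc by (simp_all add: a'_def b'_def)
  have 1: "inv (a' \<otimes> b') \<otimes> x \<in> D"
    using pow_mult_mod_derived[OF ac bc, of n] \<open>x [^] n = x\<close> ab(3) unfolding a'_def b'_def D_def by simp
  have dB: "derived (G\<lparr>carrier := B\<rparr>) B = derived G B" by (rule derived_consistent[OF subset_refl B])
  have finB: "finite (carrier (G\<lparr>carrier := B\<rparr>))" using fin subgroup.subset[OF B] finite_subset by auto
  have b'': "b' \<in> p_elements (G\<lparr>carrier := B\<rparr>) q (carrier (G\<lparr>carrier := B\<rparr>))" using b' by simp
  obtain c where c: "c \<in> Q" "inv\<^bsub>G\<lparr>carrier := B\<rparr>\<^esub> c \<otimes>\<^bsub>G\<lparr>carrier := B\<rparr>\<^esub> b' \<in> derived (G\<lparr>carrier := B\<rparr>) (carrier (G\<lparr>carrier := B\<rparr>))"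
    using BB.sylow_mult_derived[OF finB q Q b''] .
  have cB: "c \<in> B" using c(1) subgroup.subset[OF Q(1)] by auto
  have cc: "c \<in> carrier G" by (rule subgroup.mem_carrier[OF B cB])
  have "inv c \<otimes> b' \<in> derived G B" using c(2) dB m_inv_consistent[OF B cB] by simp
  then have 2: "inv c \<otimes> b' \<in> D" unfolding D_def using mono_derived[OF subgroup.subset[OF B]] by blast
  have "inv (a' \<otimes> c) \<otimes> x = (inv c \<otimes> b') \<otimes> (inv (a' \<otimes> b') \<otimes> x)"
    using c' cc j(1) by (simp add: word_simps)
  then have "inv (a' \<otimes> c) \<otimes> x \<in> D" using subgroup.m_closed[OF D 2 1] by simp
  then show thesis using that a' c(1) unfolding D_def by blast
qed

text \<open>With \<open>\<alpha> = a\<^sup>p\<^sup>-\<^sup>1\<close> and \<open>\<beta> = c\<^sup>p\<^sup>-\<^sup>1\<close>, the group \<open>K\<close> generated by \<open>[\<beta>, T]\<close> and the intersection of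
  \<open>T\<close> with the residual of \<open>A\<close> lies in the right-hand side and is normalized by \<open>T\<close>. Both \<open>\<alpha>\<close>
  and \<open>\<beta>\<close> act trivially on \<open>T / K\<close>, hence so does \<open>x\<^sup>p\<^sup>-\<^sup>1\<close>, which agrees with \<open>\<alpha> \<beta>\<close> modulo
  \<open>G'\<close>.\<close>
theorem scalar_residual_product:
  assumes A: "A \<lhd> G" and B: "subgroup B G" and AB: "carrier G = A <#> B"
    and perm: "\<And>Q P M. \<lbrakk>sylow_subgroup Q (G\<lparr>carrier := B\<rparr>); sylow_subgroup P (G\<lparr>carrier := A\<rparr>);
      maximal_subgroup M (G\<lparr>carrier := P\<rparr>)\<rbrakk> \<Longrightarrow> permutes_with G Q M"
  shows "scalar_residual G = scalar_residual (G\<lparr>carrier := A\<rparr>) <#> scalar_residual (G\<lparr>carrier := B\<rparr>)"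
proof -
  define RA where "RA = scalar_residual (G\<lparr>carrier := A\<rparr>)"
  define RB where "RB = scalar_residual (G\<lparr>carrier := B\<rparr>)"
  have AG: "subgroup A G" by (rule normal_imp_subgroup[OF A])
  interpret BB: group "G\<lparr>carrier := B\<rparr>" by (rule subgroup_imp_group[OF B])
  have RAN: "RA \<lhd> G" unfolding RA_def by (rule scalar_residual_normal_subgroup[OF A])
  have RA: "subgroup RA G" by (rule normal_imp_subgroup[OF RAN])
  have RB: "subgroup RB G"
    unfolding RB_def by (rule incl_subgroup[OF B normal_imp_subgroup[OF BB.scalar_residual_normal]])
  have S: "subgroup (RA <#> RB) G" by (rule mult_norm_subgroup[OF RAN RB])
  have "scalar_defects G \<subseteq> RA <#> RB"
  proof
    fix z assume "z \<in> scalar_defects G"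
    then obtain p q x t where z: "z = commutator G (x [^] (p - 1 :: nat)) t" and p: "prime p" "prime q" "p \<noteq> q"
      and x: "x \<in> p_elements G q (carrier G)" and t: "t \<in> p_part p"
      unfolding scalar_defects_def by blast
    have finB: "finite (carrier (G\<lparr>carrier := B\<rparr>))" using fin subgroup.subset[OF B] finite_subset by auto
    obtain m where "order (G\<lparr>carrier := B\<rparr>) = q ^ multiplicity q (order (G\<lparr>carrier := B\<rparr>)) * m"
      using multiplicity_dvd by blast
    then obtain Q where Q: "subgroup Q (G\<lparr>carrier := B\<rparr>)" "card Q = q ^ multiplicity q (order (G\<lparr>carrier := B\<rparr>))"
      using sylow_thm[OF p(2) BB.is_group _ finB] by blast
    have Qsyl: "sylow_subgroup Q (G\<lparr>carrier := B\<rparr>)" using Q p(2) unfolding sylow_subgroup_def by blast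
    have QG: "subgroup Q G" by (rule incl_subgroup[OF B Q(1)])
    obtain a c where ac: "a \<in> p_elements G q A" "c \<in> Q" "inv (a \<otimes> c) \<otimes> x \<in> derived G (carrier G)"
      using product_q_element[OF A B AB p(2) Q x] .
    have aA: "a \<in> A" using ac(1) unfolding p_elements_def by blast
    have a_c: "a \<in> carrier G" using subgroup.mem_carrier[OF AG aA] .
    have c_c: "c \<in> carrier G" using subgroup.mem_carrier[OF QG ac(2)] .
    have x_c: "x \<in> carrier G" using x unfolding p_elements_def by blast
    have cQ: "c \<in> p_elements G q Q" using p_elements_of_card[OF fin QG Q(2)] ac(2) by simp
    then have cB: "c \<in> p_elements G q B" using subgroup.subset[OF Q(1)] unfolding p_elements_def by auto
    define \<alpha> where "\<alpha> = a [^] (p - 1)"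
    define \<beta> where "\<beta> = c [^] (p - 1)"
    define T where "T = p_part p"
    have \<alpha>c: "\<alpha> \<in> carrier G" and \<beta>c: "\<beta> \<in> carrier G" using a_c c_c by (simp_all add: \<alpha>_def \<beta>_def)
    have TN: "T \<lhd> G" unfolding T_def by (rule p_part_normal)
    have T: "subgroup T G" by (rule normal_imp_subgroup[OF TN])
    have Tc: "t \<in> T \<Longrightarrow> t \<in> carrier G" for t using subgroup.mem_carrier[OF T] .
    have comT: "commutator G g s \<in> T" if "g \<in> carrier G" "s \<in> T" for g s
      using subgroup.m_closed[OF T normal_invE(2)[OF TN that] subgroup.m_inv_closed[OF T that(2)]]
      by (simp add: commutator_def)
    have \<alpha>RA: "commutator G \<alpha> s \<in> RA" if "s \<in> T" for s
      using normal_subgroup_contribution[OF A p ac(1)] that unfolding RA_def \<alpha>_def T_def by blast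
    have \<beta>RB: "commutator G \<beta> s \<in> RB" if s: "s \<in> T" for s
    proof -
      obtain u r where ur: "u \<in> p_elements G p (derived G B)" "r \<in> p_part p \<inter> A" "s = u \<otimes> r"
        using p_part_of_product[OF A B AB p(1), of s] s unfolding T_def by blast
      have uc: "u \<in> carrier G"
        using ur(1) derived_in_carrier[OF subgroup.subset[OF B]] unfolding p_elements_def by blast
      have rc: "r \<in> carrier G" using ur(2) Tc unfolding T_def by blast
      have "commutator G \<beta> r = \<one>"
        unfolding \<beta>_def
      proof (rule permuting_sylow_centralizes[OF A p QG Q(2) ac(2)])
        show "permutes_with G Q M" if "sylow_subgroup P (G\<lparr>carrier := A\<rparr>)" "maximal_subgroup M (G\<lparr>carrier := P\<rparr>)"
          for P M using perm[OF Qsyl that] .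
      qed (use ur(2) in simp_all)
      then have "\<beta> \<otimes> r \<otimes> inv \<beta> = r" using commutator_mult_eq[OF \<beta>c rc] rc by simp
      have "commutator G \<beta> s = (\<beta> \<otimes> u \<otimes> inv \<beta>) \<otimes> (\<beta> \<otimes> r \<otimes> inv \<beta>) \<otimes> inv r \<otimes> inv u"
        unfolding ur(3) using \<beta>c uc rc by (simp add: commutator_def word_simps)
      also have "\<dots> = commutator G \<beta> u"
        unfolding \<open>\<beta> \<otimes> r \<otimes> inv \<beta> = r\<close> using \<beta>c uc rc by (simp add: commutator_def word_simps)
      also have "\<dots> \<in> RB" unfolding \<beta>_def RB_def by (rule scalar_residual_restrictI[OF B p cB ur(1)])
      finally show ?thesis .
    qed
    define K1 where "K1 = RA \<inter> T"
    define K2 where "K2 = comm_span p \<beta>"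
    define K where "K = K1 <#> K2"
    note K2 = comm_span[OF \<beta>c, where p = p, folded K2_def T_def]
    have K1N: "K1 \<lhd> G" unfolding K1_def by (rule normal_subgroup_intersect[OF RAN TN])
    have K1: "subgroup K1 G" by (rule normal_imp_subgroup[OF K1N])
    have K: "subgroup K G" unfolding K_def by (rule mult_norm_subgroup[OF K1N K2(1)])
    have KT: "K \<subseteq> T" using K2(2) subgroup.m_closed[OF T] unfolding K_def K1_def set_mult_def by blast
    have "K2 \<subseteq> RB"
      unfolding K2_def by (rule generate_subgroup_incl[OF _ RB]) (use \<beta>RB in \<open>auto simp: T_def\<close>)
    then have KS: "K \<subseteq> RA <#> RB" unfolding K_def K1_def by (intro mono_set_mult) auto
    have Kn: "s \<otimes> k \<otimes> inv s \<in> K" if s: "s \<in> T" and k: "k \<in> K" for s k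
    proof -
      obtain k1 k2 where kk: "k1 \<in> K1" "k2 \<in> K2" "k = k1 \<otimes> k2" using k unfolding K_def set_mult_def by blast
      have "s \<otimes> k \<otimes> inv s = (s \<otimes> k1 \<otimes> inv s) \<otimes> (s \<otimes> k2 \<otimes> inv s)"
        unfolding kk(3) using Tc[OF s] subgroup.mem_carrier[OF K1 kk(1)] subgroup.mem_carrier[OF K2(1) kk(2)]
        by (simp add: word_simps)
      then show ?thesis
        using normal_invE(2)[OF K1N Tc[OF s] kk(1)] K2(4)[OF s kk(2)] unfolding K_def set_mult_def by blast
    qed
    have \<alpha>\<beta>: "commutator G (\<alpha> \<otimes> \<beta>) s \<in> K" if s: "s \<in> T" for s
    proof -
      have s': "\<beta> \<otimes> s \<otimes> inv \<beta> \<in> T" by (rule normal_invE(2)[OF TN \<beta>c s])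
      have "commutator G (\<alpha> \<otimes> \<beta>) s = commutator G \<alpha> (\<beta> \<otimes> s \<otimes> inv \<beta>) \<otimes> commutator G \<beta> s"
        using \<alpha>c \<beta>c Tc[OF s] by (simp add: commutator_def word_simps)
      moreover have "commutator G \<alpha> (\<beta> \<otimes> s \<otimes> inv \<beta>) \<in> K1"
        using \<alpha>RA[OF s'] comT[OF \<alpha>c s'] unfolding K1_def by blast
      ultimately show ?thesis using K2(3)[OF s] unfolding K_def set_mult_def by blast
    qed
    have "commutator G (x [^] (p - 1)) t \<in> K"
    proof (rule p'_element_centralizes_factor[OF p(1) K, of "\<alpha> \<otimes> \<beta>"])
      show "x [^] (p - 1) \<in> p'_elements G p (carrier G)"
        using pow_p_elements[OF x subgroup_self] p'_elements_if_p_elements[OF p] by blast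
      have D: "subgroup (derived G (carrier G)) G" by (rule derived_is_subgroup[OF subset_refl])
      have 1: "inv ((a \<otimes> c) [^] (p - 1)) \<otimes> x [^] (p - 1) \<in> derived G (carrier G)"
        using pow_mod_normal[OF derived_self_is_normal _ x_c ac(3)] a_c c_c by simp
      have 2: "inv (\<alpha> \<otimes> \<beta>) \<otimes> (a \<otimes> c) [^] (p - 1) \<in> derived G (carrier G)"
        unfolding \<alpha>_def \<beta>_def by (rule pow_mult_mod_derived[OF a_c c_c])
      have "(inv (\<alpha> \<otimes> \<beta>) \<otimes> (a \<otimes> c) [^] (p - 1)) \<otimes> (inv ((a \<otimes> c) [^] (p - 1)) \<otimes> x [^] (p - 1))
          = inv (\<alpha> \<otimes> \<beta>) \<otimes> x [^] (p - 1)"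
        using \<alpha>c \<beta>c a_c c_c x_c by (simp add: m_assoc)
      then show "inv (\<alpha> \<otimes> \<beta>) \<otimes> x [^] (p - 1) \<in> derived G (carrier G)"
        using subgroup.m_closed[OF D 2 1] by simp
    qed (use KT Kn \<alpha>\<beta> \<alpha>c \<beta>c t in \<open>simp_all add: T_def\<close>)
    then show "z \<in> RA <#> RB" using KS z by blast
  qed
  then have "scalar_residual G \<subseteq> RA <#> RB"
    unfolding scalar_residual_def by (rule generate_subgroup_incl[OF _ S])
  moreover have "RA <#> RB \<subseteq> scalar_residual G"
    using scalar_residual_subgroup[OF AG] scalar_residual_subgroup[OF B]
      subgroup.m_closed[OF normal_imp_subgroup[OF scalar_residual_normal]]
    unfolding RA_def RB_def set_mult_def by blast
  ultimately show ?thesis unfolding RA_def RB_def by blast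
qed

end

theorem corollaryC:
  fixes G :: "('a, 'b) monoid_scheme" (structure) and A B :: "'a set"
  assumes "group G" and "finite (carrier G)"
    and "subgroup A G" and "subgroup B G"
    and "carrier G = A <#> B"
    and "A \<lhd> G"
    and "\<And>Q P M. sylow_subgroup Q (G\<lparr>carrier := B\<rparr>) \<Longrightarrow>
           sylow_subgroup P (G\<lparr>carrier := A\<rparr>) \<Longrightarrow>
           maximal_subgroup M (G\<lparr>carrier := P\<rparr>) \<Longrightarrow>
           permutes_with G Q M"
    and "nilpotent_group (G\<lparr>carrier := derived G (carrier G)\<rparr>)"
  shows "wU_residual G =
           wU_residual (G\<lparr>carrier := A\<rparr>) <#> wU_residual (G\<lparr>carrier := B\<rparr>)"
proof -
  interpret group G by (rule assms(1))
  have "nilpotent_in G (derived G (carrier G))"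
    by (rule nilpotent_in_if_nilpotent_group[OF derived_is_subgroup[OF subset_refl] assms(8)])
  then interpret nilpotent_derived G
    using assms(2) by unfold_locales
  show ?thesis
    using scalar_residual_product[OF assms(6,4,5,7)] wU_residual_eq
      nilpotent_derived.wU_residual_eq[OF nilpotent_derived_restrict[OF assms(3)]]
      nilpotent_derived.wU_residual_eq[OF nilpotent_derived_restrict[OF assms(4)]]
    by simp
qed

end
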